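(* Let $U$ be a bounded open subset of $\mathbb{R}^2$ with $\operatorname{reach}(\partial U)>\rho>0$, and let $W$ be an open set with $W\subset\subset U$. If $\lambda$ satisfies $$0<\frac{2}{\lambda}<\rho,$$ then there exists $\delta>0$ such that for every Lebesgue measurable set $A\subset\subset W$ with $|A|<\delta$, setting $E=\mathbf{E}^2\llcorner(U\setminus A)$, the current $\partial(\mathbf{E}^2\llcorner U)$ is a multiscale flat norm minimizer for $\partial E$ at scale $\lambda$; that is, $\partial(\mathbf{E}^2\llcorner U)=\partial E-\partial S$ for some $S$ attaining the infimum that defines $\mathscr{F}_\lambda(\partial E)$.
   Context: $|\cdot|$ applied to a set denotes 2-dimensional Lebesgue measure. $B\subset\subset C$ means that the closure of $B$ is compact and contained in $C$. $\mathbf{U}(a,r)$ is the open ball of radius $r$ centered at $a$. For $A\subset\mathbb{R}^2$, $\operatorname{Unp}(A)$ is the set of all $x\in\mathbb{R}^2$ for which there is a unique point of $A$ nearest to $x$; for $a\in A$, $\operatorname{reach}(A,a)=\sup\{r:\mathbf{U}(a,r)\subset\operatorname{Unp}(A)\}$, and $\operatorname{reach}(A)=\inf\{\operatorname{reach}(A,a):a\in A\}$. In $\operatorname{reach}(\partial U)$, $\partial U$ is the topological boundary. $\mathbf{E}^2\llcorner B$ denotes the 2-dimensional current in $\mathbb{R}^2$ given by integration of 2-forms over the measurable set $B$ with the standard orientation; $\mathbf{M}$ denotes mass. The multiscale flat norm at scale $\lambda$ of a 1-dimensional current $T$ in $\mathbb{R}^2$ is $$\mathscr{F}_\lambda(T)=\inf_S\{\mathbf{M}(T-\partial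 S)+\lambda\,\mathbf{M}(S)\}$$ over 2-dimensional currents $S$ in $\mathbb{R}^2$. For $T=\partial(\mathbf{E}^2\llcorner B)$ this equals $\inf\{\operatorname{Per}(\Sigma)+\lambda|\Sigma\,\Delta\,B|\}$ over sets $\Sigma\subset\mathbb{R}^2$ of finite perimeter, where $\Delta$ is symmetric difference, with $\Sigma$ corresponding to $S$ via $\mathbf{E}^2\llcorner\Sigma=\mathbf{E}^2\llcorner B-S$. So the conclusion says equivalently that $\Sigma=U$ minimizes $\operatorname{Per}(\Sigma)+\lambda|\Sigma\,\Delta\,(U\setminus A)|$ over sets of finite perimeter. *)

theory Defs
  imports "HOL-Analysis.Analysis"
begin

section \<open>Reach\<close>

definition Unp :: "'a::metric_space set \<Rightarrow> 'a set" where
  "Unp A = {x. \<exists>!a. a \<in> A \<and> (\<forall>b\<in>A. dist x a \<le> dist x b)}"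

text \<open>The supremum and infimum are taken in the extended reals, so the reach may be
  infinite; in particular the empty set has infinite reach.\<close>

definition reach_at :: "'a::metric_space set \<Rightarrow> 'a \<Rightarrow> ereal" where
  "reach_at A a = (SUP r\<in>{r::real. ball a r \<subseteq> Unp A}. ereal r)"

definition reach :: "'a::metric_space set \<Rightarrow> ereal" where
  "reach A = (INF a\<in>A. reach_at A a)"

definition compactly_inside :: "'a::topological_space set \<Rightarrow> 'a set \<Rightarrow> bool"
    (infix "\<subset>\<subset>" 50) where
  "B \<subset>\<subset> C \<longleftrightarrow> compact (closure B) \<and> closure B \<subseteq> C"

section \<open>Test forms on the plane\<close>

definition pderiv_at :: "2 \<Rightarrow> (real^2 \<Rightarrow> 'b::real_normed_vector) \<Rightarrow> real^2 \<Rightarrow> 'b" where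
  "pderiv_at i f x = frechet_derivative f (at x) (axis i 1)"

fun iterated_pderiv :: "2 list \<Rightarrow> (real^2 \<Rightarrow> 'b::real_normed_vector) \<Rightarrow> real^2 \<Rightarrow> 'b" where
  "iterated_pderiv [] f = f"
| "iterated_pderiv (i # is) f = pderiv_at i (iterated_pderiv is f)"

text \<open>All iterated partial derivatives exist and are (totally) differentiable, hence
  continuous; this is \<open>C\<^sup>\<infinity>\<close>.\<close>

definition smooth :: "(real^2 \<Rightarrow> 'b::real_normed_vector) \<Rightarrow> bool" where
  "smooth f \<longleftrightarrow> (\<forall>is x. iterated_pderiv is f differentiable (at x))"

definition supp :: "(real^2 \<Rightarrow> 'b::real_normed_vector) \<Rightarrow> (real^2) set" where
  "supp f = closure {x. f x \<noteq> 0}"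

text \<open>Differential forms on the plane are represented by their coefficients: a 1-form
  \<open>f\<^sub>1 dx\<^sub>1 + f\<^sub>2 dx\<^sub>2\<close> is the function \<open>(f\<^sub>1, f\<^sub>2) :: real^2 \<Rightarrow> real^2\<close>,
  and a 2-form \<open>h dx\<^sub>1 \<and> dx\<^sub>2\<close> is the function \<open>h :: real^2 \<Rightarrow> real\<close>.
  In both degrees every covector of the plane is simple, so the comass of a covector is the
  norm of its coefficient vector. The degree of a form, and hence the dimension of a current,
  is determined by the type of the coefficients.\<close>

definition test_forms :: "(real^2 \<Rightarrow> 'b::real_normed_vector) set" where
  "test_forms = {\<phi>. smooth \<phi> \<and> compact (supp \<phi>)}"

definition ext_deriv :: "(real^2 \<Rightarrow> real^2) \<Rightarrow> (real^2 \<Rightarrow> real)" where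
  "ext_deriv \<phi> x = pderiv_at 1 (\<lambda>y. \<phi> y $ 2) x - pderiv_at 2 (\<lambda>y. \<phi> y $ 1) x"

section \<open>Currents\<close>

text \<open>A current is a continuous linear functional on test forms. Continuity for the usual
  inductive limit topology means that, for each compact \<open>K\<close>, the functional is bounded by
  finitely many \<open>C\<^sup>N\<close> seminorms on the test forms supported in \<open>K\<close>. Only the values on test
  forms are meaningful, so two currents are identified if they agree there.\<close>

definition is_current :: "((real^2 \<Rightarrow> 'b::real_normed_vector) \<Rightarrow> real) \<Rightarrow> bool" where
  "is_current T \<longleftrightarrow>
     (\<forall>\<phi>\<in>test_forms. \<forall>\<psi>\<in>test_forms. T (\<lambda>x. \<phi> x + \<psi> x) = T \<phi> + T \<psi>) \<and>
     (\<forall>c. \<forall>\<phi>\<in>test_forms. T (\<lambda>x. c *\<^sub>R \<phi> x) = c * T \<phi>) \<and>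
     (\<forall>K. compact K \<longrightarrow> (\<exists>C N. \<forall>\<phi>\<in>test_forms. supp \<phi> \<subseteq> K \<longrightarrow>
        \<bar>T \<phi>\<bar> \<le> C * (\<Sum>is | length is \<le> N. SUP x. norm (iterated_pderiv is \<phi> x))))"

definition current_eq ::
    "((real^2 \<Rightarrow> 'b::real_normed_vector) \<Rightarrow> real) \<Rightarrow> ((real^2 \<Rightarrow> 'b) \<Rightarrow> real) \<Rightarrow> bool" where
  "current_eq T T' \<longleftrightarrow> (\<forall>\<phi>\<in>test_forms. T \<phi> = T' \<phi>)"

definition current_diff ::
    "((real^2 \<Rightarrow> 'b::real_normed_vector) \<Rightarrow> real) \<Rightarrow> ((real^2 \<Rightarrow> 'b) \<Rightarrow> real)
      \<Rightarrow> ((real^2 \<Rightarrow> 'b) \<Rightarrow> real)" where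
  "current_diff T T' \<phi> = T \<phi> - T' \<phi>"

definition boundary ::
    "((real^2 \<Rightarrow> real) \<Rightarrow> real) \<Rightarrow> ((real^2 \<Rightarrow> real^2) \<Rightarrow> real)" where
  "boundary S \<phi> = S (ext_deriv \<phi>)"

definition mass :: "((real^2 \<Rightarrow> 'b::real_normed_vector) \<Rightarrow> real) \<Rightarrow> ereal" where
  "mass T = (SUP \<phi>\<in>{\<phi>\<in>test_forms. \<forall>x. norm (\<phi> x) \<le> 1}. ereal (T \<phi>))"

text \<open>The current \<open>\<^bold>E\<^sup>2\<close> restricted to \<open>B\<close>, for \<open>B\<close> Lebesgue measurable.\<close>

definition E2 :: "(real^2) set \<Rightarrow> ((real^2 \<Rightarrow> real) \<Rightarrow> real)" where
  "E2 B h = (LINT x:B|lebesgue. h x)"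

section \<open>The multiscale flat norm\<close>

definition flat_cost ::
    "real \<Rightarrow> ((real^2 \<Rightarrow> real^2) \<Rightarrow> real) \<Rightarrow> ((real^2 \<Rightarrow> real) \<Rightarrow> real) \<Rightarrow> ereal" where
  "flat_cost lam T S = mass (current_diff T (boundary S)) + ereal lam * mass S"

definition flat_norm :: "real \<Rightarrow> ((real^2 \<Rightarrow> real^2) \<Rightarrow> real) \<Rightarrow> ereal" where
  "flat_norm lam T = (INF S\<in>{S. is_current S}. flat_cost lam T S)"

definition flat_norm_minimizer ::
    "real \<Rightarrow> ((real^2 \<Rightarrow> real^2) \<Rightarrow> real) \<Rightarrow> ((real^2 \<Rightarrow> real^2) \<Rightarrow> real) \<Rightarrow> bool" where
  "flat_norm_minimizer lam T T' \<longleftrightarrow>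
     (\<exists>S. is_current S \<and> current_eq T' (current_diff T (boundary S)) \<and>
          flat_cost lam T S = flat_norm lam T)"

end

theory Submission
  imports Defs "HOL-Computational_Algebra.Polynomial"
begin

text \<open>The theorem is proved by calibration. For a vector field \<open>v\<close> with \<open>norm v \<le> 1\<close> and
  \<open>\<bar>div v\<bar> \<le> lam\<close>, testing both masses with \<open>v\<close> and \<open>div v / lam\<close> bounds the cost of every
  competitor from below by the integral of \<open>div v\<close> over \<open>U - A\<close>, so it suffices to find
  \<open>v\<close> that is almost normal along the boundary of \<open>U\<close> and has divergence \<open>-lam\<close> on
  most of \<open>A\<close>.

  Positive reach gives every point off the boundary a ball of radius \<open>\<rho>\<close> within distance less than
  \<open>\<rho>\<close> that misses the boundary. Let \<open>C\<close> be the set of centres of such balls inside \<open>U\<close>, and let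
  \<open>u\<close> be the largest function with \<open>u \<le> 0\<close> and \<open>u \<le> - \<rho> + (dist x c)\<^sup>2 / (2 * \<rho>)\<close> for \<open>c \<in> C\<close> such
  that \<open>u + (norm x)\<^sup>2 / (2 * \<rho>)\<close> is convex. Being a convex envelope, \<open>u\<close> is semiconcave with
  the same constant, so its Hessian has norm at most \<open>1 / \<rho>\<close> and its Laplacian is at most
  \<open>2 / \<rho> < lam\<close>. Moreover \<open>U\<close> is the sublevel set \<open>u < - \<rho> / 2\<close> up to a null set, the gradient
  of \<open>u\<close> has norm at most one, tends to norm one at that level, and is strictly shorter in the
  interior. Hence (mollifications of) \<open>grad u\<close> calibrate \<open>U\<close> and leave room in the interior
  for a small correction that changes the divergence to \<open>-lam\<close> on \<open>A\<close>; the correction is small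
  because \<open>A\<close> has small area.\<close>

section \<open>Smooth functions and test forms\<close>

text \<open>The paraboloids fix all constants. The upper barrier
  \<open>- \<rho> + (dist x c)\<^sup>2 / (2 * \<rho>)\<close> around an inner centre and the lower
  one \<open>- (dist x c)\<^sup>2 / (2 * \<rho>)\<close> around an outer centre have Hessians of
  norm 1 / \<rho>. At distance \<rho> from their centres both have value - \<rho> / 2 and a gradient
  of length one, which singles out that level. The 2 in the hypothesis on \<open>lam\<close> is the
  dimension: the trace of a Hessian of norm at most 1 / \<rho>. The signed distance is a worse
  candidate: its second derivatives grow towards the cut locus, and its unit gradient leaves no room
  for a correction in the interior. Since \<open>u\<close> has only Lipschitz first derivatives and
  test forms are smooth, a separate calibrating form is built for each competitor form \<psi> and
  tolerance \<open>e\<close>. The area threshold \<delta> has to precede both. This works because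
  mollification keeps the second-difference constant of \<open>u\<close> and, at small scale, the
  gap in its gradient on a compact part of \<open>U\<close>. The strict inequality 2 / \<rho> <
  \<open>lam\<close> pays for the cut-off that confines the correction to \<open>U\<close>.\<close>

lemma pderiv_atI: "(f has_derivative D) (at x) \<Longrightarrow> pderiv_at i f x = D (axis i 1)"
  unfolding pderiv_at_def using frechet_derivative_at by metis

lemma iterated_pderiv_append: "iterated_pderiv (js @ ks) f = iterated_pderiv js (iterated_pderiv ks f)"
  by (induction js) auto

lemma smooth_pderiv_at: "smooth f \<Longrightarrow> smooth (pderiv_at i f)"
  unfolding smooth_def
proof (intro allI)
  fix js x
  assume "\<forall>is x. iterated_pderiv is f differentiable at x"
  then have "iterated_pderiv (js @ [i]) f differentiable at x" by blast
  then show "iterated_pderiv js (pderiv_at i f) differentiable at x"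
    by (simp add: iterated_pderiv_append)
qed

lemma smooth_differentiable: "smooth f \<Longrightarrow> f differentiable (at x)"
  unfolding smooth_def by (metis iterated_pderiv.simps(1))

lemma smooth_continuous_on: "smooth f \<Longrightarrow> continuous_on S f"
  by (meson continuous_at_imp_continuous_on differentiable_imp_continuous_within smooth_differentiable)

text \<open>By induction on the index list every iterated partial derivative of \<open>f\<close>
  stays in \<open>S\<close>. Smoothness proofs then only have to name a suitable family closed under
  \<open>pderiv_at\<close>.\<close>

lemma smooth_coinduct:
  assumes "f \<in> S" and diff: "\<And>g x. g \<in> S \<Longrightarrow> g differentiable (at x)"
    and step: "\<And>g i. g \<in> S \<Longrightarrow> pderiv_at i g \<in> S"
  shows "smooth f"
proof -
  have "iterated_pderiv js f \<in> S" for js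
    by (induction js) (use assms(1) step in auto)
  then show ?thesis unfolding smooth_def using diff by blast
qed

lemma pderiv_at_bounded_linear:
  assumes "bounded_linear L" and "f differentiable (at x)"
  shows "(\<lambda>y. L (f y)) differentiable (at x)"
    and "pderiv_at i (\<lambda>y. L (f y)) x = L (pderiv_at i f x)"
proof -
  obtain D where D: "(f has_derivative D) (at x)"
    using assms(2) unfolding differentiable_def by blast
  have LD: "((\<lambda>y. L (f y)) has_derivative (\<lambda>h. L (D h))) (at x)"
    using bounded_linear.has_derivative[OF assms(1) D] .
  show "(\<lambda>y. L (f y)) differentiable (at x)" using LD unfolding differentiable_def by blast
  show "pderiv_at i (\<lambda>y. L (f y)) x = L (pderiv_at i f x)"
    using pderiv_atI[OF LD] pderiv_atI[OF D] by simp
qed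

lemma smooth_bounded_linear:
  assumes "bounded_linear L" and "smooth f"
  shows "smooth (\<lambda>y. L (f y))"
proof (rule smooth_coinduct[where S = "{\<lambda>y. L (g y) | g. smooth g}"], goal_cases)
  case 1
  then show ?case using assms(2) by blast
next
  case (2 g x)
  then show ?case
    using pderiv_at_bounded_linear(1)[OF assms(1)] smooth_differentiable by blast
next
  case (3 g i)
  then obtain g' where g': "g = (\<lambda>y. L (g' y))" "smooth g'" by blast
  have "pderiv_at i g = (\<lambda>y. L (pderiv_at i g' y))"
    unfolding g'(1) using pderiv_at_bounded_linear(2)[OF assms(1)] smooth_differentiable[OF g'(2)] by blast
  then show ?case using smooth_pderiv_at[OF g'(2)] by blast
qed

lemma pderiv_at_add:
  assumes "f differentiable (at x)" "g differentiable (at x)"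
  shows "pderiv_at i (\<lambda>y. f y + g y) x = pderiv_at i f x + pderiv_at i g x"
proof -
  obtain D E where D: "(f has_derivative D) (at x)" and E: "(g has_derivative E) (at x)"
    using assms unfolding differentiable_def by blast
  show ?thesis
    using pderiv_atI[OF has_derivative_add[OF D E]] pderiv_atI[OF D] pderiv_atI[OF E] by simp
qed

lemma pderiv_at_mult:
  fixes f g :: "real^2 \<Rightarrow> real"
  assumes "f differentiable (at x)" "g differentiable (at x)"
  shows "pderiv_at i (\<lambda>y. f y * g y) x = pderiv_at i f x * g x + f x * pderiv_at i g x"
proof -
  obtain D E where D: "(f has_derivative D) (at x)" and E: "(g has_derivative E) (at x)"
    using assms unfolding differentiable_def by blast
  show ?thesis
    using pderiv_atI[OF has_derivative_mult[OF D E]] pderiv_atI[OF D] pderiv_atI[OF E] by simp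
qed

lemma smooth_add:
  assumes "smooth f" "smooth g"
  shows "smooth (\<lambda>y. f y + g y)"
proof (rule smooth_coinduct[where S = "{\<lambda>y. f y + g y | f g. smooth f \<and> smooth g}"], goal_cases)
  case 1
  then show ?case using assms by blast
next
  case (2 g x)
  then show ?case using smooth_differentiable differentiable_add by fastforce
next
  case (3 h i)
  then obtain f g where h: "h = (\<lambda>y. f y + g y)" "smooth f" "smooth g" by blast
  have "pderiv_at i h = (\<lambda>y. pderiv_at i f y + pderiv_at i g y)"
    unfolding h(1) using pderiv_at_add smooth_differentiable h by blast
  then show ?case using smooth_pderiv_at h by blast
qed

text \<open>The Leibniz rule turns the derivative of one product into a sum of two, so single
  products do not form a family for \<open>smooth_coinduct\<close>; their finite sums do.\<close>

inductive_set product_sums :: "(real^2 \<Rightarrow> real) set" where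
  base: "smooth f \<Longrightarrow> smooth g \<Longrightarrow> (\<lambda>x. f x * g x) \<in> product_sums"
| add: "f \<in> product_sums \<Longrightarrow> g \<in> product_sums \<Longrightarrow> (\<lambda>x. f x + g x) \<in> product_sums"

lemma smooth_mult:
  fixes f g :: "real^2 \<Rightarrow> real"
  assumes "smooth f" "smooth g"
  shows "smooth (\<lambda>y. f y * g y)"
proof -
  have *: "(\<forall>x. h differentiable (at x)) \<and> (\<forall>i. pderiv_at i h \<in> product_sums)"
    if "h \<in> product_sums" for h
    using that
  proof induction
    case (base f g)
    have "pderiv_at i (\<lambda>x. f x * g x) = (\<lambda>x. pderiv_at i f x * g x + f x * pderiv_at i g x)" for i
      using pderiv_at_mult smooth_differentiable base by blast
    then show ?case
      using base smooth_pderiv_at smooth_differentiable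
      by (auto intro!: product_sums.intros differentiable_mult)
  next
    case (add f g)
    have "pderiv_at i (\<lambda>x. f x + g x) = (\<lambda>x. pderiv_at i f x + pderiv_at i g x)" for i
      using pderiv_at_add add.IH by blast
    then show ?case
      using add by (auto intro!: product_sums.intros differentiable_add)
  qed
  show ?thesis
    by (rule smooth_coinduct[where S = product_sums]) (use * assms product_sums.base in auto)
qed

lemma smooth_minus: "smooth f \<Longrightarrow> smooth g \<Longrightarrow> smooth (\<lambda>y. f y - g y)"
  using smooth_add[OF _ smooth_bounded_linear[OF bounded_linear_minus[OF bounded_linear_ident]], of f g]
  by simp

lemma pderiv_at_const [simp]: "pderiv_at i (\<lambda>_. c) x = 0"
  by (rule pderiv_atI) (rule has_derivative_const)

lemma smooth_const [simp]: "smooth (\<lambda>_. c)"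
proof (rule smooth_coinduct[where S = "range (\<lambda>c _. c)"], goal_cases)
  case (3 g i)
  then have "pderiv_at i g = (\<lambda>_. 0)" by fastforce
  then show ?case by blast
qed auto

lemma smooth_vec2:
  assumes "smooth f" "smooth g"
  shows "smooth (\<lambda>x. vector [f x, g x] :: real^2)"
proof -
  have "smooth (\<lambda>x. f x *\<^sub>R axis 1 1 + g x *\<^sub>R (axis 2 1 :: real^2))"
    by (intro smooth_add smooth_bounded_linear[OF bounded_linear_scaleR_left] assms)
  moreover have "(\<lambda>x. f x *\<^sub>R axis 1 1 + g x *\<^sub>R (axis 2 1 :: real^2)) = (\<lambda>x. vector [f x, g x])"
    by (auto simp: vec_eq_iff forall_2 axis_def)
  ultimately show ?thesis by simp
qed

lemma smooth_nth: "smooth f \<Longrightarrow> smooth (\<lambda>x. f x $ i)" for f :: "real^2 \<Rightarrow> real^'n"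
  by (rule smooth_bounded_linear[OF bounded_linear_vec_nth])

lemma test_forms_smooth: "f \<in> test_forms \<Longrightarrow> smooth f"
  unfolding test_forms_def by blast

lemma test_formsI:
  assumes "smooth f" "\<And>x. norm x > B \<Longrightarrow> f x = 0"
  shows "f \<in> test_forms"
proof -
  have "supp f \<subseteq> cball 0 B" unfolding supp_def
    by (rule closure_minimal) (use assms(2) in force)+
  moreover have "closed (supp f)" unfolding supp_def by simp
  ultimately show ?thesis
    using assms(1) compact_Int_closed[OF compact_cball] unfolding test_forms_def
    by (metis (mono_tags, lifting) inf.absorb_iff2 mem_Collect_eq)
qed

lemma test_forms_support:
  assumes "f \<in> test_forms"
  shows "\<exists>B>0. \<forall>x. norm x > B \<longrightarrow> f x = 0"
proof -
  have "bounded (supp f)" using assms by (simp add: test_forms_def compact_imp_bounded)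
  from bounded_subset_ballD[OF this, of 0]
  obtain B where B: "B > 0" "supp f \<subseteq> ball 0 B" by auto
  have "f x = 0" if "norm x > B" for x
  proof (rule ccontr)
    assume "f x \<noteq> 0"
    then have "x \<in> supp f" unfolding supp_def using closure_subset[of "{x. f x \<noteq> 0}"] by blast
    then show False using B(2) that by auto
  qed
  then show ?thesis using B(1) by blast
qed

lemma pderiv_at_eq_0_outside:
  assumes "\<And>x. norm x > B \<Longrightarrow> f x = 0" "norm x > B"
  shows "pderiv_at i f x = 0"
proof -
  have "(f has_derivative (\<lambda>_. 0)) (at x)"
    by (rule has_derivative_transform_within_open[OF has_derivative_const, where s = "- cball 0 B"])
      (use assms in auto)
  from pderiv_atI[OF this] show ?thesis by simp
qed

lemma pderiv_at_locally_const:
  assumes "open S" "x \<in> S" "\<And>y. y \<in> S \<Longrightarrow> f y = c"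
  shows "pderiv_at i f x = 0"
proof -
  have "(f has_derivative (\<lambda>_. 0)) (at x)"
    by (rule has_derivative_transform_within_open[OF has_derivative_const, where s = S])
      (use assms in auto)
  from pderiv_atI[OF this] show ?thesis by simp
qed

lemma pderiv_at_test_forms:
  assumes "f \<in> test_forms"
  shows "pderiv_at i f \<in> test_forms"
proof -
  obtain B where "B > 0" "\<forall>x. norm x > B \<longrightarrow> f x = 0" using test_forms_support[OF assms] by blast
  then show ?thesis
    using pderiv_at_eq_0_outside[of B f _ i]
    by (intro test_formsI[of _ B], intro smooth_pderiv_at test_forms_smooth assms) blast+
qed

lemma test_forms_nth:
  fixes f :: "real^2 \<Rightarrow> real^'n"
  assumes "f \<in> test_forms"
  shows "(\<lambda>x. f x $ i) \<in> test_forms"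
proof -
  obtain B where "B > 0" "\<forall>x. norm x > B \<longrightarrow> f x = 0" using test_forms_support[OF assms] by blast
  then show ?thesis
    by (intro test_formsI[of _ B], intro smooth_nth test_forms_smooth assms) simp
qed

lemma test_forms_add:
  assumes "f \<in> test_forms" "g \<in> test_forms"
  shows "(\<lambda>x. f x + g x) \<in> test_forms"
proof -
  obtain B where "B > 0" "\<forall>x. norm x > B \<longrightarrow> f x = 0" using test_forms_support[OF assms(1)] by blast
  moreover obtain C where "C > 0" "\<forall>x. norm x > C \<longrightarrow> g x = 0" using test_forms_support[OF assms(2)] by blast
  ultimately show ?thesis
    by (intro test_formsI[of _ "max B C"], intro smooth_add test_forms_smooth assms) simp
qed

lemma test_forms_mult:
  fixes f g :: "real^2 \<Rightarrow> real"
  assumes "f \<in> test_forms" "smooth g"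
  shows "(\<lambda>x. f x * g x) \<in> test_forms"
proof -
  obtain B where "B > 0" "\<forall>x. norm x > B \<longrightarrow> f x = 0" using test_forms_support[OF assms(1)] by blast
  then show ?thesis
    by (intro test_formsI[of _ B], intro smooth_mult test_forms_smooth assms) simp
qed

lemma test_forms_scaleR:
  assumes "f \<in> test_forms"
  shows "(\<lambda>x. c *\<^sub>R f x) \<in> test_forms"
proof -
  obtain B where "B > 0" "\<forall>x. norm x > B \<longrightarrow> f x = 0" using test_forms_support[OF assms(1)] by blast
  then show ?thesis
    by (intro test_formsI[of _ B], intro smooth_bounded_linear[OF bounded_linear_scaleR_right] test_forms_smooth assms) simp
qed

lemma test_forms_vec2:
  assumes "f \<in> test_forms" "g \<in> test_forms"
  shows "(\<lambda>x. vector [f x, g x] :: real^2) \<in> test_forms"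
proof -
  obtain B where "B > 0" "\<forall>x. norm x > B \<longrightarrow> f x = 0" using test_forms_support[OF assms(1)] by blast
  moreover obtain C where "C > 0" "\<forall>x. norm x > C \<longrightarrow> g x = 0" using test_forms_support[OF assms(2)] by blast
  ultimately show ?thesis
    by (intro test_formsI[of _ "max B C"], intro smooth_vec2 test_forms_smooth assms)
      (simp add: vec_eq_iff forall_2)
qed

lemma test_forms_bounded:
  assumes "f \<in> test_forms"
  shows "\<exists>C>0. \<forall>x. norm (f x) \<le> C"
proof -
  obtain B where B: "B > 0" "\<forall>x. norm x > B \<longrightarrow> f x = 0" using test_forms_support[OF assms] by blast
  have "compact (f ` cball 0 B)"
    by (intro compact_continuous_image smooth_continuous_on test_forms_smooth assms) simp
  then obtain C where C: "C > 0" "\<And>y. y \<in> f ` cball 0 B \<Longrightarrow> norm y \<le> C"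
    using bounded_pos[of "f ` cball 0 B"] compact_imp_bounded by blast
  have "norm (f x) \<le> C" for x
    using B(2) C by (cases "norm x > B") auto
  then show ?thesis using C(1) by blast
qed

lemma ext_deriv_test_forms:
  assumes "\<phi> \<in> test_forms"
  shows "ext_deriv \<phi> \<in> test_forms"
proof -
  have "(\<lambda>x. pderiv_at 1 (\<lambda>y. \<phi> y $ 2) x + (-1) *\<^sub>R pderiv_at 2 (\<lambda>y. \<phi> y $ 1) x) \<in> test_forms"
    by (intro test_forms_add test_forms_scaleR pderiv_at_test_forms test_forms_nth assms)
  moreover have "(\<lambda>x. pderiv_at 1 (\<lambda>y. \<phi> y $ 2) x + (-1) *\<^sub>R pderiv_at 2 (\<lambda>y. \<phi> y $ 1) x) = ext_deriv \<phi>"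
    by (auto simp: ext_deriv_def)
  ultimately show ?thesis by simp
qed

definition grad :: "(real^2 \<Rightarrow> real) \<Rightarrow> real^2 \<Rightarrow> real^2" where
  "grad f x = vector [pderiv_at 1 f x, pderiv_at 2 f x]"

lemma has_derivative_grad:
  assumes "f differentiable (at x)"
  shows "(f has_derivative (\<lambda>h. grad f x \<bullet> h)) (at x)"
proof -
  obtain D where D: "(f has_derivative D) (at x)"
    using assms unfolding differentiable_def by blast
  interpret bounded_linear D using D by (rule has_derivative_bounded_linear)
  have "D h = grad f x \<bullet> h" for h
  proof -
    have "h = (h$1) *\<^sub>R axis 1 1 + (h$2) *\<^sub>R axis 2 1"
      by (simp add: vec_eq_iff forall_2 axis_def)
    then have "D h = (h$1) * D (axis 1 1) + (h$2) * D (axis 2 1)"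
      by (metis add scaleR real_scaleR_def)
    then show ?thesis
      by (simp add: grad_def inner_vec_def sum_2 pderiv_atI[OF D] mult.commute)
  qed
  then have "D = (\<lambda>h. grad f x \<bullet> h)" by blast
  then show ?thesis using D by simp
qed

section \<open>Sets of positive reach\<close>

lemma compact_subset_cball:
  fixes S :: "'a::real_normed_vector set"
  assumes "compact S"
  shows "\<exists>B. S \<subseteq> cball 0 B"
  using compact_imp_bounded[OF assms] unfolding bounded_iff subset_iff mem_cball_0 by blast

text \<open>The reach is used at a nearest point \<open>p\<close> of \<open>z\<close>: some ball
  around \<open>p\<close> of radius larger than \<rho> consists of points with unique projection,
  and it contains \<open>z\<close>.\<close>

lemma Unp_of_reach:
  fixes \<Gamma> :: "'a::euclidean_space set"
  assumes "closed \<Gamma>" "\<Gamma> \<noteq> {}" "ereal \<rho> < reach \<Gamma>" "infdist z \<Gamma> \<le> \<rho>"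
  shows "z \<in> Unp \<Gamma>"
proof -
  obtain p where p: "p \<in> \<Gamma>" "infdist z \<Gamma> = dist z p"
    using infdist_attains_inf[OF assms(1,2)] by blast
  have "ereal \<rho> < reach_at \<Gamma> p"
    using assms(3) p(1) unfolding reach_def by (meson INF_lower less_le_trans)
  then obtain r where r: "ball p r \<subseteq> Unp \<Gamma>" "\<rho> < r"
    unfolding reach_at_def less_SUP_iff by auto
  have "z \<in> ball p r" using p assms(4) r(2) by (simp add: dist_commute)
  then show ?thesis using r(1) by blast
qed

text \<open>Moving away from the unique nearest point \<open>p\<close> along the normal raises the
  distance at a rate close to one. Uniqueness keeps the nearest points of the moved point close to
  \<open>p\<close>, so they are left behind almost as fast as \<open>p\<close> itself.\<close>

lemma infdist_ascent:
  fixes \<Gamma> :: "'a::euclidean_space set"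
  assumes "closed \<Gamma>" "\<Gamma> \<noteq> {}" "z \<in> Unp \<Gamma>" "z \<notin> \<Gamma>" "0 < \<eta>" "\<eta> < 1" "0 < e"
  shows "\<exists>z'. 0 < dist z z' \<and> dist z z' < e \<and> infdist z' \<Gamma> > infdist z \<Gamma> + (1 - \<eta>) * dist z z'"
proof -
  define d where "d = infdist z \<Gamma>"
  obtain p where p: "p \<in> \<Gamma>" "d = dist z p"
    using infdist_attains_inf[OF assms(1,2), of z] unfolding d_def by blast
  have dpos: "d > 0" using p assms(4) by auto
  have nearest: "dist z p \<le> dist z b" if "b \<in> \<Gamma>" for b
    using infdist_le[OF that, of z] p(2) d_def by simp
  have uniq: "q = p" if "q \<in> \<Gamma>" "dist z q \<le> d" for q
  proof -
    from assms(3) have "\<exists>!a. a \<in> \<Gamma> \<and> (\<forall>b\<in>\<Gamma>. dist z a \<le> dist z b)" by (simp add: Unp_def)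
    moreover have "\<forall>b\<in>\<Gamma>. dist z q \<le> dist z b" using that(2) p(2) nearest by fastforce
    ultimately show ?thesis using that(1) p(1) nearest by blast
  qed
  \<comment> \<open>In the squared distance the deviation from \<open>p\<close> costs 2 h \<kappa> =
    h d \<eta>, half of the 2 h d \<eta> that the target rate 1 - \<eta> gives away.\<close>
  define \<kappa> where "\<kappa> = \<eta> * d / 2"
  have \<kappa>: "0 < \<kappa>" unfolding \<kappa>_def using assms dpos by simp
  define K where "K = \<Gamma> - ball p \<kappa>"
  have "closed K" unfolding K_def using assms(1) by (simp add: closed_Diff)
  \<comment> \<open>Gap by compactness: the points of \<Gamma> outside
    \<open>ball p \<kappa>\<close> form a closed set without nearest points of \<open>z\<close>, so
    their distance from \<open>z\<close> exceeds \<open>d\<close> by a fixed amount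
    \<open>h0\<close>.\<close>
  obtain h0 where h0: "h0 > 0" "\<And>q. q \<in> \<Gamma> \<Longrightarrow> dist z q < d + h0 \<Longrightarrow> dist p q < \<kappa>"
  proof (cases "K = {}")
    case True
    show ?thesis by (rule that[of 1]) (use True K_def in auto)
  next
    case False
    then obtain q0 where q0: "q0 \<in> K" "infdist z K = dist z q0"
      using infdist_attains_inf[OF \<open>closed K\<close>] by blast
    have "dist z q0 > d" using uniq[of q0] q0(1) \<kappa> unfolding K_def by force
    moreover have "dist p q < \<kappa>" if "q \<in> \<Gamma>" "dist z q < d + (dist z q0 - d)" for q
    proof (rule ccontr)
      assume "\<not> dist p q < \<kappa>"
      then have "q \<in> K" using that(1) unfolding K_def by auto
      then show False using infdist_le[of q K z] q0(2) that(2) by auto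
    qed
    ultimately show ?thesis using that[of "dist z q0 - d"] by simp
  qed
  \<comment> \<open>A nearest point of \<open>z'\<close> lies within d + 2 h of \<open>z\<close>,
    and this must stay below d + h0.\<close>
  define h where "h = min (h0 / 3) (e / 2)"
  have h: "0 < h" "h < e" "2 * h < h0" unfolding h_def using h0(1) assms(7) by auto
  define n where "n = (z - p) /\<^sub>R d"
  have dn: "d *\<^sub>R n = z - p" and nn: "norm n = 1"
    using dpos p(2) unfolding n_def by (simp_all add: dist_norm)
  define z' where "z' = z + h *\<^sub>R n"
  have dz: "dist z z' = h" unfolding z'_def dist_norm using h nn by simp
  obtain p' where p': "p' \<in> \<Gamma>" "infdist z' \<Gamma> = dist z' p'"
    using infdist_attains_inf[OF assms(1,2), of z'] by blast
  have "dist z' p' \<le> dist z' p" using infdist_le[OF p(1), of z'] p'(2) by simp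
  also have "\<dots> \<le> h + d" using dz p(2) dist_triangle[of z' p z] by (simp add: dist_commute)
  finally have "dist z p' \<le> 2 * h + d" using dz dist_triangle[of z p' z'] by simp
  then have pp: "dist p p' < \<kappa>" using h0(2)[OF p'(1)] h(3) by simp
  have zp': "norm (z - p') \<ge> d" using nearest[OF p'(1)] p(2) by (simp add: dist_norm)
  have "n \<bullet> (z - p') = n \<bullet> (d *\<^sub>R n) + n \<bullet> (p - p')"
    unfolding dn by (simp add: algebra_simps)
  moreover have "n \<bullet> (d *\<^sub>R n) = d" using nn by (simp add: dot_square_norm)
  moreover have "n \<bullet> (p - p') \<ge> - \<kappa>"
    using Cauchy_Schwarz_ineq2[of n "p - p'"] nn pp by (simp add: dist_norm)
  ultimately have ip: "n \<bullet> (z - p') \<ge> d - \<kappa>" by linarith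
  have "(norm (z' - p'))\<^sup>2 = (norm (z - p'))\<^sup>2 + 2 * h * (n \<bullet> (z - p')) + h\<^sup>2"
    unfolding z'_def power2_norm_eq_inner using nn
    by (simp add: inner_simps inner_commute power2_eq_square norm_eq_1 algebra_simps)
  also have "\<dots> \<ge> d\<^sup>2 + 2 * h * (d - \<kappa>) + h\<^sup>2"
    using zp' dpos ip h(1) by (intro add_mono mult_left_mono power_mono) auto
  finally have *: "(norm (z' - p'))\<^sup>2 \<ge> d\<^sup>2 + 2 * h * (d - \<kappa>) + h\<^sup>2" .
  have "(1 - \<eta>)\<^sup>2 \<le> 1" using assms by (simp add: power_le_one)
  then have "(1 - \<eta>)\<^sup>2 * h\<^sup>2 \<le> h\<^sup>2" using mult_right_mono[of _ 1 "h\<^sup>2"] by simp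
  moreover have "0 < h * d * \<eta>" using h dpos assms by simp
  ultimately have "(d + (1 - \<eta>) * h)\<^sup>2 < d\<^sup>2 + 2 * h * (d - \<kappa>) + h\<^sup>2"
    unfolding \<kappa>_def by (simp add: power2_eq_square algebra_simps)
  then have "d + (1 - \<eta>) * h < norm (z' - p')"
    using * power2_less_imp_less[of "d + (1 - \<eta>) * h" "norm (z' - p')"] by simp
  then show ?thesis using dz h p'(2) unfolding d_def by (intro exI[of _ z']) (simp add: dist_norm)
qed

text \<open>If \<open>x\<close> is closer than \<rho> to \<Gamma>, walking away from \<Gamma> at
  unit rate for the missing distance \<open>r\<close> would reach a centre at distance \<rho> from
  \<Gamma>. Maximising the distance over \<open>cball x r\<close> replaces the walk. Since
  \<open>r\<close> is less than \<rho>, the resulting ball still contains \<open>x\<close>.\<close>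

lemma empty_ball_of_reach:
  fixes \<Gamma> :: "'a::euclidean_space set"
  assumes "closed \<Gamma>" "\<Gamma> \<noteq> {}" "ereal \<rho> < reach \<Gamma>" "0 < \<rho>" "x \<notin> \<Gamma>"
  shows "\<exists>c. dist x c < \<rho> \<and> ball c \<rho> \<inter> \<Gamma> = {}"
proof -
  define s where "s = infdist x \<Gamma>"
  have spos: "s > 0" unfolding s_def using assms infdist_pos_not_in_closed by blast
  have far: "ball c \<rho> \<inter> \<Gamma> = {}" if "infdist c \<Gamma> \<ge> \<rho>" for c
    using that infdist_le[of _ \<Gamma> c] by force
  show ?thesis
  proof (cases "s \<ge> \<rho>")
    case True
    then show ?thesis using far assms(4) unfolding s_def by (intro exI[of _ x]) simp
  next
    case False
    define r where "r = \<rho> - s"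
    have r: "r > 0" using False unfolding r_def by simp
    have ne: "cball x r \<noteq> {}" using r by auto
    have "continuous_on (cball x r) (\<lambda>z. infdist z \<Gamma>)" by (intro continuous_intros)
    from continuous_attains_sup[OF compact_cball ne this]
    obtain c where c: "c \<in> cball x r" "\<forall>z\<in>cball x r. infdist z \<Gamma> \<le> infdist c \<Gamma>"
      by blast
    \<comment> \<open>A maximiser \<open>w\<close> of the penalised distance cannot be interior: it
      would have a unique nearest point, and \<open>infdist_ascent\<close> would beat the penalty.
      The point \<open>c\<close> does not depend on \<eta>, so \<eta> can tend to 0
      afterwards.\<close>
    have grow: "infdist c \<Gamma> \<ge> s + (1 - \<eta>) * r" if \<eta>: "0 < \<eta>" "\<eta> < 1" for \<eta>
    proof -
      have "continuous_on (cball x r) (\<lambda>z. infdist z \<Gamma> - (1 - \<eta>) * dist x z)" by (intro continuous_intros)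
      from continuous_attains_sup[OF compact_cball ne this]
      obtain w where w: "w \<in> cball x r"
        "\<forall>z\<in>cball x r. infdist z \<Gamma> - (1 - \<eta>) * dist x z \<le> infdist w \<Gamma> - (1 - \<eta>) * dist x w"
        by blast
      have ws: "infdist w \<Gamma> \<ge> s + (1 - \<eta>) * dist x w"
        using bspec[OF w(2), of x] r unfolding s_def by simp
      have "dist x w = r"
      proof (rule ccontr)
        assume "dist x w \<noteq> r"
        then have lt: "dist x w < r" using w(1) by simp
        have "infdist w \<Gamma> \<le> s + dist x w"
          unfolding s_def using infdist_triangle[of w \<Gamma> x] by (simp add: dist_commute)
        then have "w \<in> Unp \<Gamma>" using lt Unp_of_reach[OF assms(1-3)] unfolding r_def by simp
        moreover have "0 \<le> (1 - \<eta>) * dist x w" using \<eta> by simp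
        then have "infdist w \<Gamma> > 0" using ws spos by linarith
        then have "w \<notin> \<Gamma>" by auto
        ultimately obtain z' where z': "0 < dist w z'" "dist w z' < r - dist x w"
          "infdist z' \<Gamma> > infdist w \<Gamma> + (1 - \<eta>) * dist w z'"
          using infdist_ascent[OF assms(1,2), of w \<eta> "r - dist x w"] \<eta> lt by auto
        have t: "dist x z' \<le> dist x w + dist w z'" by (rule dist_triangle)
        then have "z' \<in> cball x r" using z'(2) by simp
        moreover have "(1 - \<eta>) * dist x z' \<le> (1 - \<eta>) * dist x w + (1 - \<eta>) * dist w z'"
          using mult_left_mono[OF t, of "1 - \<eta>"] \<eta> by (simp add: distrib_left)
        ultimately show False using bspec[OF w(2), of z'] z'(3) by simp
      qed
      then show ?thesis using ws bspec[OF c(2) w(1)] by simp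
    qed
    have "infdist c \<Gamma> \<ge> \<rho>"
    proof (rule field_le_epsilon)
      fix e :: real assume e: "0 < e"
      define \<eta> where "\<eta> = min (1/2) (e / r)"
      have "\<eta> * r \<le> e" unfolding \<eta>_def using r by (simp add: min_def field_simps)
      moreover have "s + (1 - \<eta>) * r \<le> infdist c \<Gamma>"
        by (rule grow) (use e r in \<open>auto simp: \<eta>_def\<close>)
      ultimately show "\<rho> \<le> infdist c \<Gamma> + e" unfolding r_def by (simp add: algebra_simps)
    qed
    then show ?thesis using far c(1) spos unfolding r_def by (intro exI[of _ c]) simp
  qed
qed

text \<open>Translates of \<open>D\<close> by distinct multiples of \<open>e\<close> between 0 and
  \<open>r\<close> are pairwise disjoint, have equal measure and lie in one bounded set. Infinitely
  many of them force measure zero.\<close>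

lemma negligible_disjoint_translates:
  fixes D :: "'a::euclidean_space set"
  assumes "compact D" "0 < r"
    and disj: "\<And>a t. a \<in> D \<Longrightarrow> 0 < t \<Longrightarrow> t < r \<Longrightarrow> a + t *\<^sub>R e \<notin> D"
  shows "negligible D"
proof -
  \<comment> \<open>The offset 2 keeps \<open>\<tau> 0\<close> strictly below \<open>r\<close> as
    well.\<close>
  define \<tau> where "\<tau> k = r / (real k + 2)" for k :: nat
  define T where "T k = (+) (\<tau> k *\<^sub>R e) ` D" for k
  have \<tau>: "0 < \<tau> k" "\<tau> k < r" for k
    using assms(2) unfolding \<tau>_def by (auto simp: field_simps add_pos_nonneg)
  have \<tau>_inj: "\<tau> k \<noteq> \<tau> l" if "k \<noteq> l" for k l
    using assms(2) that unfolding \<tau>_def by (auto simp: field_simps)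
  have aux: "T k \<inter> T l = {}" if "\<tau> k < \<tau> l" for k l
  proof (rule ccontr)
    assume "T k \<inter> T l \<noteq> {}"
    then obtain a b where ab: "a \<in> D" "b \<in> D" "\<tau> k *\<^sub>R e + a = \<tau> l *\<^sub>R e + b"
      unfolding T_def by blast
    then have "a = b + (\<tau> l - \<tau> k) *\<^sub>R e" by (simp add: algebra_simps)
    then show False using disj[OF ab(2), of "\<tau> l - \<tau> k"] ab(1) that \<tau>[of k] \<tau>[of l] by simp
  qed
  have df: "disjoint_family T"
    unfolding disjoint_family_on_def using aux \<tau>_inj by (metis Int_commute linorder_neqE_linordered_idom)
  have cT: "compact (T k)" for k unfolding T_def using assms(1) compact_translation by blast
  obtain B where B: "D \<subseteq> cball 0 B" using compact_subset_cball[OF assms(1)] by blast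
  have sub: "T k \<subseteq> cball 0 (B + r * norm e)" for k
  proof
    fix y assume "y \<in> T k"
    then obtain a where a: "a \<in> D" "y = \<tau> k *\<^sub>R e + a" unfolding T_def by blast
    have "norm y \<le> \<tau> k * norm e + norm a" using a(2) \<tau>(1)[of k] norm_triangle_ineq[of "\<tau> k *\<^sub>R e" a] by simp
    also have "\<dots> \<le> r * norm e + B"
      using a(1) B \<tau>[of k] by (intro add_mono mult_right_mono) auto
    finally show "y \<in> cball 0 (B + r * norm e)" by simp
  qed
  have m: "T k \<in> lmeasurable" for k using cT lmeasurable_compact by blast
  have meas: "measure lebesgue (T k) = measure lebesgue D" for k
    unfolding T_def by (rule measure_translation)
  have "real n * measure lebesgue D \<le> measure lebesgue (cball (0::'a) (B + r * norm e))" for n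
  proof -
    have "real n * measure lebesgue D = (\<Sum>k<n. measure lebesgue (T k))" by (simp add: meas)
    also have "\<dots> = measure lebesgue (\<Union>k<n. T k)"
      using m df by (intro measure_UNION'[symmetric])
        (auto simp: pairwise_def disjnt_def disjoint_family_on_def)
    also have "\<dots> \<le> measure lebesgue (cball (0::'a) (B + r * norm e))"
      using sub m by (intro measure_mono_fmeasurable) (auto intro: fmeasurableD)
    finally show ?thesis .
  qed
  then have "\<not> measure lebesgue D > 0"
    by (metis ex_less_of_nat_mult linorder_not_less)
  then have "measure lebesgue D = 0" by (simp add: order_less_le)
  moreover have "D \<in> lmeasurable" using assms(1) lmeasurable_compact by blast
  ultimately show ?thesis using negligible_iff_measure by blast
qed

text \<open>If the centre of the empty ball touching at \<open>a\<close> lies roughly in direction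
  \<open>e\<close>, every short translate of \<open>a\<close> along \<open>e\<close> enters that
  ball and misses \<Gamma>. Four axis directions account for all centres, so \<Gamma> is covered by
  four sets with disjoint translates.\<close>

lemma negligible_of_empty_balls:
  fixes \<Gamma> :: "(real^2) set"
  assumes "compact \<Gamma>" "0 < \<rho>" and tan: "\<And>a. a \<in> \<Gamma> \<Longrightarrow> \<exists>c. dist a c = \<rho> \<and> ball c \<rho> \<inter> \<Gamma> = {}"
  shows "negligible \<Gamma>"
proof -
  obtain B where B: "\<Gamma> \<subseteq> cball 0 B"
    using compact_subset_cball[OF assms(1)] by blast
  \<comment> \<open>Recording the centre next to the point turns the condition into a closed one, so
    the projection \<open>D e\<close> of \<open>P e\<close> is compact.\<close>
  define P where "P e = (\<Gamma> \<times> cball 0 (B + \<rho>)) \<inter> ({p. dist (fst p) (snd p) = \<rho>} \<inter>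
     {p. \<rho>/2 \<le> (snd p - fst p) \<bullet> e} \<inter> (\<Inter>y\<in>\<Gamma>. {p. \<rho> \<le> dist (snd p) y}))" for e :: "real^2"
  define D where "D e = fst ` P e" for e
  have neg: "negligible (D e)" if e: "norm e = 1" for e
  proof (rule negligible_disjoint_translates[OF _ assms(2)])
    have "closed ({p :: (real^2) \<times> (real^2). dist (fst p) (snd p) = \<rho>} \<inter>
     {p. \<rho>/2 \<le> (snd p - fst p) \<bullet> e} \<inter> (\<Inter>y\<in>\<Gamma>. {p. \<rho> \<le> dist (snd p) y}))"
      by (intro closed_Int closed_INT ballI closed_Collect_eq closed_Collect_le continuous_intros)
    then have "compact (P e)" unfolding P_def
      by (intro compact_Int_closed compact_Times assms(1) compact_cball)
    then show "compact (D e)" unfolding D_def by (intro compact_continuous_image continuous_intros)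
    fix a t assume a: "a \<in> D e" and t: "0 < t" "t < \<rho>"
    then obtain c where c: "dist a c = \<rho>" "\<rho>/2 \<le> (c - a) \<bullet> e" "\<And>y. y \<in> \<Gamma> \<Longrightarrow> \<rho> \<le> dist c y"
      unfolding D_def P_def by auto
    have "(norm (c - (a + t *\<^sub>R e)))\<^sup>2 = (norm (c - a))\<^sup>2 - 2 * t * ((c - a) \<bullet> e) + t\<^sup>2"
      unfolding power2_norm_eq_inner using e
      by (simp add: inner_simps inner_commute power2_eq_square norm_eq_1 algebra_simps)
    also have "\<dots> \<le> \<rho>\<^sup>2 - t * \<rho> + t\<^sup>2"
      using c(1) mult_left_mono[OF c(2), of "2*t"] t by (simp add: dist_norm norm_minus_commute)
    also have "\<dots> < \<rho>\<^sup>2" using t by (simp add: power2_eq_square)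
    finally have "dist c (a + t *\<^sub>R e) < \<rho>"
      using power2_less_imp_less[of _ \<rho>] assms(2) by (simp add: dist_norm)
    then have "a + t *\<^sub>R e \<notin> \<Gamma>" using c(3) by force
    then show "a + t *\<^sub>R e \<notin> D e" unfolding D_def P_def by auto
  qed
  define dirs :: "(real^2) set" where "dirs = {axis 1 1, - axis 1 1, axis 2 1, - axis 2 1}"
  have "\<Gamma> \<subseteq> (\<Union>e\<in>dirs. D e)"
  proof
    fix a assume a: "a \<in> \<Gamma>"
    then obtain c where c: "dist a c = \<rho>" "ball c \<rho> \<inter> \<Gamma> = {}" using tan by blast
    have "norm c \<le> B + \<rho>"
      using a B c(1) norm_triangle_sub[of c a] by (auto simp: dist_norm norm_minus_commute)
    then have mem: "a \<in> D e" if "\<rho>/2 \<le> (c - a) \<bullet> e" for e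
      unfolding D_def P_def using a c that by (intro image_eqI[of _ _ "(a, c)"]) force+
    \<comment> \<open>A plane vector of length \<rho> has a component of size at least \<rho>
      divided by the square root of 2.\<close>
    have "\<rho>/2 \<le> \<bar>(c - a) $ 1\<bar> \<or> \<rho>/2 \<le> \<bar>(c - a) $ 2\<bar>"
    proof (rule ccontr)
      assume "\<not> ?thesis"
      then have "((c - a) $ 1)\<^sup>2 < (\<rho>/2)\<^sup>2" "((c - a) $ 2)\<^sup>2 < (\<rho>/2)\<^sup>2"
        using assms(2) by (auto simp: abs_le_square_iff[symmetric] not_le simp flip: linorder_not_le)
      moreover have "\<rho>\<^sup>2 = ((c - a) $ 1)\<^sup>2 + ((c - a) $ 2)\<^sup>2"
        using c(1) by (auto simp: dist_norm norm_vec_def L2_set_def sum_2 power2_commute)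
      ultimately show False using assms(2) by (simp add: power2_eq_square) (smt (verit) mult_pos_pos)
    qed
    then show "a \<in> (\<Union>e\<in>dirs. D e)"
      using mem[of "axis 1 1"] mem[of "- axis 1 1"] mem[of "axis 2 1"] mem[of "- axis 2 1"]
      unfolding dirs_def by (auto simp: inner_axis abs_if split: if_splits)
  qed
  moreover have "negligible (\<Union>e\<in>dirs. D e)"
    by (intro negligible_Union) (auto simp: dirs_def intro!: neg)
  ultimately show ?thesis using negligible_subset by blast
qed

text \<open>Continuity of the distance to \<open>C\<close> carries the strict bound over to the
  closure as a weak one, and closedness of \<open>C\<close> lets a centre attain it.\<close>

lemma touching_ball:
  fixes \<Gamma> X :: "'a::euclidean_space set"
  assumes "0 < \<rho>" "a \<in> closure X" 
    and near: "\<And>x. x \<in> X \<Longrightarrow> \<exists>c\<in>C. dist x c < \<rho>" and "closed C"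
  shows "\<exists>c\<in>C. dist a c \<le> \<rho>"
proof -
  obtain x where x: "\<And>n. x n \<in> X" "x \<longlonglongrightarrow> a"
    using assms(2) closure_sequential by metis
  have Cne: "C \<noteq> {}" using near x(1) by fastforce
  have "infdist (x n) C \<le> \<rho>" for n
    using near[OF x(1)] infdist_le2 less_imp_le by metis
  moreover have "(\<lambda>n. infdist (x n) C) \<longlonglongrightarrow> infdist a C"
    by (intro tendsto_infdist x)
  ultimately have "infdist a C \<le> \<rho>" by (meson LIMSEQ_le_const2)
  then show ?thesis using infdist_attains_inf[OF assms(4) Cne, of a] by fastforce
qed

section \<open>The semiconvex envelope\<close>

text \<open>The first clause is midpoint convexity of
  \<open>f x + (norm x)\<^sup>2 / (2 * \<rho>)\<close>: the quadratic term has second difference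
  \<open>(norm v)\<^sup>2 / \<rho>\<close>. In this form it asks for no regularity of
  \<open>f\<close> and passes directly to translates, averages and suprema.\<close>

definition envelope_class :: "real \<Rightarrow> 'a::real_inner set \<Rightarrow> ('a \<Rightarrow> real) set" where
  "envelope_class \<rho> C = {f. (\<forall>x v. 2 * f x \<le> f (x + v) + f (x - v) + (norm v)\<^sup>2 / \<rho>) \<and>
     (\<forall>x. f x \<le> 0) \<and> (\<forall>c\<in>C. \<forall>x. f x \<le> - \<rho> + (dist x c)\<^sup>2 / (2 * \<rho>))}"

definition envelope :: "real \<Rightarrow> 'a::real_inner set \<Rightarrow> 'a \<Rightarrow> real" where
  "envelope \<rho> C x = (SUP f\<in>envelope_class \<rho> C. f x)"

lemma parallelogram: "(norm (a + v))\<^sup>2 + (norm (a - v))\<^sup>2 = 2 * (norm a)\<^sup>2 + 2 * (norm v)\<^sup>2"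
  for a v :: "'a::real_inner"
  unfolding power2_norm_eq_inner by (simp add: inner_simps inner_commute)

context
  fixes \<rho> :: real and C :: "'a::real_inner set"
  assumes \<rho>: "0 < \<rho>"
begin

lemma const_in_envelope_class: "(\<lambda>_. - \<rho>) \<in> envelope_class \<rho> C"
  unfolding envelope_class_def using \<rho> by simp

lemma envelope_upper: "f \<in> envelope_class \<rho> C \<Longrightarrow> f x \<le> envelope \<rho> C x"
  unfolding envelope_def
  by (rule cSUP_upper) (auto intro!: bdd_aboveI[of _ 0] simp: envelope_class_def)

lemma envelope_least: "(\<And>f. f \<in> envelope_class \<rho> C \<Longrightarrow> f x \<le> b) \<Longrightarrow> envelope \<rho> C x \<le> b"
  unfolding envelope_def using const_in_envelope_class by (intro cSUP_least) auto

lemma envelope_in_class: "envelope \<rho> C \<in> envelope_class \<rho> C"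
proof -
  have "2 * envelope \<rho> C x \<le> envelope \<rho> C (x + v) + envelope \<rho> C (x - v) + (norm v)\<^sup>2 / \<rho>" for x v
  proof -
    have "envelope \<rho> C x \<le> (envelope \<rho> C (x + v) + envelope \<rho> C (x - v) + (norm v)\<^sup>2 / \<rho>) / 2"
    proof (rule envelope_least)
      fix f assume f: "f \<in> envelope_class \<rho> C"
      then have "2 * f x \<le> f (x + v) + f (x - v) + (norm v)\<^sup>2 / \<rho>"
        unfolding envelope_class_def by blast
      then show "f x \<le> (envelope \<rho> C (x + v) + envelope \<rho> C (x - v) + (norm v)\<^sup>2 / \<rho>) / 2"
        using envelope_upper[OF f, of "x + v"] envelope_upper[OF f, of "x - v"] by simp
    qed
    then show ?thesis by simp
  qed
  moreover have "envelope \<rho> C x \<le> 0" for x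
    by (rule envelope_least) (simp add: envelope_class_def)
  moreover have "envelope \<rho> C x \<le> - \<rho> + (dist x c)\<^sup>2 / (2 * \<rho>)" if "c \<in> C" for c x
    by (rule envelope_least) (use that in \<open>simp add: envelope_class_def\<close>)
  ultimately show ?thesis unfolding envelope_class_def by blast
qed

lemma envelope_semiconvex:
  "2 * envelope \<rho> C x \<le> envelope \<rho> C (x + v) + envelope \<rho> C (x - v) + (norm v)\<^sup>2 / \<rho>"
  and envelope_nonpos: "envelope \<rho> C x \<le> 0"
  and envelope_le_paraboloid: "c \<in> C \<Longrightarrow> envelope \<rho> C x \<le> - \<rho> + (dist x c)\<^sup>2 / (2 * \<rho>)"
  using envelope_in_class unfolding envelope_class_def by blast+

lemma envelope_ge: "- \<rho> \<le> envelope \<rho> C x"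
  by (rule envelope_upper[OF const_in_envelope_class])

text \<open>The averaged translates of the envelope, lowered by \<open>(norm v)\<^sup>2 / (2 * \<rho>)\<close>, again
  belong to the class, because the defining upper barriers are semiconcave.\<close>

lemma envelope_semiconcave:
  "envelope \<rho> C (x + v) + envelope \<rho> C (x - v) \<le> 2 * envelope \<rho> C x + (norm v)\<^sup>2 / \<rho>"
proof -
  let ?u = "envelope \<rho> C"
  define g where "g y = (?u (y + v) + ?u (y - v)) / 2 - (norm v)\<^sup>2 / (2 * \<rho>)" for y
  have "2 * g y \<le> g (y + w) + g (y - w) + (norm w)\<^sup>2 / \<rho>" for y w
  proof -
    have "2 * ?u (y + v) \<le> ?u (y + w + v) + ?u (y - w + v) + (norm w)\<^sup>2 / \<rho>"
      using envelope_semiconvex[of "y + v" w] by (simp add: algebra_simps)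
    moreover have "2 * ?u (y - v) \<le> ?u (y + w - v) + ?u (y - w - v) + (norm w)\<^sup>2 / \<rho>"
      using envelope_semiconvex[of "y - v" w] by (simp add: algebra_simps)
    ultimately show ?thesis unfolding g_def by (simp add: field_simps)
  qed
  moreover have "g y \<le> 0" for y
  proof -
    have "0 \<le> (norm v)\<^sup>2 / (2 * \<rho>)" using \<rho> by simp
    moreover have "(?u (y + v) + ?u (y - v)) / 2 \<le> 0"
      using envelope_nonpos[of "y + v"] envelope_nonpos[of "y - v"] by simp
    ultimately show ?thesis unfolding g_def using diff_mono by fastforce
  qed
  moreover have "g y \<le> - \<rho> + (dist y c)\<^sup>2 / (2 * \<rho>)" if "c \<in> C" for y c
  proof -
    have "?u (y + v) \<le> - \<rho> + (norm ((y - c) + v))\<^sup>2 / (2 * \<rho>)"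
      using envelope_le_paraboloid[OF that, of "y + v"] by (simp add: dist_norm algebra_simps)
    moreover have "?u (y - v) \<le> - \<rho> + (norm ((y - c) - v))\<^sup>2 / (2 * \<rho>)"
      using envelope_le_paraboloid[OF that, of "y - v"] by (simp add: dist_norm algebra_simps)
    ultimately have "?u (y + v) + ?u (y - v)
        \<le> - 2 * \<rho> + ((norm ((y - c) + v))\<^sup>2 + (norm ((y - c) - v))\<^sup>2) / (2 * \<rho>)"
      by (simp add: add_divide_distrib)
    then show ?thesis unfolding g_def parallelogram dist_norm by (simp add: add_divide_distrib)
  qed
  ultimately have "g \<in> envelope_class \<rho> C" unfolding envelope_class_def by blast
  from envelope_upper[OF this, of x] show ?thesis unfolding g_def by (simp add: field_simps)
qed

text \<open>The downward paraboloid is itself a competitor. It satisfies the semiconvexity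
  inequality with equality, and it stays below an inner barrier because the squared distances from a
  point to two centres at least 2 \<rho> apart add up to at least \<open>2 * \<rho>\<^sup>2\<close>,
  the value at the midpoint in the extreme case.\<close>

lemma envelope_ge_paraboloid:
  assumes far: "\<And>c'. c' \<in> C \<Longrightarrow> 2 * \<rho> \<le> dist c c'"
  shows "- (dist x c)\<^sup>2 / (2 * \<rho>) \<le> envelope \<rho> C x"
proof -
  define g where "g y = - (dist y c)\<^sup>2 / (2 * \<rho>)" for y
  have "2 * g y \<le> g (y + w) + g (y - w) + (norm w)\<^sup>2 / \<rho>" for y w
  proof -
    have "(dist (y + w) c)\<^sup>2 + (dist (y - w) c)\<^sup>2 = 2 * (dist y c)\<^sup>2 + 2 * (norm w)\<^sup>2"
      using parallelogram[of "y - c" w] by (simp add: dist_norm algebra_simps)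
    then have "((dist (y + w) c)\<^sup>2 + (dist (y - w) c)\<^sup>2) / (2 * \<rho>)
        = (2 * (dist y c)\<^sup>2 + 2 * (norm w)\<^sup>2) / (2 * \<rho>)" by simp
    then show ?thesis unfolding g_def by (simp add: add_divide_distrib)
  qed
  moreover have "g y \<le> 0" for y unfolding g_def using \<rho> by simp
  moreover have "g y \<le> - \<rho> + (dist y c')\<^sup>2 / (2 * \<rho>)" if "c' \<in> C" for y c'
  proof -
    have "2 * \<rho> \<le> dist y c + dist y c'"
      using far[OF that] dist_triangle[of c c' y] by (simp add: dist_commute)
    then have "(2 * \<rho>)\<^sup>2 \<le> (dist y c + dist y c')\<^sup>2" using \<rho> by (intro power_mono) auto
    also have "\<dots> \<le> 2 * ((dist y c)\<^sup>2 + (dist y c')\<^sup>2)"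
      using sum_squares_bound[of "dist y c" "dist y c'"] by (simp add: power2_sum)
    finally have "2 * \<rho>\<^sup>2 \<le> (dist y c)\<^sup>2 + (dist y c')\<^sup>2" by (simp add: power2_eq_square)
    then have "(2 * \<rho>\<^sup>2) / (2 * \<rho>) \<le> ((dist y c)\<^sup>2 + (dist y c')\<^sup>2) / (2 * \<rho>)"
      using \<rho> by (intro divide_right_mono) auto
    then show ?thesis unfolding g_def using \<rho> by (simp add: add_divide_distrib power2_eq_square)
  qed
  ultimately have "g \<in> envelope_class \<rho> C" unfolding envelope_class_def by blast
  from envelope_upper[OF this, of x] show ?thesis unfolding g_def .
qed

text \<open>A large increment over a short step would, by semiconvexity, persist over many steps and
  leave the interval \<open>[-\<rho>, 0]\<close>.\<close>

lemma envelope_uniformly_continuous: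
  assumes "0 < e"
  shows "\<exists>d>0. \<forall>x y. dist x y < d \<longrightarrow> \<bar>envelope \<rho> C x - envelope \<rho> C y\<bar> \<le> e"
proof -
  let ?u = "envelope \<rho> C"
  obtain n :: nat where n: "real n > 2 * \<rho> / e" "n > 0"
    using reals_Archimedean2[of "max 0 (2 * \<rho> / e)"] by auto
  \<comment> \<open>The bound n > 2 \<rho> / e makes the mean slope \<rho> / n over \<open>n\<close>
    steps at most e / 2; this \<open>d\<close> makes the accumulated second-order loss
    \<open>n * q\<close> at most e / 2 too.\<close>
  define d where "d = sqrt (e * \<rho> / (2 * real n))"
  have d: "d > 0" "d\<^sup>2 = e * \<rho> / (2 * real n)" unfolding d_def using n assms \<rho> by auto
  have step: "?u (x + v) - ?u x \<le> e" if v: "norm v < d" for x v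
  proof -
    define w where "w = ?u (x + v) - ?u x"
    define q where "q = (norm v)\<^sup>2 / \<rho>"
    have q0: "q \<ge> 0" unfolding q_def using \<rho> by simp
    have inc: "w - real k * q \<le> ?u (x + real (Suc k) *\<^sub>R v) - ?u (x + real k *\<^sub>R v)" for k
    proof (induction k)
      case 0
      then show ?case by (simp add: w_def)
    next
      case (Suc k)
      have "2 * ?u (x + real (Suc k) *\<^sub>R v)
          \<le> ?u (x + real (Suc (Suc k)) *\<^sub>R v) + ?u (x + real k *\<^sub>R v) + q"
        using envelope_semiconvex[of "x + real (Suc k) *\<^sub>R v" v] unfolding q_def
        by (simp add: algebra_simps scaleR_2)
      then show ?case using Suc by (simp add: algebra_simps)
    qed
    have "real n * w - real n * (real n * q) = (\<Sum>k<n. w - real n * q)" by (simp add: algebra_simps)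
    also have "\<dots> \<le> (\<Sum>k<n. w - real k * q)"
      using q0 by (intro sum_mono diff_mono mult_right_mono) auto
    also have "\<dots> \<le> (\<Sum>k<n. ?u (x + real (Suc k) *\<^sub>R v) - ?u (x + real k *\<^sub>R v))"
      by (intro sum_mono inc)
    also have "\<dots> = ?u (x + real n *\<^sub>R v) - ?u x"
      by (subst sum_lessThan_telescope) simp
    also have "\<dots> \<le> \<rho>" using envelope_nonpos[of "x + real n *\<^sub>R v"] envelope_ge[of x] by linarith
    finally have 1: "real n * (w - real n * q) \<le> \<rho>" by (simp add: algebra_simps)
    have "real n * q \<le> e / 2"
    proof -
      have "(norm v)\<^sup>2 \<le> d\<^sup>2" using v by (intro power_mono) auto
      then have "q \<le> e / (2 * real n)" unfolding q_def d(2) using \<rho> by (simp add: field_simps)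
      then show ?thesis using n(2) by (simp add: field_simps)
    qed
    moreover have "w - real n * q \<le> \<rho> / real n" using 1 n(2) by (simp add: field_simps)
    moreover have "\<rho> / real n \<le> e / 2" using n assms by (simp add: field_simps)
    ultimately show ?thesis unfolding w_def by linarith
  qed
  have "\<bar>?u x - ?u y\<bar> \<le> e" if "dist x y < d" for x y
    using step[of "x - y" y] step[of "y - x" x] that by (simp add: dist_norm norm_minus_commute abs_le_iff)
  then show ?thesis using d(1) by blast
qed

lemma continuous_on_envelope: "continuous_on S (envelope \<rho> C)"
  unfolding continuous_on_iff
proof (intro ballI allI impI)
  fix x and e :: real assume "x \<in> S" "0 < e"
  then obtain d where "d > 0" "\<forall>x y. dist x y < d \<longrightarrow> \<bar>envelope \<rho> C x - envelope \<rho> C y\<bar> \<le> e / 2"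
    using envelope_uniformly_continuous[of "e/2"] by auto
  then show "\<exists>d>0. \<forall>x'\<in>S. dist x' x < d \<longrightarrow> dist (envelope \<rho> C x') (envelope \<rho> C x) < e"
    using \<open>0 < e\<close> by (intro exI[of _ d]) (force simp: dist_real_def)
qed

end

section \<open>First-order expansions and gradient bounds from second differences\<close>

lemma has_field_derivative_line:
  fixes g :: "'a::real_normed_vector \<Rightarrow> real"
  assumes der: "(g has_derivative D) (at x)"
  shows "((\<lambda>t. g (x + t *\<^sub>R v)) has_field_derivative D v) (at 0)"
proof -
  have "((\<lambda>t. g (x + t *\<^sub>R v)) has_derivative (\<lambda>t. D (t *\<^sub>R v))) (at 0)"
    by (rule has_derivative_compose[of "\<lambda>t. x + t *\<^sub>R v", simplified])
      (auto intro!: derivative_eq_intros simp: der)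
  moreover have "linear D" using der has_derivative_linear by blast
  ultimately show ?thesis
    unfolding has_field_derivative_def by (simp add: linear_scale mult_commute_abs)
qed

text \<open>A second-difference bound turns, by dyadic subdivision, into a quadratic bound for the
  remainder of the first-order expansion.\<close>

lemma first_order_lower:
  fixes g :: "'a::real_inner \<Rightarrow> real"
  assumes der: "(g has_derivative D) (at x)"
    and sc: "\<And>x v. 2 * g x \<le> g (x + v) + g (x - v) + (norm v)\<^sup>2 / \<rho>" and "0 < \<rho>"
  shows "g x + D v - (norm v)\<^sup>2 / (2 * \<rho>) \<le> g (x + v)"
proof -
  define \<Delta> where "\<Delta> t = g (x + t *\<^sub>R v) - g x" for t
  define q where "q = (norm v)\<^sup>2 / \<rho>"
  have double: "2 * \<Delta> (t / 2) - t\<^sup>2 * q / 4 \<le> \<Delta> t" for t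
  proof -
    have "2 * g (x + (t/2) *\<^sub>R v) \<le> g (x + (t/2) *\<^sub>R v + (t/2) *\<^sub>R v) + g (x + (t/2) *\<^sub>R v - (t/2) *\<^sub>R v)
        + (norm ((t/2) *\<^sub>R v))\<^sup>2 / \<rho>" by (rule sc)
    also have "x + (t/2) *\<^sub>R v + (t/2) *\<^sub>R v = x + t *\<^sub>R v"
      by (metis add.assoc field_sum_of_halves scaleR_left_distrib)
    finally show ?thesis unfolding \<Delta>_def q_def by (simp add: power_mult_distrib field_simps)
  qed
  \<comment> \<open>The losses \<open>q / 4 / 2^n\<close> of successive halvings form a geometric
    series with sum q / 2, the constant of the final remainder.\<close>
  have iter: "2^n * \<Delta> (1 / 2^n) - (q / 2) * (1 - 1 / 2^n) \<le> \<Delta> 1" for n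
  proof (induction n)
    case (Suc n)
    have "2^n * (2 * \<Delta> (1 / 2^n / 2) - (1 / 2^n)\<^sup>2 * q / 4) \<le> 2^n * \<Delta> (1 / 2^n)"
      by (intro mult_left_mono double) simp
    moreover have "2^n * (2 * \<Delta> (1 / 2^n / 2) - (1 / 2^n)\<^sup>2 * q / 4)
        = 2^Suc n * \<Delta> (1 / 2^Suc n) - q / 4 / 2^n"
      by (simp add: field_simps power2_eq_square)
    moreover have "(q / 2) * (1 - 1 / 2^Suc n) = (q / 2) * (1 - 1 / 2^n) + q / 4 / 2^n"
      by (simp add: field_simps)
    ultimately show ?case using Suc by linarith
  qed simp
  have "((\<lambda>t. g (x + t *\<^sub>R v)) has_field_derivative D v) (at 0)"
    by (rule has_field_derivative_line[OF der])
  then have "((\<lambda>h. \<Delta> h / h) \<longlongrightarrow> D v) (at 0)"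
    unfolding DERIV_def \<Delta>_def by simp
  moreover have "filterlim (\<lambda>n. 1 / 2^n :: real) (at 0) sequentially"
  proof -
    have "(\<lambda>n. (1/2)^n :: real) \<longlonglongrightarrow> 0" by (intro LIMSEQ_power_zero) simp
    then show ?thesis unfolding filterlim_at by (simp add: power_one_over)
  qed
  ultimately have "((\<lambda>n. \<Delta> (1 / 2^n) / (1 / 2^n)) \<longlonglongrightarrow> D v)"
    by (rule filterlim_compose)
  then have lim1: "(\<lambda>n. 2^n * \<Delta> (1 / 2^n)) \<longlonglongrightarrow> D v" by (simp add: mult.commute)
  have "(\<lambda>n. (1/2)^n :: real) \<longlonglongrightarrow> 0" by (intro LIMSEQ_power_zero) simp
  then have "(\<lambda>n. (q / 2) * (1 - 1 / 2^n)) \<longlonglongrightarrow> (q / 2) * (1 - 0)"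
    by (intro tendsto_intros) (simp add: power_one_over)
  then have "(\<lambda>n. 2^n * \<Delta> (1 / 2^n) - (q / 2) * (1 - 1 / 2^n)) \<longlonglongrightarrow> D v - (q / 2) * (1 - 0)"
    by (intro tendsto_diff lim1)
  then have "D v - (q / 2) * (1 - 0) \<le> \<Delta> 1"
    using iter by (intro LIMSEQ_le_const2) auto
  then show ?thesis unfolding \<Delta>_def q_def by simp
qed

text \<open>For continuously differentiable \<open>g\<close> this says that the gradient is
  Lipschitz with constant 1 / \<rho>. Stated by differences it applies to the envelope before any
  derivative is known, and it survives convolution.\<close>

definition second_difference_bounded :: "real \<Rightarrow> ('a::real_inner \<Rightarrow> real) \<Rightarrow> bool" where
  "second_difference_bounded \<rho> g \<longleftrightarrow> (\<forall>x v. \<bar>g (x + v) + g (x - v) - 2 * g x\<bar> \<le> (norm v)\<^sup>2 / \<rho>)"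

lemma second_difference_taylor:
  fixes g :: "'a::real_inner \<Rightarrow> real"
  assumes "second_difference_bounded \<rho> g" "0 < \<rho>" "(g has_derivative D) (at x)"
  shows "\<bar>g (x + v) - g x - D v\<bar> \<le> (norm v)\<^sup>2 / (2 * \<rho>)"
proof -
  have b: "\<bar>g (y + w) + g (y - w) - 2 * g y\<bar> \<le> (norm w)\<^sup>2 / \<rho>" for y w
    using assms(1) unfolding second_difference_bounded_def by blast
  have "2 * g y \<le> g (y + w) + g (y - w) + (norm w)\<^sup>2 / \<rho>" for y w
    using b[of y w] by linarith
  from first_order_lower[OF assms(3) this assms(2), of v]
  have "g x + D v - (norm v)\<^sup>2 / (2 * \<rho>) \<le> g (x + v)" .
  moreover have "2 * - g y \<le> - g (y + w) + - g (y - w) + (norm w)\<^sup>2 / \<rho>" for y w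
    using b[of y w] by linarith
  from first_order_lower[OF has_derivative_minus[OF assms(3)] this assms(2), of v]
  have "- g x + - D v - (norm v)\<^sup>2 / (2 * \<rho>) \<le> - g (x + v)" .
  ultimately show ?thesis by linarith
qed

text \<open>By the Taylor bound, the step \<open>\<rho> *\<^sub>R G\<close> raises \<open>g\<close>
  by at least \<open>\<rho> * (norm G)\<^sup>2 / 2\<close> and the opposite step lowers it by as
  much, yet \<open>g\<close> stays in [-\<rho>, 0]. The lower end gives the first estimate, which is
  strict below the level - \<rho> / 2; adding both ends gives the second.\<close>

lemma gradient_upper:
  fixes g :: "'a::real_inner \<Rightarrow> real"
  assumes "second_difference_bounded \<rho> g" "0 < \<rho>" "(g has_derivative (\<lambda>h. G \<bullet> h)) (at x)"
    and range: "\<And>y. - \<rho> \<le> g y" "\<And>y. g y \<le> 0"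
  shows "(norm G)\<^sup>2 \<le> 2 * (g x + \<rho>) / \<rho>" "norm G \<le> 1"
proof -
  note t = second_difference_taylor[OF assms(1-3)]
  have "(norm (\<rho> *\<^sub>R G))\<^sup>2 / (2 * \<rho>) = \<rho> * (norm G)\<^sup>2 / 2"
    using assms(2) by (simp add: power_mult_distrib power2_eq_square)
  moreover have "G \<bullet> (\<rho> *\<^sub>R G) = \<rho> * (norm G)\<^sup>2"
    by (simp add: dot_square_norm)
  moreover have "G \<bullet> (- (\<rho> *\<^sub>R G)) = - (\<rho> * (norm G)\<^sup>2)"
    by (simp add: dot_square_norm)
  moreover have "(norm (- (\<rho> *\<^sub>R G)))\<^sup>2 / (2 * \<rho>) = \<rho> * (norm G)\<^sup>2 / 2"
    using assms(2) by (simp add: power_mult_distrib power2_eq_square)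
  ultimately have "\<rho> * (norm G)\<^sup>2 / 2 \<le> - g x" "\<rho> * (norm G)\<^sup>2 / 2 \<le> g x + \<rho>"
    using t[of "\<rho> *\<^sub>R G"] range(2)[of "x + \<rho> *\<^sub>R G"]
      t[of "- (\<rho> *\<^sub>R G)"] range(1)[of "x + - (\<rho> *\<^sub>R G)"] by linarith+
  then have 1: "\<rho> * (norm G)\<^sup>2 \<le> 2 * g x + 2 * \<rho>" "\<rho> * (norm G)\<^sup>2 \<le> \<rho>" by linarith+
  then show "(norm G)\<^sup>2 \<le> 2 * (g x + \<rho>) / \<rho>"
    using assms(2) by (simp add: field_simps)
  have "(norm G)\<^sup>2 \<le> 1\<^sup>2" using 1(2) assms(2) by simp
  then show "norm G \<le> 1" by (rule power2_le_imp_le) simp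
qed

text \<open>Near the level \<open>-\<rho>/2\<close> the gradient is almost a unit vector: moving towards \<open>c\<close> the
  function has to drop by almost \<open>\<rho>/2\<close> over a distance at most \<open>\<rho>\<close>, which leaves no room
  for a smaller slope at the starting point.\<close>

lemma gradient_lower:
  fixes g :: "'a::real_inner \<Rightarrow> real"
  assumes "second_difference_bounded \<rho> g" "0 < \<rho>" "(g has_derivative (\<lambda>h. G \<bullet> h)) (at x)"
    and up: "\<And>z. g z \<le> - \<rho> + (dist z c)\<^sup>2 / (2 * \<rho>) + w" and "dist x c \<le> \<rho>"
    and lo: "- \<rho> / 2 - t \<le> g x" and "0 < s"
  shows "1 - 2 * (t + w) / \<rho> - s / \<rho> - (t + w) / s \<le> norm G"
proof -
  define L where "L = dist x c"
  define \<kappa> where "\<kappa> = t + w"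
  have L: "0 \<le> L" "L \<le> \<rho>" using assms(5) unfolding L_def by auto
  have "\<rho> / 2 - \<kappa> \<le> L\<^sup>2 / (2 * \<rho>)" using up[of x] lo unfolding L_def \<kappa>_def by simp
  then have "\<rho>\<^sup>2 - 2 * \<rho> * \<kappa> \<le> L\<^sup>2" using assms(2) by (simp add: field_simps power2_eq_square)
  moreover have "L\<^sup>2 \<le> L * \<rho>" using L by (simp add: power2_eq_square mult_left_mono)
  ultimately have L2: "1 - 2 * \<kappa> / \<rho> \<le> L / \<rho>" using assms(2) by (simp add: field_simps power2_eq_square)
  show ?thesis
  \<comment> \<open>At the centre itself there is no direction to move in, but then
    \<open>L2\<close> forces 2 \<kappa> / \<rho> to be at least 1 and the left-hand side is not
    positive.\<close>
  proof (cases "L = 0")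
    case True
    then have "1 - 2 * \<kappa> / \<rho> \<le> 0" "0 \<le> \<kappa>" using L2 assms(2) by (auto simp: field_simps)
    moreover have "0 \<le> s / \<rho>" "0 \<le> \<kappa> / s" using \<open>0 \<le> \<kappa>\<close> assms(2) \<open>0 < s\<close> by simp_all
    ultimately show ?thesis unfolding \<kappa>_def[symmetric] using norm_ge_zero[of G] by linarith
  next
    case False
    define e where "e = (x - c) /\<^sub>R L"
    have e: "norm e = 1" "x - c = L *\<^sub>R e" using False unfolding e_def L_def by (auto simp: dist_norm)
    have "x + - (s *\<^sub>R e) - c = (L - s) *\<^sub>R e" using e(2) by (simp add: algebra_simps)
    then have d: "(dist (x + - (s *\<^sub>R e)) c)\<^sup>2 = (L - s)\<^sup>2" unfolding dist_norm by (simp add: e(1))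
    \<comment> \<open>The lower Taylor bound and the barrier are compared after one step of length
      \<open>s\<close> towards \<open>c\<close>. The free \<open>s\<close> balances the second-order
      error s / \<rho> against \<kappa> / s.\<close>
    have "\<bar>g (x + - (s *\<^sub>R e)) - g x - G \<bullet> (- (s *\<^sub>R e))\<bar> \<le> s\<^sup>2 / (2 * \<rho>)"
      using second_difference_taylor[OF assms(1-3), of "- (s *\<^sub>R e)"] by (simp add: power_mult_distrib e(1))
    then have 1: "g x - s * (G \<bullet> e) - s\<^sup>2 / (2 * \<rho>) \<le> - \<rho> + (L - s)\<^sup>2 / (2 * \<rho>) + w"
      using up[of "x + - (s *\<^sub>R e)"] unfolding d by simp
    have "L\<^sup>2 / (2 * \<rho>) \<le> \<rho> / 2"
      using L mult_mono[of L \<rho> L \<rho>] assms(2) by (simp add: field_simps power2_eq_square)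
    moreover have "s\<^sup>2 / (2 * \<rho>) + (L - s)\<^sup>2 / (2 * \<rho>) = L\<^sup>2 / (2 * \<rho>) - s * (L / \<rho> - s / \<rho>)"
      using assms(2) by (simp add: field_simps power2_eq_square)
    ultimately have "s * (L / \<rho> - s / \<rho>) - \<kappa> \<le> s * (G \<bullet> e)"
      using 1 lo unfolding \<kappa>_def by linarith
    then have "L / \<rho> - s / \<rho> - \<kappa> / s \<le> G \<bullet> e" using \<open>0 < s\<close> by (simp add: field_simps)
    also have "G \<bullet> e \<le> norm G" using norm_cauchy_schwarz[of G e] e(1) by simp
    finally show ?thesis unfolding \<kappa>_def[symmetric] using L2 by linarith
  qed
qed

definition laplacian :: "(real^2 \<Rightarrow> real) \<Rightarrow> real^2 \<Rightarrow> real" where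
  "laplacian g x = pderiv_at 1 (pderiv_at 1 g) x + pderiv_at 2 (pderiv_at 2 g) x"

lemma inner_grad_axis: "grad g x \<bullet> axis i 1 = pderiv_at i g x"
  unfolding grad_def inner_axis using exhaust_2[of i] by auto

text \<open>Taylor expansions from both ends of a segment, added up, show that the partial
  derivative is Lipschitz with constant 1 / \<rho> in its own direction. The two remainders 1 / (2
  \<rho>) add up exactly, so nothing is lost.\<close>

lemma second_pderiv_bound:
  fixes g :: "real^2 \<Rightarrow> real"
  assumes "second_difference_bounded \<rho> g" "0 < \<rho>" "smooth g"
  shows "\<bar>pderiv_at i (pderiv_at i g) x\<bar> \<le> 1 / \<rho>"
proof -
  let ?e = "axis i 1 :: real^2" and ?f = "pderiv_at i g"
  have lip: "\<bar>?f (x + t *\<^sub>R ?e) - ?f x\<bar> \<le> \<bar>t\<bar> / \<rho>" for t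
  proof (cases "t = 0")
    case False
    define y where "y = x + t *\<^sub>R ?e"
    have "\<bar>g (x + t *\<^sub>R ?e) - g x - grad g x \<bullet> (t *\<^sub>R ?e)\<bar> \<le> t\<^sup>2 / (2 * \<rho>)"
      using second_difference_taylor[OF assms(1,2) has_derivative_grad[OF smooth_differentiable[OF assms(3)]],
          of x "t *\<^sub>R ?e"]
      by (simp add: power_mult_distrib)
    moreover have "\<bar>g (y + - (t *\<^sub>R ?e)) - g y - grad g y \<bullet> (- (t *\<^sub>R ?e))\<bar> \<le> t\<^sup>2 / (2 * \<rho>)"
      using second_difference_taylor[OF assms(1,2) has_derivative_grad[OF smooth_differentiable[OF assms(3)]],
          of y "- (t *\<^sub>R ?e)"]
      by (simp add: power_mult_distrib)
    moreover have "grad g z \<bullet> (t *\<^sub>R ?e) = t * ?f z" "grad g z \<bullet> (- (t *\<^sub>R ?e)) = - (t * ?f z)" for z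
      by (simp_all add: inner_grad_axis)
    moreover have "t\<^sup>2 / \<rho> = t\<^sup>2 / (2 * \<rho>) + t\<^sup>2 / (2 * \<rho>)" by simp
    ultimately have "\<bar>t * ?f y - t * ?f x\<bar> \<le> t\<^sup>2 / \<rho>"
      unfolding y_def by (simp add: inner_grad_axis)
    then have "\<bar>t\<bar> * \<bar>?f y - ?f x\<bar> \<le> \<bar>t\<bar> * (\<bar>t\<bar> / \<rho>)"
      by (simp add: abs_mult[symmetric] right_diff_distrib power2_eq_square)
    then show ?thesis using False unfolding y_def by (simp del: times_divide_eq_right)
  qed simp
  have "(?f has_derivative (\<lambda>h. grad ?f x \<bullet> h)) (at x)"
    by (intro has_derivative_grad smooth_differentiable smooth_pderiv_at assms)
  from has_field_derivative_line[OF this, of ?e]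
  have "((\<lambda>h. (?f (x + h *\<^sub>R ?e) - ?f x) / h) \<longlongrightarrow> pderiv_at i ?f x) (at 0)"
    unfolding DERIV_def by (simp add: inner_grad_axis)
  then have "((\<lambda>h. \<bar>(?f (x + h *\<^sub>R ?e) - ?f x) / h\<bar>) \<longlongrightarrow> \<bar>pderiv_at i ?f x\<bar>) (at 0)"
    by (rule tendsto_rabs)
  moreover have "\<forall>\<^sub>F h in at 0. \<bar>(?f (x + h *\<^sub>R ?e) - ?f x) / h\<bar> \<le> 1 / \<rho>"
  proof (rule eventually_at_filter[THEN iffD2], intro always_eventually allI impI)
    fix h :: real assume "h \<noteq> 0"
    then show "\<bar>(?f (x + h *\<^sub>R ?e) - ?f x) / h\<bar> \<le> 1 / \<rho>"
      using lip[of h] by (simp add: abs_divide field_simps)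
  qed
  ultimately show ?thesis by (rule tendsto_upperbound) simp
qed

lemma laplacian_bound:
  assumes "second_difference_bounded \<rho> g" "0 < \<rho>" "smooth g"
  shows "\<bar>laplacian g x\<bar> \<le> 2 / \<rho>"
  using second_pderiv_bound[OF assms, of 1 x] second_pderiv_bound[OF assms, of 2 x]
  unfolding laplacian_def by linarith

section \<open>Superpositions of translates of a test form\<close>

lemma test_form_quadratic_remainder:
  fixes f :: "real^2 \<Rightarrow> real"
  assumes "f \<in> test_forms"
  shows "\<exists>C\<ge>0. \<forall>y h. \<bar>f (y + h) - f y - grad f y \<bullet> h\<bar> \<le> C * (norm h)\<^sup>2"
proof -
  have "\<exists>C\<ge>0. \<forall>y z. \<bar>pderiv_at i f y - pderiv_at i f z\<bar> \<le> C * norm (y - z)" for i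
  proof -
    let ?p = "pderiv_at i f"
    have p: "?p \<in> test_forms" by (intro pderiv_at_test_forms assms)
    obtain C1 where C1: "C1 > 0" "\<forall>x. norm (pderiv_at 1 ?p x) \<le> C1"
      using test_forms_bounded[OF pderiv_at_test_forms[OF p]] by blast
    obtain C2 where C2: "C2 > 0" "\<forall>x. norm (pderiv_at 2 ?p x) \<le> C2"
      using test_forms_bounded[OF pderiv_at_test_forms[OF p]] by blast
    have "norm (?p y - ?p z) \<le> (C1 + C2) * norm (y - z)" for y z
    proof (rule differentiable_bound[of UNIV ?p "\<lambda>x h. grad ?p x \<bullet> h"])
      fix x :: "real^2"
      show "(?p has_derivative (\<lambda>h. grad ?p x \<bullet> h)) (at x within UNIV)"
        using has_derivative_grad[OF smooth_differentiable[OF test_forms_smooth[OF p]]] by simp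
      have "norm (grad ?p x) \<le> \<bar>grad ?p x $ 1\<bar> + \<bar>grad ?p x $ 2\<bar>"
        using norm_le_l1_cart[of "grad ?p x"] by (simp add: sum_2)
      also have "\<dots> \<le> C1 + C2" using C1(2)[rule_format, of x] C2(2)[rule_format, of x] by (simp add: grad_def)
      finally have n: "norm (grad ?p x) \<le> C1 + C2" .
      show "onorm (\<lambda>h. grad ?p x \<bullet> h) \<le> C1 + C2"
      proof (rule onorm_bound)
        show "norm (grad ?p x \<bullet> h) \<le> (C1 + C2) * norm h" for h
          using Cauchy_Schwarz_ineq2[of "grad ?p x" h] mult_right_mono[OF n norm_ge_zero[of h]] by simp
      qed (use C1 C2 in simp)
    qed auto
    then show ?thesis using C1(1) C2(1) by (intro exI[of _ "C1 + C2"]) simp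
  qed
  then obtain C where C: "\<And>i. C i \<ge> 0" "\<And>i y z. \<bar>pderiv_at i f y - pderiv_at i f z\<bar> \<le> C i * norm (y - z)"
    by metis
  have lip: "norm (grad f y - grad f z) \<le> (C 1 + C 2) * norm (y - z)" for y z
    using norm_le_l1_cart[of "grad f y - grad f z"] C(2)[of 1 y z] C(2)[of 2 y z]
    by (simp add: sum_2 grad_def distrib_right)
  have "\<bar>f (y + h) - f y - grad f y \<bullet> h\<bar> \<le> (C 1 + C 2) * (norm h)\<^sup>2" for y h
  proof -
    \<comment> \<open>Without its linear part the function has gradient of order
      \<open>norm h\<close> on the ball of that radius. The resulting constant is uniform in
      \<open>y\<close>, so the remainder can be integrated over all translates.\<close>
    define F where "F z = f z - grad f y \<bullet> z" for z
    have "norm (F (y + h) - F y) \<le> ((C 1 + C 2) * norm h) * norm (y + h - y)"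
    proof (rule differentiable_bound[of "cball y (norm h)" F "\<lambda>x k. (grad f x - grad f y) \<bullet> k"])
      fix x assume x: "x \<in> cball y (norm h)"
      have "(F has_derivative (\<lambda>k. grad f x \<bullet> k - grad f y \<bullet> k)) (at x)"
        unfolding F_def
        by (intro has_derivative_diff has_derivative_grad smooth_differentiable test_forms_smooth assms)
          (auto intro!: derivative_eq_intros)
      then show "(F has_derivative (\<lambda>k. (grad f x - grad f y) \<bullet> k)) (at x within cball y (norm h))"
        by (simp add: inner_diff_left has_derivative_at_withinI)
      have n: "norm (grad f x - grad f y) \<le> (C 1 + C 2) * norm h"
        using lip[of x y] x C(1)[of 1] C(1)[of 2]
          mult_left_mono[of "norm (x - y)" "norm h" "C 1 + C 2"]
        by (simp add: dist_norm norm_minus_commute)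
      show "onorm (\<lambda>k. (grad f x - grad f y) \<bullet> k) \<le> (C 1 + C 2) * norm h"
      proof (rule onorm_bound)
        show "norm ((grad f x - grad f y) \<bullet> k) \<le> (C 1 + C 2) * norm h * norm k" for k
          using Cauchy_Schwarz_ineq2[of "grad f x - grad f y" k] mult_right_mono[OF n norm_ge_zero[of k]] by simp
      qed (use C in simp)
    qed (auto simp: dist_norm)
    then show ?thesis unfolding F_def by (simp add: inner_add_right power2_eq_square algebra_simps)
  qed
  then show ?thesis using C(1) by (intro exI[of _ "C 1 + C 2"]) simp
qed

text \<open>A common form for two operators. Convolution has the mollified function as weight and
  the identity as shift; the divergence solver has a weight on a strip of lengths and slopes and
  shifts along rays. One smoothness proof serves both.\<close>

definition superpose :: "'m measure \<Rightarrow> ('m \<Rightarrow> real) \<Rightarrow> ('m \<Rightarrow> real^2) \<Rightarrow> (real^2 \<Rightarrow> real) \<Rightarrow> real^2 \<Rightarrow> real" where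
  "superpose M w Y f x = (LINT p|M. w p * f (x - Y p))"

context
  fixes M :: "'m measure" and w :: "'m \<Rightarrow> real" and Y :: "'m \<Rightarrow> real^2"
  assumes w: "integrable M w" and Y [measurable]: "Y \<in> borel_measurable M"
begin

lemma superpose_integrable:
  assumes "f \<in> test_forms"
  shows "integrable M (\<lambda>p. w p * f (x - Y p))"
proof -
  obtain C where C: "C > 0" "\<forall>x. norm (f x) \<le> C" using test_forms_bounded[OF assms] by blast
  have [measurable]: "f \<in> borel_measurable borel"
    by (intro borel_measurable_continuous_onI smooth_continuous_on test_forms_smooth assms)
  have [measurable]: "w \<in> borel_measurable M" using w by simp
  show ?thesis
  proof (rule Bochner_Integration.integrable_bound[of M "\<lambda>p. C * w p"])
    show "integrable M (\<lambda>p. C * w p)" using w by simp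
    show "AE p in M. norm (w p * f (x - Y p)) \<le> norm (C * w p)"
    proof (intro AE_I2)
      fix p
      have "norm (f (x - Y p)) \<le> C" using C by blast
      then show "norm (w p * f (x - Y p)) \<le> norm (C * w p)"
        using C(1) mult_left_mono[of "norm (f (x - Y p))" C "\<bar>w p\<bar>"] by (simp add: abs_mult mult.commute)
    qed
  qed measurable
qed

text \<open>All derivatives fall on the test form, so integrability of the weight suffices: the
  uniform quadratic remainder of \<open>f\<close> is integrated against \<bar>w\<bar>.\<close>

lemma superpose_has_derivative:
  assumes f: "f \<in> test_forms"
  shows "(superpose M w Y f has_derivative
    (\<lambda>h. superpose M w Y (pderiv_at 1 f) x * h $ 1 + superpose M w Y (pderiv_at 2 f) x * h $ 2)) (at x)"
proof -
  let ?D = "\<lambda>h. superpose M w Y (pderiv_at 1 f) x * h $ 1 + superpose M w Y (pderiv_at 2 f) x * h $ 2"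
  obtain C where C: "C \<ge> 0" "\<forall>y h. \<bar>f (y + h) - f y - grad f y \<bullet> h\<bar> \<le> C * (norm h)\<^sup>2"
    using test_form_quadratic_remainder[OF f] by blast
  define I where "I = (LINT p|M. \<bar>w p\<bar>)"
  have I0: "I \<ge> 0" unfolding I_def by simp
  have bound: "\<bar>superpose M w Y f (x + h) - superpose M w Y f x - ?D h\<bar> \<le> C * I * (norm h)\<^sup>2" for h
  proof -
    note int = superpose_integrable[OF f] superpose_integrable[OF pderiv_at_test_forms[OF f]]
    have "superpose M w Y f (x + h) - superpose M w Y f x - ?D h
      = (LINT p|M. w p * f (x + h - Y p) - w p * f (x - Y p) -
         (w p * pderiv_at 1 f (x - Y p) * h $ 1 + w p * pderiv_at 2 f (x - Y p) * h $ 2))"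
      unfolding superpose_def using int by simp
    also have "\<dots> = (LINT p|M. w p * (f ((x - Y p) + h) - f (x - Y p) - grad f (x - Y p) \<bullet> h))"
      by (intro Bochner_Integration.integral_cong)
        (auto simp: grad_def inner_vec_def sum_2 algebra_simps)
    finally have eq: "superpose M w Y f (x + h) - superpose M w Y f x - ?D h = \<dots>" .
    have "\<bar>LINT p|M. w p * (f ((x - Y p) + h) - f (x - Y p) - grad f (x - Y p) \<bullet> h)\<bar>
        \<le> (LINT p|M. C * (norm h)\<^sup>2 * \<bar>w p\<bar>)"
    proof -
      have "integrable M (\<lambda>p. w p * f (x + h - Y p) - w p * f (x - Y p) -
         (w p * pderiv_at 1 f (x - Y p) * h $ 1 + w p * pderiv_at 2 f (x - Y p) * h $ 2))"
        using int by simp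
      then have I: "integrable M (\<lambda>p. w p * (f ((x - Y p) + h) - f (x - Y p) - grad f (x - Y p) \<bullet> h))"
        by (rule back_subst[of "integrable M"])
          (auto simp: grad_def inner_vec_def sum_2 algebra_simps)
      have "integrable M (\<lambda>p. C * (norm h)\<^sup>2 * \<bar>w p\<bar>)" using w by simp
      moreover have "\<bar>w p * (f ((x - Y p) + h) - f (x - Y p) - grad f (x - Y p) \<bullet> h)\<bar> \<le> C * (norm h)\<^sup>2 * \<bar>w p\<bar>" for p
        using mult_left_mono[OF C(2)[rule_format, of "x - Y p" h] abs_ge_zero[of "w p"]]
        by (simp add: abs_mult mult.commute)
      ultimately have "(LINT p|M. \<bar>w p * (f ((x - Y p) + h) - f (x - Y p) - grad f (x - Y p) \<bullet> h)\<bar>)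
          \<le> (LINT p|M. C * (norm h)\<^sup>2 * \<bar>w p\<bar>)"
        using I by (intro integral_mono integrable_abs) auto
      then show ?thesis by (rule order_trans[OF integral_abs_bound])
    qed
    also have "\<dots> = C * I * (norm h)\<^sup>2" unfolding I_def by simp
    finally show ?thesis unfolding eq .
  qed
  show ?thesis unfolding has_derivative_at
  proof
    show "bounded_linear ?D"
      by (intro bounded_linear_add bounded_linear_compose[OF bounded_linear_mult_right] bounded_linear_vec_nth)
    show "(\<lambda>h. norm (superpose M w Y f (x + h) - superpose M w Y f x - ?D h) / norm h) \<midarrow>0\<rightarrow> 0"
    proof (rule Lim_null_comparison)
      show "((\<lambda>h::real^2. C * I * norm h) \<longlongrightarrow> 0) (at 0)"
        by (rule tendsto_eq_intros refl tendsto_norm_zero)+ simp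
      show "\<forall>\<^sub>F h in at 0. norm (norm (superpose M w Y f (x + h) - superpose M w Y f x - ?D h) / norm h) \<le> C * I * norm h"
      proof (rule eventually_at_filter[THEN iffD2], intro always_eventually allI impI)
        fix h :: "real^2" assume "h \<noteq> 0"
        then show "norm (norm (superpose M w Y f (x + h) - superpose M w Y f x - ?D h) / norm h) \<le> C * I * norm h"
          using bound[of h] by (simp add: divide_le_eq power2_eq_square mult.assoc)
      qed
    qed
  qed
qed

lemma pderiv_at_superpose:
  assumes "f \<in> test_forms"
  shows "pderiv_at i (superpose M w Y f) = superpose M w Y (pderiv_at i f)"
proof
  fix x
  show "pderiv_at i (superpose M w Y f) x = superpose M w Y (pderiv_at i f) x"
    using pderiv_atI[OF superpose_has_derivative[OF assms], of i] exhaust_2[of i]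
    by (auto simp: axis_def)
qed

lemma smooth_superpose:
  assumes "f \<in> test_forms"
  shows "smooth (superpose M w Y f)"
proof (rule smooth_coinduct[where S = "superpose M w Y ` test_forms"], goal_cases)
  case (2 g x)
  then show ?case using superpose_has_derivative differentiable_def by blast
next
  case (3 g i)
  then show ?case using pderiv_at_superpose pderiv_at_test_forms by blast
qed (use assms in blast)

end

section \<open>Mollification and integration by parts\<close>

text \<open>The polynomial parameter closes the family under differentiation: with s = 1 / t, the
  derivative of p(s) exp(-s) in t is \<open>s\<^sup>2\<close> (p(s) - p'(s)) exp(-s).\<close>

definition flat_exp :: "real poly \<Rightarrow> real \<Rightarrow> real" where
  "flat_exp p t = (if t > 0 then poly p (inverse t) * exp (- inverse t) else 0)"

lemma poly_exp_decay: "((\<lambda>s::real. s ^ k * poly p s * exp (- s)) \<longlongrightarrow> 0) at_top"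
proof (induction p arbitrary: k)
  case (pCons a p)
  have "((\<lambda>s::real. a * (s ^ k / exp s) + s ^ Suc k * poly p s * exp (- s)) \<longlongrightarrow> a * 0 + 0) at_top"
    by (intro tendsto_intros tendsto_power_div_exp_0 pCons.IH)
  then show ?case by (simp add: algebra_simps exp_minus divide_inverse)
qed simp

lemma flat_exp_has_derivative:
  "(flat_exp p has_field_derivative flat_exp ([:0, 0, 1:] * (p - pderiv p)) t) (at t)"
proof -
  consider "t > 0" | "t < 0" | "t = 0" by linarith
  then show ?thesis
  proof cases
    case 1
    have "((\<lambda>t. poly p (inverse t) * exp (- inverse t)) has_field_derivative
       flat_exp ([:0, 0, 1:] * (p - pderiv p)) t) (at t)"
      using 1 by (auto intro!: derivative_eq_intros poly_DERIV[THEN DERIV_chain2]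
        simp: flat_exp_def power2_eq_square algebra_simps)
    then show ?thesis
      by (rule has_field_derivative_transform_within_open[where S = "{0<..}"])
        (use 1 in \<open>auto simp: flat_exp_def\<close>)
  next
    case 2
    have "((\<lambda>t. 0) has_field_derivative flat_exp ([:0, 0, 1:] * (p - pderiv p)) t) (at t)"
      using 2 by (simp add: flat_exp_def)
    then show ?thesis
      by (rule has_field_derivative_transform_within_open[where S = "{..<0}"])
        (use 2 in \<open>auto simp: flat_exp_def\<close>)
  next
    case 3
    \<comment> \<open>The first power of \<open>inverse h\<close> is the division in the difference
      quotient at 0; exponential decay absorbs it.\<close>
    have "((\<lambda>h. (inverse h) ^ 1 * poly p (inverse h) * exp (- inverse h)) \<longlongrightarrow> 0) (at_right 0)"
      by (rule filterlim_compose[OF poly_exp_decay filterlim_inverse_at_top_right])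
    then have "((\<lambda>h. flat_exp p h / h) \<longlongrightarrow> 0) (at_right 0)"
      by (rule Lim_transform_eventually)
        (auto simp: eventually_at_filter flat_exp_def field_simps intro!: always_eventually)
    moreover have "((\<lambda>h. flat_exp p h / h) \<longlongrightarrow> 0) (at_left 0)"
      by (rule Lim_transform_eventually[OF tendsto_const])
        (auto simp: eventually_at_filter flat_exp_def intro!: always_eventually)
    ultimately have "((\<lambda>h. flat_exp p h / h) \<longlongrightarrow> 0) (at 0)"
      by (simp add: filterlim_split_at)
    then show ?thesis using 3 unfolding DERIV_def by (simp add: flat_exp_def)
  qed
qed

lemma smooth_flat_exp: "smooth (\<lambda>x. k * flat_exp p (c + s * x $ j))"
proof (rule smooth_coinduct[where S = "{\<lambda>x. k * flat_exp p (c + s * x $ j) | k p. True}"], goal_cases)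
  case 1
  then show ?case by blast
next
  have der: "((\<lambda>x::real^2. k * flat_exp p (c + s * x $ j)) has_derivative
     (\<lambda>h. k * (flat_exp ([:0, 0, 1:] * (p - pderiv p)) (c + s * x $ j) * (s * h $ j)))) (at x)"
    for k p and x :: "real^2"
  proof -
    have "((\<lambda>x::real^2. c + s * x $ j) has_derivative (\<lambda>h. s * h $ j)) (at x)"
      by (auto intro!: derivative_eq_intros bounded_linear.has_derivative[OF bounded_linear_vec_nth])
    from has_derivative_compose[OF this flat_exp_has_derivative[unfolded has_field_derivative_def]]
    show ?thesis by (intro has_derivative_mult_right)
  qed
  {
    case (2 g x)
    then show ?case using der differentiable_def by blast
  next
    case (3 g i)
    then obtain k p where g: "g = (\<lambda>x. k * flat_exp p (c + s * x $ j))" by blast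
    have "pderiv_at i g = (\<lambda>x. (k * (s * axis i 1 $ j)) * flat_exp ([:0, 0, 1:] * (p - pderiv p)) (c + s * x $ j))"
      unfolding g using pderiv_atI[OF der] by (auto simp: algebra_simps)
    then show ?case by blast
  }
qed

lemma integrable_continuous_compact_support:
  fixes f :: "'a::euclidean_space \<Rightarrow> real"
  assumes "continuous_on UNIV f" "\<And>x. norm x > B \<Longrightarrow> f x = 0"
  shows "integrable lborel f"
proof -
  have "integrable lborel (\<lambda>x. indicator (cball 0 B) x *\<^sub>R f x)"
    by (intro borel_integrable_compact compact_cball continuous_on_subset[OF assms(1)]) auto
  then show ?thesis
    by (rule back_subst[of "integrable lborel"]) (use assms(2) in \<open>force simp: indicator_def\<close>)
qed

lemma integrable_test_form:
  fixes f :: "real^2 \<Rightarrow> real"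
  assumes "f \<in> test_forms"
  shows "integrable lborel f"
proof -
  obtain B where "\<forall>x. norm x > B \<longrightarrow> f x = 0" using test_forms_support[OF assms] by blast
  then show ?thesis
    by (intro integrable_continuous_compact_support[of f B] smooth_continuous_on test_forms_smooth assms) auto
qed

definition mollifier :: "real \<Rightarrow> (real^2 \<Rightarrow> real) \<Rightarrow> bool" where
  "mollifier \<epsilon> \<eta> \<longleftrightarrow> \<eta> \<in> test_forms \<and> (\<forall>x. 0 \<le> \<eta> x) \<and> (\<forall>x. norm x > \<epsilon> \<longrightarrow> \<eta> x = 0) \<and>
     integral\<^sup>L lborel \<eta> = 1"

lemma mollifier_exists:
  assumes "0 < \<epsilon>"
  shows "\<exists>\<eta>. mollifier \<epsilon> \<eta>"
proof -
  \<comment> \<open>Outside \<open>cball 0 \<epsilon>\<close> some coordinate exceeds \<epsilon> / 2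
    in absolute value, since the norm is at most the sum of both; one of the four one-sided factors
    of \<open>h\<close> then vanishes.\<close>
  define e where "e = \<epsilon> / 2"
  have e: "e > 0" unfolding e_def using assms by simp
  define b where "b s x = flat_exp 1 (e + s * x $ 1) * flat_exp 1 (e + s * x $ 2)" for s and x :: "real^2"
  define h where "h x = b 1 x * b (- 1) x" for x
  have sm: "smooth h" unfolding h_def b_def
    by (intro smooth_mult smooth_flat_exp[of 1 1 e, unfolded mult_1[of "flat_exp _ _"]])
  have nn: "0 \<le> h x" for x unfolding h_def b_def flat_exp_def by simp
  have zero: "h x = 0" if "norm x > \<epsilon>" for x
  proof -
    have "\<bar>x $ 1\<bar> > e \<or> \<bar>x $ 2\<bar> > e"
      using norm_le_l1_cart[of x] that unfolding e_def by (auto simp: sum_2)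
    then show ?thesis unfolding h_def b_def flat_exp_def by auto
  qed
  have tf: "h \<in> test_forms" using sm zero by (rule test_formsI)
  have pos: "h x > 0" if "x \<in> box (vector [-e, -e]) (vector [e, e])" for x
    using that unfolding h_def b_def flat_exp_def by (auto simp: mem_box_cart forall_2)
  have int: "integrable lborel h" by (rule integrable_test_form[OF tf])
  have "integral\<^sup>L lborel h \<noteq> 0"
  proof
    assume "integral\<^sup>L lborel h = 0"
    then have "AE x in lborel. h x = 0"
      using integral_nonneg_eq_0_iff_AE[OF int] nn by simp
    then have "AE x::real^2 in lborel. x \<notin> box (vector [-e, -e]) (vector [e, e])"
      by eventually_elim (use pos in force)
    then have "emeasure lborel (box (vector [-e, -e]) (vector [e, e]) :: (real^2) set) = 0"
      by (subst (asm) AE_iff_measurable[OF _ refl]) auto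
    then have "negligible (box (vector [-e, -e]) (vector [e, e]) :: (real^2) set)"
      by (simp add: negligible_iff_emeasure0)
    then have "box (vector [-e, -e]) (vector [e, e]) = ({} :: (real^2) set)"
      by (simp add: negligible_interval)
    moreover have "(0::real^2) \<in> box (vector [-e, -e]) (vector [e, e])"
      using e by (simp add: mem_box_cart forall_2)
    ultimately show False by blast
  qed
  then have I: "integral\<^sup>L lborel h > 0"
    using Bochner_Integration.integral_nonneg[of lborel h] nn by (simp add: order_less_le)
  let ?\<eta> = "\<lambda>x. inverse (integral\<^sup>L lborel h) *\<^sub>R h x"
  have "?\<eta> \<in> test_forms" by (intro test_forms_scaleR tf)
  moreover have "integral\<^sup>L lborel ?\<eta> = 1" using I int by simp
  ultimately show ?thesis
    unfolding mollifier_def using I nn zero by (intro exI[of _ ?\<eta>]) simp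
qed

lemma lborel_reflect: "distr lborel borel (\<lambda>y. x - y) = (lborel :: 'a::euclidean_space measure)"
  using lborel_affine[of "- 1" x] by (simp add: density_1)

lemma integral_lborel_reflect:
  fixes f :: "'a::euclidean_space \<Rightarrow> real"
  assumes "f \<in> borel_measurable borel"
  shows "(LINT y|lborel. f (x - y)) = integral\<^sup>L lborel f"
  using integral_distr[of "\<lambda>y. x - y" lborel borel f] assms by (simp add: lborel_reflect)

lemma integrable_lborel_reflect:
  fixes f :: "'a::euclidean_space \<Rightarrow> real"
  assumes "integrable lborel f"
  shows "integrable lborel (\<lambda>y. f (x - y))"
  using integrable_distr_eq[of "\<lambda>y. x - y" lborel borel f] assms by (simp add: lborel_reflect)

lemma integral_lborel_translate:
  fixes f :: "'a::euclidean_space \<Rightarrow> real"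
  assumes "f \<in> borel_measurable borel"
  shows "(LINT y|lborel. f (a + y)) = integral\<^sup>L lborel f"
  using integral_distr[of "(+) a" lborel borel f] assms by (simp add: lborel_distr_plus)

lemma integrable_lborel_translate:
  fixes f :: "'a::euclidean_space \<Rightarrow> real"
  assumes "integrable lborel f"
  shows "integrable lborel (\<lambda>y. f (a + y))"
  using integrable_distr_eq[of "(+) a" lborel borel f] assms by (simp add: lborel_distr_plus)

definition mollify :: "(real^2 \<Rightarrow> real) \<Rightarrow> (real^2 \<Rightarrow> real) \<Rightarrow> real^2 \<Rightarrow> real" where
  "mollify \<eta> g = superpose lborel g (\<lambda>y. y) \<eta>"

context
  fixes \<eta> g :: "real^2 \<Rightarrow> real" and \<epsilon> :: real
  assumes mollifier: "mollifier \<epsilon> \<eta>" and g: "integrable lborel g"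
begin

private lemma \<eta>: "\<eta> \<in> test_forms" "0 \<le> \<eta> x" "norm x > \<epsilon> \<Longrightarrow> \<eta> x = 0" "integral\<^sup>L lborel \<eta> = 1"
  using mollifier unfolding mollifier_def by auto

lemma smooth_mollify: "smooth (mollify \<eta> g)"
  unfolding mollify_def by (rule smooth_superpose) (use \<eta> g in auto)

lemma integrable_mollify: "integrable lborel (\<lambda>y. g y * \<eta> (x - y))"
  using superpose_integrable[OF g _ \<eta>(1), of "\<lambda>y. y"] by simp

lemma integrable_mollify': "integrable lborel (\<lambda>y. g (x - y) * \<eta> y)"
  using integrable_lborel_reflect[OF integrable_mollify[of x], of x] by simp

lemma mollify_eq: "mollify \<eta> g x = (LINT y|lborel. g (x - y) * \<eta> y)"
proof -
  have "(\<lambda>y. g y * \<eta> (x - y)) \<in> borel_measurable borel"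
    using integrable_mollify[of x] by (simp add: borel_measurable_integrable)
  from integral_lborel_reflect[OF this, of x]
  show ?thesis unfolding mollify_def superpose_def by simp
qed

lemma mollify_mono_le:
  assumes "\<And>y. dist x y \<le> \<epsilon> \<Longrightarrow> g y \<le> b"
  shows "mollify \<eta> g x \<le> b"
proof -
  have "mollify \<eta> g x \<le> (LINT y|lborel. b * \<eta> y)"
    unfolding mollify_eq
  proof (rule integral_mono[OF integrable_mollify'])
    show "integrable lborel (\<lambda>y. b * \<eta> y)" using integrable_test_form[OF \<eta>(1)] by simp
    fix y
    show "g (x - y) * \<eta> y \<le> b * \<eta> y"
      using assms[of "x - y"] \<eta>(2,3)[of y] by (cases "norm y \<le> \<epsilon>") (auto simp: dist_norm intro: mult_right_mono)
  qed
  then show ?thesis using \<eta>(4) by simp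
qed

lemma mollify_mono_ge:
  assumes "\<And>y. dist x y \<le> \<epsilon> \<Longrightarrow> b \<le> g y"
  shows "b \<le> mollify \<eta> g x"
proof -
  have "(LINT y|lborel. b * \<eta> y) \<le> mollify \<eta> g x"
    unfolding mollify_eq
  proof (rule integral_mono[OF _ integrable_mollify'])
    show "integrable lborel (\<lambda>y. b * \<eta> y)" using integrable_test_form[OF \<eta>(1)] by simp
    fix y
    show "b * \<eta> y \<le> g (x - y) * \<eta> y"
      using assms[of "x - y"] \<eta>(2,3)[of y] by (cases "norm y \<le> \<epsilon>") (auto simp: dist_norm intro: mult_right_mono)
  qed
  then show ?thesis using \<eta>(4) by simp
qed

text \<open>Second differences commute with averaging over translates, and the weights are
  nonnegative with total mass one, so the constant is kept.\<close>

lemma mollify_second_difference: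
  assumes "second_difference_bounded \<rho> g"
  shows "second_difference_bounded \<rho> (mollify \<eta> g)"
  unfolding second_difference_bounded_def
proof (intro allI)
  fix x v
  have eq: "mollify \<eta> g (x + v) + mollify \<eta> g (x - v) - 2 * mollify \<eta> g x =
    (LINT y|lborel. (g (x - y + v) + g (x - y - v) - 2 * g (x - y)) * \<eta> y)"
  proof -
    have "(LINT y|lborel. (g (x - y + v) + g (x - y - v) - 2 * g (x - y)) * \<eta> y) =
      (LINT y|lborel. g (x + v - y) * \<eta> y + g (x - v - y) * \<eta> y - 2 * (g (x - y) * \<eta> y))"
      by (simp add: algebra_simps)
    then show ?thesis
      unfolding mollify_eq
      using integrable_mollify'[of "x + v"] integrable_mollify'[of "x - v"] integrable_mollify'[of x] by simp
  qed
  have I: "integrable lborel (\<lambda>y. (g (x - y + v) + g (x - y - v) - 2 * g (x - y)) * \<eta> y)"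
  proof -
    have "integrable lborel (\<lambda>y. g (x + v - y) * \<eta> y + g (x - v - y) * \<eta> y - 2 * (g (x - y) * \<eta> y))"
      using integrable_mollify'[of "x + v"] integrable_mollify'[of "x - v"] integrable_mollify'[of x] by simp
    then show ?thesis by (simp add: algebra_simps)
  qed
  have "\<bar>LINT y|lborel. (g (x - y + v) + g (x - y - v) - 2 * g (x - y)) * \<eta> y\<bar>
      \<le> (LINT y|lborel. (norm v)\<^sup>2 / \<rho> * \<eta> y)"
  proof (rule integral_abs_bound_integral[OF I])
    show "integrable lborel (\<lambda>y. (norm v)\<^sup>2 / \<rho> * \<eta> y)" using integrable_test_form[OF \<eta>(1)] by simp
    fix y
    show "\<bar>(g (x - y + v) + g (x - y - v) - 2 * g (x - y)) * \<eta> y\<bar> \<le> (norm v)\<^sup>2 / \<rho> * \<eta> y"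
      using assms[unfolded second_difference_bounded_def, rule_format, of "x - y" v] \<eta>(2)[of y]
      by (simp only: abs_mult abs_of_nonneg mult_right_mono)
  qed
  then show "\<bar>mollify \<eta> g (x + v) + mollify \<eta> g (x - v) - 2 * mollify \<eta> g x\<bar> \<le> (norm v)\<^sup>2 / \<rho>"
    unfolding eq using \<eta>(4) by simp
qed

end

text \<open>The indicator of the r / 2 neighbourhood of \<open>K\<close> is mollified at scale r /
  2: each point of \<open>K\<close> sees only the value one, each point farther than
  \<open>r\<close> from \<open>K\<close> only the value zero.\<close>

lemma smooth_urysohn:
  fixes K V :: "(real^2) set"
  assumes "compact K" "open V" "K \<subseteq> V"
  obtains a L where "a \<in> test_forms" "\<And>x. 0 \<le> a x" "\<And>x. a x \<le> (1::real)" "\<And>x. x \<in> K \<Longrightarrow> a x = 1"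
    "compact L" "L \<subseteq> V" "\<And>x. x \<notin> L \<Longrightarrow> a x = 0"
proof -
  obtain r where r: "r > 0" "(\<Union>x\<in>K. cball x r) \<subseteq> V"
    using compact_subset_open_imp_cball_epsilon_subset[OF assms] by blast
  have nbhd: "compact (\<Union>x\<in>K. cball x s)" for s
  proof -
    have "(\<Union>x\<in>K. cball x s) = {x + y | x y. x \<in> K \<and> y \<in> cball 0 s}"
      by (auto simp: dist_norm) (metis add_diff_cancel_left' diff_add_cancel norm_minus_commute)
    then show ?thesis using compact_sums[OF assms(1) compact_cball[of 0 s]] by (simp only:)
  qed
  define N where "N = (\<Union>x\<in>K. cball x (r/2))"
  obtain \<eta> where \<eta>: "mollifier (r/2) \<eta>" using mollifier_exists[of "r/2"] r(1) by auto
  have "N \<in> sets borel" "emeasure lborel N < \<infinity>"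
    unfolding N_def using emeasure_compact_finite[OF nbhd]
    by (auto intro!: borel_compact nbhd)
  then have g: "integrable lborel (indicator N :: real^2 \<Rightarrow> real)"
    by simp
  define a where "a = mollify \<eta> (indicator N)"
  define L where "L = (\<Union>x\<in>K. cball x r)"
  have range: "0 \<le> a x" "a x \<le> 1" for x
    unfolding a_def by (intro mollify_mono_ge[OF \<eta> g] mollify_mono_le[OF \<eta> g], simp)+
  have one: "a x = 1" if "x \<in> K" for x
  proof -
    have "1 \<le> a x" unfolding a_def
      by (rule mollify_mono_ge[OF \<eta> g]) (use that in \<open>auto simp: N_def indicator_def\<close>)
    then show ?thesis using range[of x] by simp
  qed
  have zero: "a x = 0" if "x \<notin> L" for x
  proof -
    have "a x \<le> 0" unfolding a_def
    proof (rule mollify_mono_le[OF \<eta> g])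
      fix y assume y: "dist x y \<le> r / 2"
      have "y \<notin> N"
      proof
        assume "y \<in> N"
        then obtain k where k: "k \<in> K" "dist k y \<le> r/2" unfolding N_def by auto
        then have "dist k x \<le> r" using y dist_triangle[of k x y] by (simp add: dist_commute)
        then show False using that k(1) unfolding L_def by auto
      qed
      then show "indicator N y \<le> (0::real)" by simp
    qed
    then show ?thesis using range[of x] by simp
  qed
  obtain B where B: "L \<subseteq> cball 0 B" using compact_subset_cball[OF nbhd[of r]] unfolding L_def by blast
  have "smooth a" unfolding a_def by (rule smooth_mollify[OF \<eta> g])
  then have "a \<in> test_forms" by (rule test_formsI[of _ B]) (use zero B in force)
  then show thesis
    using that[of a L] range one zero nbhd[of r] r(2) unfolding L_def by blast
qed

text \<open>Difference quotients have integral zero by translation invariance and converge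
  dominatedly to the partial derivative, which avoids iterated integrals.\<close>

lemma integral_pderiv_zero:
  fixes f :: "real^2 \<Rightarrow> real"
  assumes diff: "\<And>x. f differentiable (at x)" and cont: "continuous_on UNIV (pderiv_at i f)"
    and supp: "\<And>x. norm x > B \<Longrightarrow> f x = 0"
  shows "integral\<^sup>L lborel (pderiv_at i f) = 0"
proof -
  let ?e = "axis i 1 :: real^2" and ?p = "pderiv_at i f"
  have fc: "continuous_on UNIV f"
    by (simp add: continuous_at_imp_continuous_on diff differentiable_imp_continuous_within)
  have f: "integrable lborel f" by (rule integrable_continuous_compact_support[OF fc supp])
  have "compact (?p ` cball 0 B)"
    by (intro compact_continuous_image continuous_on_subset[OF cont] compact_cball) simp
  then obtain M where M: "\<forall>y\<in>?p ` cball 0 B. norm y \<le> M" "M > 0"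
    using bounded_pos compact_imp_bounded by blast
  have Mb: "\<bar>?p x\<bar> \<le> M" for x
    using M supp pderiv_at_eq_0_outside[of B f x i] by (cases "norm x > B") auto
  have line: "((\<lambda>t. f (x + t *\<^sub>R ?e)) has_field_derivative ?p (x + s *\<^sub>R ?e)) (at s)" for x s
  proof -
    have "((\<lambda>t. f ((x + s *\<^sub>R ?e) + t *\<^sub>R ?e)) has_field_derivative (grad f (x + s *\<^sub>R ?e) \<bullet> ?e)) (at 0)"
      by (rule has_field_derivative_line[OF has_derivative_grad[OF diff]])
    then show ?thesis
      using DERIV_shift[where f = "\<lambda>t. f (x + t *\<^sub>R ?e)" and x = 0 and z = s]
      by (simp add: inner_grad_axis scaleR_left_distrib algebra_simps)
  qed
  have lip: "\<bar>f (x + h *\<^sub>R ?e) - f x\<bar> \<le> M * h" if hpos: "h > 0" for x h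
  proof -
    obtain z where "f (x + h *\<^sub>R ?e) - f (x + 0 *\<^sub>R ?e) = (h - 0) * ?p (x + z *\<^sub>R ?e)"
      using MVT2[OF hpos, of "\<lambda>t. f (x + t *\<^sub>R ?e)" "\<lambda>s. ?p (x + s *\<^sub>R ?e)"] line by blast
    then show ?thesis using Mb[of "x + z *\<^sub>R ?e"] hpos by (simp add: abs_mult mult.commute)
  qed
  define h where "h n = 1 / real (Suc n)" for n
  have h: "0 < h n" "h n \<le> 1" for n unfolding h_def by auto
  define q where "q n x = (f (h n *\<^sub>R ?e + x) - f x) / h n" for n x
  have [measurable]: "f \<in> borel_measurable borel" "?p \<in> borel_measurable borel"
    using fc cont by (simp_all add: borel_measurable_continuous_onI)
  have q0: "integral\<^sup>L lborel (q n) = 0" for n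
    unfolding q_def using f integrable_lborel_translate[OF f] integral_lborel_translate[of f] by simp
  \<comment> \<open>The shifts \<open>h n\<close> are at most 1, so all quotients vanish outside the
    ball of radius B + 1.\<close>
  have "(\<lambda>n. integral\<^sup>L lborel (q n)) \<longlonglongrightarrow> integral\<^sup>L lborel ?p"
  proof (rule integral_dominated_convergence[where w = "\<lambda>x. M * indicator (cball 0 (B + 1)) x"])
    show "?p \<in> borel_measurable lborel" by simp
    show "q n \<in> borel_measurable lborel" for n unfolding q_def by measurable
    show "integrable lborel (\<lambda>x::real^2. M * indicator (cball 0 (B + 1)) x)"
      using emeasure_compact_finite[OF compact_cball[of "0::real^2" "B + 1"]] by (intro integrable_mult_right) simp
    show "AE x in lborel. (\<lambda>n. q n x) \<longlonglongrightarrow> ?p x"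
    proof (rule AE_I2)
      fix x
      have "((\<lambda>t. (f (x + t *\<^sub>R ?e) - f x) / t) \<longlongrightarrow> ?p x) (at 0)"
        using line[of x 0] unfolding DERIV_def by simp
      moreover have "filterlim h (at 0) sequentially"
        unfolding filterlim_at h_def using LIMSEQ_inverse_real_of_nat
        by (auto simp: inverse_eq_divide)
      ultimately have "(\<lambda>n. (f (x + h n *\<^sub>R ?e) - f x) / h n) \<longlonglongrightarrow> ?p x"
        by (rule filterlim_compose)
      then show "(\<lambda>n. q n x) \<longlonglongrightarrow> ?p x" unfolding q_def by (simp add: add.commute)
    qed
    show "AE x in lborel. norm (q n x) \<le> M * indicator (cball 0 (B + 1)) x" for n
    proof (rule AE_I2)
      fix x :: "real^2"
      show "norm (q n x) \<le> M * indicator (cball 0 (B + 1)) x"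
      proof (cases "norm x \<le> B + 1")
        case True
        then show ?thesis using lip[OF h(1)[of n], of x] h(1)[of n]
          unfolding q_def by (simp add: add.commute field_simps)
      next
        case False
        have "norm x \<le> norm (h n *\<^sub>R ?e + x) + norm (h n *\<^sub>R ?e)"
          using norm_triangle_ineq4[of "h n *\<^sub>R ?e + x" "h n *\<^sub>R ?e"] by simp
        then have "norm (h n *\<^sub>R ?e + x) > B" using False h[of n] by simp
        then show ?thesis using False supp[of x] supp[of "h n *\<^sub>R ?e + x"] unfolding q_def by simp
      qed
    qed
  qed
  then show ?thesis unfolding q0 by (simp add: LIMSEQ_const_iff)
qed

text \<open>Only first derivatives of \<open>a\<close> enter. This suits the cut-off in
  \<open>perimeter_estimate\<close>, whose profile from \<open>cutoff_exists\<close> is known to be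
  of class C^1.\<close>

lemma integration_by_parts:
  fixes a b :: "real^2 \<Rightarrow> real"
  assumes a: "\<And>x. a differentiable (at x)" "continuous_on UNIV (pderiv_at i a)"
    and b: "b \<in> test_forms"
  shows "(LINT x|lborel. a x * pderiv_at i b x) = - (LINT x|lborel. pderiv_at i a x * b x)"
proof -
  have ac: "continuous_on UNIV a"
    by (simp add: continuous_at_imp_continuous_on a differentiable_imp_continuous_within)
  have bd: "b differentiable (at x)" for x using b smooth_differentiable test_forms_smooth by blast
  have bc: "continuous_on UNIV b" "continuous_on UNIV (pderiv_at i b)"
    using b smooth_continuous_on test_forms_smooth pderiv_at_test_forms by blast+
  obtain B where B: "\<And>x. norm x > B \<Longrightarrow> b x = 0" using test_forms_support[OF b] by blast
  have eq: "pderiv_at i (\<lambda>x. a x * b x) = (\<lambda>x. pderiv_at i a x * b x + a x * pderiv_at i b x)"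
    using pderiv_at_mult[OF a(1) bd] by blast
  have 1: "integrable lborel (\<lambda>x. pderiv_at i a x * b x)"
    by (rule integrable_continuous_compact_support[of _ B]) (auto intro!: continuous_intros a bc simp: B)
  have 2: "integrable lborel (\<lambda>x. a x * pderiv_at i b x)"
    by (rule integrable_continuous_compact_support[of _ B])
      (auto intro!: continuous_intros ac bc simp: B pderiv_at_eq_0_outside[of B b])
  have "integral\<^sup>L lborel (pderiv_at i (\<lambda>x. a x * b x)) = 0"
    by (rule integral_pderiv_zero[of _ _ B])
      (auto simp: eq B intro!: continuous_intros ac bc a differentiable_mult bd)
  then show ?thesis unfolding eq using 1 2 by simp
qed

section \<open>A right inverse of the divergence\<close>

definition plane_vec :: "real \<times> real \<Rightarrow> real^2" where
  "plane_vec p = fst p *\<^sub>R axis 1 1 + snd p *\<^sub>R axis 2 1"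

lemma plane_vec_nth [simp]: "plane_vec p $ 1 = fst p" "plane_vec p $ 2 = snd p"
  unfolding plane_vec_def by (simp_all add: axis_def)

lemma continuous_on_plane_vec: "continuous_on S plane_vec"
  unfolding plane_vec_def by (intro continuous_intros)

lemma plane_vec_measurable [measurable]: "plane_vec \<in> borel_measurable borel"
  by (intro borel_measurable_continuous_onI continuous_on_plane_vec)

lemma Basis_plane: "(Basis :: (real^2) set) = {axis 1 1, axis 2 1}"
  unfolding Basis_vec_def by (auto simp: UNIV_2)

text \<open>Boxes determine Lebesgue measure and pull back to products of intervals. This makes
  Tonelli's theorem for two real variables available on \<open>real^2\<close>.\<close>

lemma distr_plane_vec: "distr lborel borel plane_vec = lborel"
proof (rule lborel_eqI[symmetric])
  fix l u :: "real^2" assume le: "\<And>b. b \<in> Basis \<Longrightarrow> l \<bullet> b \<le> u \<bullet> b"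
  have le': "l $ 1 \<le> u $ 1" "l $ 2 \<le> u $ 2"
    using le[of "axis 1 1"] le[of "axis 2 1"] by (auto simp: Basis_plane inner_axis)
  have "plane_vec -` box l u = box (l $ 1) (u $ 1) \<times> box (l $ 2) (u $ 2)"
    by (auto simp: mem_box_cart forall_2)
  then have "emeasure (distr lborel borel plane_vec) (box l u)
      = emeasure (lborel \<Otimes>\<^sub>M lborel) (box (l $ 1) (u $ 1) \<times> box (l $ 2) (u $ 2))"
    by (simp add: emeasure_distr lborel_prod)
  also have "\<dots> = ennreal (u $ 1 - l $ 1) * ennreal (u $ 2 - l $ 2)"
    using le' by (subst lborel.emeasure_pair_measure_Times) auto
  also have "\<dots> = (\<Prod>b\<in>Basis. (u - l) \<bullet> b)"
    using le' by (simp add: Basis_plane inner_axis ennreal_mult axis_eq_axis)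
  finally show "emeasure (distr lborel borel plane_vec) (box l u) = (\<Prod>b\<in>Basis. (u - l) \<bullet> b)" .
qed simp

lemma nn_integral_plane:
  assumes [measurable]: "f \<in> borel_measurable (borel :: (real^2) measure)"
  shows "(\<integral>\<^sup>+a. \<integral>\<^sup>+b. f (plane_vec (a, b)) \<partial>lborel \<partial>lborel) = (\<integral>\<^sup>+x. f x \<partial>lborel)"
proof -
  have "(\<integral>\<^sup>+a. \<integral>\<^sup>+b. f (plane_vec (a, b)) \<partial>lborel \<partial>lborel) = (\<integral>\<^sup>+p. f (plane_vec p) \<partial>(lborel \<Otimes>\<^sub>M lborel))"
    by (rule lborel.nn_integral_fst) (simp add: lborel_prod)
  also have "\<dots> = (\<integral>\<^sup>+x. f x \<partial>distr lborel borel plane_vec)"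
    by (simp add: nn_integral_distr lborel_prod)
  finally show ?thesis by (simp add: distr_plane_vec)
qed

text \<open>The strip of lengths up to \<open>s\<^sub>0\<close> has area 2 \<open>s\<^sub>0\<close>.
  Beyond it, the map from (r, s) to (r, r s) has Jacobian r, larger than \<open>s\<^sub>0\<close>,
  so the rays meet \<open>V\<close> in parameter area at most m / \<open>s\<^sub>0\<close>. For
  \<open>s\<^sub>0\<close> of the order of the square root of \<open>m\<close> the total is of that
  order too.\<close>

lemma ray_integral_bound:
  fixes V :: "(real^2) set" and m T s\<^sub>0 :: real
  assumes [measurable]: "V \<in> sets borel" and m: "emeasure lborel V \<le> ennreal m" "0 \<le> m" and "0 < s\<^sub>0"
  shows "(\<integral>\<^sup>+p. indicator ({0..T} \<times> {-1..1}) p * indicator V (x - plane_vec (fst p, fst p * snd p)) \<partial>lborel)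
     \<le> ennreal (2 * s\<^sub>0 + m / s\<^sub>0)"
proof -
  let ?Y = "\<lambda>p::real\<times>real. plane_vec (fst p, fst p * snd p)"
  let ?I = "\<lambda>a b. indicator V (plane_vec (a, b)) :: ennreal"
  have [measurable]: "(\<lambda>p. plane_vec (fst p, fst p * snd p)) \<in> borel_measurable (lborel :: (real \<times> real) measure)"
    by (simp add: borel_prod[symmetric])
  have "(\<integral>\<^sup>+p. indicator ({0..T} \<times> {-1..1}) p * indicator V (x - ?Y p) \<partial>lborel)
    \<le> (\<integral>\<^sup>+p. indicator ({0..s\<^sub>0} \<times> {-1..1}) p + indicator ({s\<^sub>0<..} \<times> UNIV) p * indicator V (x - ?Y p) \<partial>(lborel :: (real \<times> real) measure))"
    by (intro nn_integral_mono) (auto simp: indicator_def)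
  also have "\<dots> = (\<integral>\<^sup>+p. indicator ({0..s\<^sub>0} \<times> {-1..1}) p \<partial>(lborel :: (real \<times> real) measure))
     + (\<integral>\<^sup>+p. indicator ({s\<^sub>0<..} \<times> UNIV) p * indicator V (x - ?Y p) \<partial>(lborel :: (real \<times> real) measure))"
    by (intro nn_integral_add) (auto simp: borel_prod[symmetric])
  also have "(\<integral>\<^sup>+p. indicator ({0..s\<^sub>0} \<times> {-1..1}) p \<partial>(lborel :: (real \<times> real) measure))
      = emeasure (lborel \<Otimes>\<^sub>M lborel) ({0..s\<^sub>0} \<times> {-1..1::real})"
    by (subst nn_integral_indicator) (auto simp: lborel_prod borel_prod[symmetric])
  also have "\<dots> = ennreal (2 * s\<^sub>0)"
    using \<open>0 < s\<^sub>0\<close> by (subst lborel.emeasure_pair_measure_Times) (auto simp: ennreal_mult mult.commute)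
  also have "(\<integral>\<^sup>+p. indicator ({s\<^sub>0<..} \<times> UNIV) p * indicator V (x - ?Y p) \<partial>(lborel :: (real \<times> real) measure))
     = (\<integral>\<^sup>+r. \<integral>\<^sup>+s. indicator ({s\<^sub>0<..} \<times> UNIV) (r, s) * indicator V (x - ?Y (r, s)) \<partial>lborel \<partial>lborel)"
    unfolding lborel_prod[symmetric] by (subst lborel.nn_integral_fst) (auto simp: lborel_prod borel_prod[symmetric])
  also have "\<dots> \<le> (\<integral>\<^sup>+r. ennreal (1 / s\<^sub>0) * (\<integral>\<^sup>+u. ?I (x $ 1 - r) u \<partial>lborel) \<partial>lborel)"
  proof (intro nn_integral_mono)
    fix r :: real
    show "(\<integral>\<^sup>+s. indicator ({s\<^sub>0<..} \<times> UNIV) (r, s) * indicator V (x - ?Y (r, s)) \<partial>lborel)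
       \<le> ennreal (1 / s\<^sub>0) * (\<integral>\<^sup>+u. ?I (x $ 1 - r) u \<partial>lborel)"
    proof (cases "r > s\<^sub>0")
      case True
      have vec: "x - ?Y (r, s) = plane_vec (x $ 1 - r, x $ 2 + - r * s)" for s
        by (simp add: vec_eq_iff forall_2)
      define I where "I = (\<integral>\<^sup>+s. ?I (x $ 1 - r) (x $ 2 + - r * s) \<partial>lborel)"
      have "(\<integral>\<^sup>+u. ?I (x $ 1 - r) u \<partial>lborel) = ennreal \<bar>- r\<bar> * I"
        unfolding I_def by (rule nn_integral_real_affine) (use True \<open>0 < s\<^sub>0\<close> in \<open>auto intro!: borel_measurable_indicator' simp: borel_prod[symmetric]\<close>)
      then have "ennreal s\<^sub>0 * I \<le> (\<integral>\<^sup>+u. ?I (x $ 1 - r) u \<partial>lborel)"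
        using True by (simp add: mult_right_mono ennreal_leI)
      then have "ennreal (1 / s\<^sub>0) * (ennreal s\<^sub>0 * I) \<le> ennreal (1 / s\<^sub>0) * (\<integral>\<^sup>+u. ?I (x $ 1 - r) u \<partial>lborel)"
        by (rule mult_left_mono) simp
      moreover have "ennreal (1 / s\<^sub>0) * (ennreal s\<^sub>0 * I) = I"
        using \<open>0 < s\<^sub>0\<close> by (simp add: mult.assoc[symmetric] ennreal_mult[symmetric])
      moreover have "(\<integral>\<^sup>+s. indicator ({s\<^sub>0<..} \<times> UNIV) (r, s) * indicator V (x - ?Y (r, s)) \<partial>lborel) = I"
        unfolding I_def vec using True by simp
      ultimately show ?thesis by simp
    qed simp
  qed
  also have "\<dots> = ennreal (1 / s\<^sub>0) * (\<integral>\<^sup>+r. \<integral>\<^sup>+u. ?I (x $ 1 - r) u \<partial>lborel \<partial>lborel)"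
    by (rule nn_integral_cmult) simp
  also have "(\<integral>\<^sup>+r. \<integral>\<^sup>+u. ?I (x $ 1 - r) u \<partial>lborel \<partial>lborel) = (\<integral>\<^sup>+r. \<integral>\<^sup>+u. ?I r u \<partial>lborel \<partial>lborel)"
    using nn_integral_real_affine[of "\<lambda>r. \<integral>\<^sup>+u. ?I r u \<partial>lborel" "- 1" "x $ 1"] by simp
  also have "\<dots> = emeasure lborel V"
    using nn_integral_plane[of "indicator V"] by simp
  also have "ennreal (1 / s\<^sub>0) * emeasure lborel V \<le> ennreal (1 / s\<^sub>0) * ennreal m"
    by (intro mult_left_mono m) simp
  finally show ?thesis
    using m \<open>0 < s\<^sub>0\<close> by (simp add: ennreal_mult[symmetric] ennreal_plus[symmetric] add_left_mono del: ennreal_plus)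
qed

text \<open>Averaging the inverses of the directional derivatives along \<open>(1, s)\<close>, \<open>\<bar>s\<bar> \<le> 1\<close>,
  gives a right inverse of the divergence with kernel of size \<open>1 / r\<close> at distance \<open>r\<close>.\<close>

lemma divergence_solver:
  fixes f :: "real^2 \<Rightarrow> real" and V :: "(real^2) set" and m s\<^sub>0 N R :: real
  assumes f: "f \<in> test_forms" and supp: "\<And>x. norm x > R \<Longrightarrow> f x = 0" and "0 < R"
    and V: "V \<in> sets borel" "emeasure lborel V \<le> ennreal m" "0 \<le> m" and "0 < s\<^sub>0"
    and bound: "\<And>x. \<bar>f x\<bar> \<le> N * indicator V x" "0 \<le> N"
  shows "\<exists>p q. smooth p \<and> smooth q \<and> (\<forall>x. norm x \<le> R \<longrightarrow> pderiv_at 1 p x + pderiv_at 2 q x = f x) \<and>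
    (\<forall>x. \<bar>p x\<bar> \<le> N * (s\<^sub>0 + m / (2 * s\<^sub>0)) \<and> \<bar>q x\<bar> \<le> N * (s\<^sub>0 + m / (2 * s\<^sub>0)))"
proof -
  \<comment> \<open>At length \<open>T\<close> the first coordinate of the point on the ray is below
    -R, outside the support of \<open>f\<close>, for every slope.\<close>
  define T where "T = 2 * R + 1"
  define S where "S = {0..T} \<times> {-1..1::real}"
  define Y where "Y p = plane_vec (fst p, fst p * snd p)" for p
  \<comment> \<open>The exponents 0 and 1 give the two components of the direction (1, s); the
    factor 1 / 2 normalises the slope interval of length 2.\<close>
  define w where "w k p = indicator S p *\<^sub>R ((snd p) ^ k / 2)" for k :: nat and p
  have "compact S" unfolding S_def by (intro compact_Times) auto
  then have wint: "integrable lborel (w k)" for k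
    unfolding w_def by (rule borel_integrable_compact) (auto intro!: continuous_intros)
  have "continuous_on UNIV Y" unfolding Y_def plane_vec_def by (auto intro!: continuous_intros)
  then have Ym: "Y \<in> borel_measurable lborel" by (simp add: borel_measurable_continuous_onI)
  define p where "p k = superpose lborel (w k) Y f" for k
  have sm: "smooth (p k)" for k unfolding p_def by (rule smooth_superpose[OF wint Ym f])
  have wb: "\<bar>w k z\<bar> \<le> indicator S z / 2" for k z
    unfolding w_def S_def by (auto simp: indicator_def power_abs intro!: power_le_one)
  have pb: "\<bar>p k x\<bar> \<le> N * (s\<^sub>0 + m / (2 * s\<^sub>0))" for k x
  proof -
    have "ennreal \<bar>p k x\<bar> \<le> (\<integral>\<^sup>+z. norm (w k z * f (x - Y z)) \<partial>lborel)"
      unfolding p_def superpose_def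
      using integral_norm_bound_ennreal[OF superpose_integrable[OF wint Ym f]] by simp
    also have "\<dots> \<le> (\<integral>\<^sup>+z. ennreal (N / 2) * (indicator S z * indicator V (x - Y z)) \<partial>lborel)"
    proof (intro nn_integral_mono)
      fix z
      have "norm (w k z * f (x - Y z)) \<le> (indicator S z / 2) * (N * indicator V (x - Y z))"
        unfolding real_norm_def abs_mult by (intro mult_mono wb bound(1)) auto
      also have "\<dots> = N / 2 * (indicator S z * indicator V (x - Y z))" by simp
      finally have "ennreal (norm (w k z * f (x - Y z))) \<le> ennreal (N / 2 * (indicator S z * indicator V (x - Y z)))"
        by (rule ennreal_leI)
      then show "ennreal (norm (w k z * f (x - Y z))) \<le> ennreal (N / 2) * (indicator S z * indicator V (x - Y z))"
        by (rule order_trans) (auto simp: indicator_def)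
    qed
    also have "\<dots> = ennreal (N / 2) * (\<integral>\<^sup>+z. indicator S z * indicator V (x - Y z) \<partial>lborel)"
    proof (rule nn_integral_cmult)
      have [measurable]: "Y \<in> borel_measurable lborel" "V \<in> sets borel" "S \<in> sets borel"
        using Ym V(1) \<open>compact S\<close> by (auto intro: borel_compact)
      show "(\<lambda>z. indicator S z * indicator V (x - Y z) :: ennreal) \<in> borel_measurable lborel"
        by measurable
    qed
    also have "\<dots> \<le> ennreal (N / 2) * ennreal (2 * s\<^sub>0 + m / s\<^sub>0)"
      unfolding S_def Y_def by (intro mult_left_mono ray_integral_bound V \<open>0 < s\<^sub>0\<close>) simp
    also have "\<dots> = ennreal (N * (s\<^sub>0 + m / (2 * s\<^sub>0)))"
      using bound(2) V(3) \<open>0 < s\<^sub>0\<close> by (simp add: ennreal_mult[symmetric] algebra_simps)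
    finally show ?thesis
      using bound(2) V(3) \<open>0 < s\<^sub>0\<close> by (subst (asm) ennreal_le_iff) auto
  qed
  have div: "pderiv_at 1 (p 0) x + pderiv_at 2 (p 1) x = f x" if x: "norm x \<le> R" for x
  proof -
    let ?f1 = "pderiv_at 1 f" and ?f2 = "pderiv_at 2 f"
    define H where "H z = w 0 z * ?f1 (x - Y z) + w 1 z * ?f2 (x - Y z)" for z
    have i1: "integrable lborel (\<lambda>z. w 0 z * ?f1 (x - Y z))" and i2: "integrable lborel (\<lambda>z. w 1 z * ?f2 (x - Y z))"
      by (intro superpose_integrable wint Ym pderiv_at_test_forms f)+
    then have Hi: "integrable (lborel \<Otimes>\<^sub>M lborel) H" unfolding H_def lborel_prod by simp
    have "pderiv_at 1 (p 0) x + pderiv_at 2 (p 1) x = integral\<^sup>L lborel H"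
      unfolding p_def pderiv_at_superpose[OF wint Ym f] superpose_def H_def using i1 i2 by simp
    also have "\<dots> = (LINT s|lborel. LINT r|lborel. H (r, s))"
      using lborel_pair.integral_snd[of "\<lambda>r s. H (r, s)"] Hi by (simp add: lborel_prod)
    \<comment> \<open>For each slope the inner integrand is the derivative of - f / 2 along the ray,
      which starts at \<open>x\<close> and ends outside the support; so every slope contributes f x
      / 2.\<close>
    also have "\<dots> = (LINT s|lborel. indicator {-1..1::real} s *\<^sub>R (f x / 2))"
    proof (intro Bochner_Integration.integral_cong refl)
      fix s :: real
      define F where "F r = - f (x - Y (r, s)) / 2" for r
      define F' where "F' r = (?f1 (x - Y (r, s)) + s * ?f2 (x - Y (r, s))) / 2" for r
      have Yr: "x - Y (r, s) = x + r *\<^sub>R (- plane_vec (1, s))" for r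
        unfolding Y_def by (simp add: vec_eq_iff forall_2)
      have der: "(F has_vector_derivative F' r) (at r within {0..T})" for r
      proof -
        have "(f has_derivative (\<lambda>h. grad f (x - Y (r, s)) \<bullet> h)) (at (x - Y (r, s)))"
          by (intro has_derivative_grad smooth_differentiable test_forms_smooth f)
        moreover have "((\<lambda>r. x - Y (r, s)) has_derivative (\<lambda>t. t *\<^sub>R (- plane_vec (1, s)))) (at r)"
          unfolding Yr by (auto intro!: derivative_eq_intros)
        ultimately have "((\<lambda>r. f (x - Y (r, s))) has_derivative (\<lambda>t. grad f (x - Y (r, s)) \<bullet> (t *\<^sub>R (- plane_vec (1, s))))) (at r)"
          by (rule has_derivative_compose[rotated])
        moreover have "grad f (x - Y (r, s)) \<bullet> (t *\<^sub>R (- plane_vec (1, s))) = - 2 * F' r * t" for t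
          unfolding F'_def grad_def inner_vec_def by (simp add: sum_2 algebra_simps)
        ultimately have "((\<lambda>r. f (x - Y (r, s))) has_derivative (\<lambda>t. - 2 * F' r * t)) (at r)"
          by (simp only:)
        then have "((\<lambda>r. f (x - Y (r, s))) has_real_derivative (- 2 * F' r)) (at r)"
          unfolding has_field_derivative_def .
        then have "(F has_real_derivative F' r) (at r)"
          unfolding F_def by (auto intro!: derivative_eq_intros)
        then show ?thesis
          by (simp add: has_real_derivative_iff_has_vector_derivative has_vector_derivative_at_within)
      qed
      have cont: "continuous_on {0..T} F'"
        unfolding F'_def Yr
        by (intro continuous_intros continuous_on_compose2[OF smooth_continuous_on[OF test_forms_smooth[OF pderiv_at_test_forms[OF f]], of UNIV]]) auto
      have "norm (x - Y (T, s)) > R"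
      proof -
        have "\<bar>x $ 1\<bar> \<le> R" using component_le_norm_cart[of x 1] x by simp
        then have "\<bar>(x - Y (T, s)) $ 1\<bar> > R" unfolding Y_def T_def using \<open>0 < R\<close> by simp
        then show ?thesis using component_le_norm_cart[of "x - Y (T, s)" 1] by linarith
      qed
      then have "f (x - Y (T, s)) = 0" by (rule supp)
      moreover have "Y (0, s) = 0" unfolding Y_def by (simp add: vec_eq_iff forall_2)
      ultimately have "F T - F 0 = f x / 2" unfolding F_def by simp
      then have ftc: "(LINT r|lborel. indicator {0..T} r *\<^sub>R F' r) = f x / 2"
        using integral_FTC_atLeastAtMost[of 0 T F F'] der cont \<open>0 < R\<close> unfolding T_def by simp
      have "H (r, s) = indicator {-1..1} s *\<^sub>R (indicator {0..T} r *\<^sub>R F' r)" for r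
        unfolding H_def w_def S_def F'_def by (auto simp: indicator_def field_simps)
      then show "(LINT r|lborel. H (r, s)) = indicator {-1..1} s *\<^sub>R (f x / 2)"
        by (simp add: ftc[simplified])
    qed
    also have "\<dots> = f x" by simp
    finally show ?thesis .
  qed
  show ?thesis using sm div pb by blast
qed

section \<open>The perimeter estimate\<close>

text \<open>Open balls make this set closed, so a nearest centre exists even for points of the
  frontier.\<close>

definition inner_centres :: "real \<Rightarrow> 'a::metric_space set \<Rightarrow> 'a set" where
  "inner_centres \<rho> U = {c. ball c \<rho> \<subseteq> U}"

lemma closed_inner_centres: "closed (inner_centres \<rho> U)"
proof -
  have "inner_centres \<rho> U = (\<Inter>y\<in>- U. {c. \<rho> \<le> dist c y})"
    unfolding inner_centres_def by force
  also have "closed \<dots>" by (intro closed_INT ballI closed_Collect_le continuous_intros)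
  finally show ?thesis .
qed

lemma laplacian_test_forms: "g \<in> test_forms \<Longrightarrow> laplacian g \<in> test_forms"
  unfolding laplacian_def[abs_def] by (intro test_forms_add pderiv_at_test_forms)

lemma flat_exp_continuous: "continuous_on S (flat_exp p)"
  by (meson DERIV_isCont continuous_at_imp_continuous_on flat_exp_has_derivative)

text \<open>The quotient E(s) / (E(s) + E(1 - s)) has a positive denominator because s or 1 - s is
  positive. The derivative is named as well since its sign and its support determine the weight on
  the transition layer.\<close>

lemma cutoff_exists:
  "\<exists>\<theta> \<theta>' :: real \<Rightarrow> real. (\<forall>s. (\<theta> has_field_derivative \<theta>' s) (at s)) \<and> continuous_on UNIV \<theta>' \<and>
     (\<forall>s. 0 \<le> \<theta> s \<and> \<theta> s \<le> 1) \<and> (\<forall>s\<le>0. \<theta> s = 0) \<and> (\<forall>s\<ge>1. \<theta> s = 1) \<and>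
     (\<forall>s. 0 \<le> \<theta>' s) \<and> (\<forall>s. s \<le> 0 \<or> 1 \<le> s \<longrightarrow> \<theta>' s = 0)"
proof -
  define E where "E = flat_exp 1"
  define E' where "E' = flat_exp ([:0, 0, 1:] * (1 - pderiv 1))"
  define d where "d s = E s + E (1 - s)" for s
  define \<theta> where "\<theta> s = E s / d s" for s
  define \<theta>' where "\<theta>' s = (E' s * E (1 - s) + E s * E' (1 - s)) / (d s)\<^sup>2" for s
  have E: "0 \<le> E s" "0 \<le> E' s" "s > 0 \<Longrightarrow> 0 < E s" "s \<le> 0 \<Longrightarrow> E s = 0" "s \<le> 0 \<Longrightarrow> E' s = 0" for s
    unfolding E_def E'_def flat_exp_def by (simp_all add: pderiv_1)
  have d: "0 < d s" for s
    unfolding d_def using E(1)[of s] E(1)[of "1 - s"] E(3)[of s] E(3)[of "1 - s"] by (cases "s > 0") auto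
  have DE: "(E has_field_derivative E' s) (at s)" for s
    unfolding E_def E'_def by (rule flat_exp_has_derivative)
  have DE1: "((\<lambda>s. E (1 - s)) has_field_derivative - E' (1 - s)) (at s)" for s
  proof -
    have "((\<lambda>s. 1 - s) has_field_derivative - 1) (at s)" by (auto intro!: derivative_eq_intros)
    from DERIV_chain2[OF DE this] show ?thesis by simp
  qed
  have "(\<theta> has_field_derivative \<theta>' s) (at s)" for s
  proof -
    have "(\<theta> has_field_derivative (E' s * d s - E s * (E' s + - E' (1 - s))) / (d s * d s)) (at s)"
      unfolding \<theta>_def d_def
      by (intro DERIV_divide DE DERIV_add DE1) (use d[of s] in \<open>simp add: d_def\<close>)
    then show ?thesis unfolding \<theta>'_def d_def by (simp add: power2_eq_square algebra_simps)
  qed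
  moreover have "continuous_on UNIV \<theta>'"
    unfolding \<theta>'_def d_def E_def E'_def
    by (intro continuous_intros flat_exp_continuous continuous_on_compose2[OF flat_exp_continuous[of UNIV]])
      (use d in \<open>auto simp: d_def E_def less_imp_neq[symmetric]\<close>)
  moreover have "0 \<le> \<theta> s \<and> \<theta> s \<le> 1" for s
    unfolding \<theta>_def using E(1)[of s] E(1)[of "1 - s"] d[of s] by (auto simp: d_def)
  moreover have "\<theta> s = 0" if "s \<le> 0" for s unfolding \<theta>_def using E(4)[OF that] by simp
  moreover have "\<theta> s = 1" if "1 \<le> s" for s
    unfolding \<theta>_def using E(4)[of "1 - s"] d[of s] that by (simp add: d_def)
  moreover have "0 \<le> \<theta>' s" for s unfolding \<theta>'_def using E by simp
  moreover have "\<theta>' s = 0" if "s \<le> 0 \<or> 1 \<le> s" for s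
    unfolding \<theta>'_def using E(4,5)[of s] E(4,5)[of "1 - s"] that by auto
  ultimately show ?thesis by blast
qed

section \<open>Integration of test forms over measurable sets\<close>

lemma E2_eq: "E2 B h = (LINT x|lebesgue. indicator B x * h x)"
  unfolding E2_def set_lebesgue_integral_def by simp

lemma integrable_E2:
  fixes h :: "real^2 \<Rightarrow> real"
  assumes "h \<in> test_forms" "B \<in> sets lebesgue"
  shows "integrable lebesgue (\<lambda>x. indicator B x * h x)"
proof -
  have "integrable lebesgue h"
    using integrable_test_form[OF assms(1)] integrable_completion[of h lborel]
    by (simp add: borel_measurable_integrable)
  from integrable_mult_indicator[OF assms(2) this] show ?thesis by simp
qed

lemma E2_add:
  assumes "h \<in> test_forms" "k \<in> test_forms" "B \<in> sets lebesgue"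
  shows "E2 B (\<lambda>x. h x + k x) = E2 B h + E2 B k"
  unfolding E2_eq using integrable_E2[OF assms(1,3)] integrable_E2[OF assms(2,3)] by (simp add: distrib_left)

lemma E2_scale: "E2 B (\<lambda>x. c * h x) = c * E2 B h"
  unfolding E2_eq by (simp add: mult.left_commute)

lemma E2_Diff:
  assumes "h \<in> test_forms" "A \<in> sets lebesgue" "U \<in> sets lebesgue" "A \<subseteq> U"
  shows "E2 (U - A) h = E2 U h - E2 A h"
proof -
  have "E2 (U - A) h = (LINT x|lebesgue. indicator U x * h x - indicator A x * h x)"
    unfolding E2_eq using assms(4) by (intro Bochner_Integration.integral_cong) (auto simp: indicator_def)
  then show ?thesis unfolding E2_eq using integrable_E2[OF assms(1,3)] integrable_E2[OF assms(1,2)] by simp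
qed

lemma E2_bound:
  assumes "h \<in> test_forms" "B \<in> lmeasurable" "\<And>x. \<bar>h x\<bar> \<le> C"
  shows "\<bar>E2 B h\<bar> \<le> C * measure lebesgue B"
proof -
  have "\<bar>E2 B h\<bar> \<le> (LINT x|lebesgue. C * indicator B x)"
    unfolding E2_eq
  proof (rule integral_abs_bound_integral)
    show "integrable lebesgue (\<lambda>x. indicator B x * h x)"
      using assms by (intro integrable_E2) (auto intro: fmeasurableD)
    show "integrable lebesgue (\<lambda>x. C * indicator B x)"
      using assms(2) by (intro integrable_mult_right integrable_real_indicator) (auto simp: fmeasurable_def)
    show "\<bar>indicator B x * h x\<bar> \<le> C * indicator B x" for x
      using assms(3)[of x] by (auto simp: indicator_def)
  qed
  also have "\<dots> = C * measure lebesgue B" by simp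
  finally show ?thesis .
qed

section \<open>The envelope of a bounded open set whose boundary has positive reach\<close>

context
  fixes U :: "(real^2) set" and \<rho> :: real
  assumes U: "open U" "bounded U" and \<rho>: "0 < \<rho>" and reach: "ereal \<rho> < reach (frontier U)"
begin

private abbreviation "u \<equiv> envelope \<rho> (inner_centres \<rho> U)"

private lemma avoiding_ball:
  assumes "x \<notin> frontier U" "U \<noteq> {}"
  shows "\<exists>c. dist x c < \<rho> \<and> ball c \<rho> \<inter> frontier U = {}"
proof (rule empty_ball_of_reach[OF _ _ reach \<rho> assms(1)])
  \<comment> \<open>A nonempty set with empty frontier would be the whole plane, which is
    unbounded.\<close>
  show "frontier U \<noteq> {}"
    using assms(2) U(2) not_bounded_UNIV[where 'a = "real^2"] by (auto simp: frontier_eq_empty)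
qed simp

text \<open>A ball is connected, so if it avoids the frontier and meets \<open>U\<close>, it lies
  inside \<open>U\<close>.\<close>

lemma inner_centre_near:
  assumes "x \<in> U"
  shows "\<exists>c\<in>inner_centres \<rho> U. dist x c < \<rho>"
proof -
  have "x \<notin> frontier U" using assms U(1) by (simp add: frontier_def interior_open)
  then obtain c where c: "dist x c < \<rho>" "ball c \<rho> \<inter> frontier U = {}"
    using avoiding_ball assms by blast
  have "x \<in> ball c \<rho> \<inter> U" using c(1) assms by (simp add: dist_commute)
  then have "ball c \<rho> \<subseteq> U"
    using connected_Int_frontier[of "ball c \<rho>" U] c(2) by blast
  then show ?thesis using c(1) unfolding inner_centres_def by blast
qed

lemma inner_centre_near_closure:
  assumes "x \<in> closure U"
  shows "\<exists>c\<in>inner_centres \<rho> U. dist x c \<le> \<rho>"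
  using touching_ball[OF \<rho> assms inner_centre_near closed_inner_centres] .

text \<open>A frontier point is within \<rho> of an inner centre but not in the open inner ball, so
  that ball touches it at distance exactly \<rho>.\<close>

lemma negligible_frontier: "negligible (frontier U)"
proof (rule negligible_of_empty_balls[OF _ \<rho>])
  show "compact (frontier U)" using U(2) by (rule compact_frontier_bounded)
  fix a assume a: "a \<in> frontier U"
  then have "a \<in> closure U" by (simp add: frontier_def)
  then obtain c where c: "ball c \<rho> \<subseteq> U" "dist a c \<le> \<rho>"
    using inner_centre_near_closure unfolding inner_centres_def by blast
  have "U \<inter> frontier U = {}" using U(1) by (auto simp: frontier_def interior_open)
  then have "ball c \<rho> \<inter> frontier U = {}" using c(1) by blast
  moreover have "a \<notin> ball c \<rho>" using calculation a by blast
  then have "\<not> dist a c < \<rho>" by (simp add: dist_commute)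
  ultimately show "\<exists>c. dist a c = \<rho> \<and> ball c \<rho> \<inter> frontier U = {}" using c(2) by force
qed

text \<open>Centres of an inner and an outer ball are at least 2 \<rho> apart, since otherwise their
  midpoint would lie in both balls.\<close>

lemma envelope_ge_outside:
  assumes "ball c \<rho> \<inter> U = {}"
  shows "- (dist x c)\<^sup>2 / (2 * \<rho>) \<le> u x"
proof (rule envelope_ge_paraboloid[OF \<rho>], rule ccontr)
  fix c' assume c': "c' \<in> inner_centres \<rho> U" and "\<not> 2 * \<rho> \<le> dist c c'"
  then have "midpoint c c' \<in> ball c \<rho> \<inter> ball c' \<rho>" by (simp add: dist_midpoint)
  then show False using assms c' unfolding inner_centres_def by blast
qed

text \<open>The upper barrier reaches - \<rho> / 2 exactly at distance \<rho> from its centre, so a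
  centre strictly nearer than \<rho> gives a strict inequality. The lower barrier does the same
  outside the closure.\<close>

lemma envelope_inside:
  assumes "x \<in> U"
  shows "u x < - \<rho> / 2"
proof -
  obtain c where c: "c \<in> inner_centres \<rho> U" "dist x c < \<rho>" using inner_centre_near[OF assms] by blast
  have "(dist x c)\<^sup>2 < \<rho>\<^sup>2" using c(2) by (intro power_strict_mono) auto
  then have "(dist x c)\<^sup>2 / (2 * \<rho>) < \<rho> / 2" using \<rho> by (simp add: field_simps power2_eq_square)
  then show ?thesis using envelope_le_paraboloid[OF \<rho> c(1), of x] by linarith
qed

lemma envelope_outside:
  assumes "x \<notin> closure U"
  shows "- \<rho> / 2 < u x"
proof -
  have "\<exists>c. dist x c < \<rho> \<and> ball c \<rho> \<inter> U = {}"
  \<comment> \<open>For empty \<open>U\<close> the lemma \<open>avoiding_ball\<close> does not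
    apply, but every ball misses \<open>U\<close>.\<close>
  proof (cases "U = {}")
    case True
    then show ?thesis using \<rho> by (intro exI[of _ x]) simp
  next
    case False
    have "x \<notin> frontier U" using assms by (simp add: frontier_def)
    then obtain c where c: "dist x c < \<rho>" "ball c \<rho> \<inter> frontier U = {}"
      using avoiding_ball False by blast
    have "x \<in> ball c \<rho> - U" using c(1) assms closure_subset by (auto simp: dist_commute)
    then have "ball c \<rho> \<inter> U = {}" using connected_Int_frontier[of "ball c \<rho>" U] c(2) by blast
    then show ?thesis using c(1) by blast
  qed
  then obtain c where c: "dist x c < \<rho>" "ball c \<rho> \<inter> U = {}" by blast
  have "(dist x c)\<^sup>2 < \<rho>\<^sup>2" using c(1) by (intro power_strict_mono) auto
  then have "(dist x c)\<^sup>2 / (2 * \<rho>) < \<rho> / 2" using \<rho> by (simp add: field_simps power2_eq_square)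
  then show ?thesis using envelope_ge_outside[OF c(2), of x] by linarith
qed

text \<open>Far from \<open>U\<close> the point \<open>x\<close> is itself the centre of an outer
  ball, and the lower barrier vanishes at its own centre.\<close>

lemma envelope_compact_support: "\<exists>B. \<forall>x. norm x > B \<longrightarrow> u x = 0"
proof -
  obtain B where B: "\<forall>y\<in>U. norm y \<le> B" using U(2) bounded_iff by blast
  have "u x = 0" if "norm x > B + \<rho>" for x
  proof -
    have "ball x \<rho> \<inter> U = {}"
    proof (rule ccontr)
      assume "ball x \<rho> \<inter> U \<noteq> {}"
      then obtain y where "y \<in> U" "dist x y < \<rho>" by auto
      then show False using B that norm_triangle_sub[of x y] by (force simp: dist_norm)
    qed
    from envelope_ge_outside[OF this, of x] show ?thesis
      using envelope_nonpos[OF \<rho>, of "inner_centres \<rho> U" x] by simp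
  qed
  then show ?thesis by blast
qed

lemma second_difference_bounded_envelope: "second_difference_bounded \<rho> u"
  unfolding second_difference_bounded_def
  using envelope_semiconvex[OF \<rho>, of "inner_centres \<rho> U"] envelope_semiconcave[OF \<rho>, of "inner_centres \<rho> U"]
  by (auto simp: abs_le_iff algebra_simps)

lemma integrable_envelope: "integrable lborel u"
proof -
  obtain B where "\<forall>x. norm x > B \<longrightarrow> u x = 0" using envelope_compact_support by blast
  then show ?thesis
    by (intro integrable_continuous_compact_support[of u B] continuous_on_envelope \<rho>) auto
qed

context
  fixes \<epsilon> :: real and \<eta> :: "real^2 \<Rightarrow> real"
  assumes \<eta>: "mollifier \<epsilon> \<eta>"
begin

private abbreviation "g \<equiv> mollify \<eta> u"

lemma mollified_envelope_test_form: "g \<in> test_forms"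
proof -
  obtain B where B: "\<forall>x. norm x > B \<longrightarrow> u x = 0" using envelope_compact_support by blast
  have "g x = 0" if "norm x > B + \<epsilon>" for x
  proof -
    have "u y = 0" if "dist x y \<le> \<epsilon>" for y
      using B that \<open>norm x > B + \<epsilon>\<close> norm_triangle_sub[of x y] by (simp add: dist_norm)
    then have "g x \<le> 0" "0 \<le> g x"
      using mollify_mono_le[OF \<eta> integrable_envelope, of x 0] mollify_mono_ge[OF \<eta> integrable_envelope, of x 0]
      by auto
    then show ?thesis by simp
  qed
  then show ?thesis using smooth_mollify[OF \<eta> integrable_envelope] by (intro test_formsI[of _ "B + \<epsilon>"]) auto
qed

lemma mollified_envelope_range: "- \<rho> \<le> g x" "g x \<le> 0"
  by (rule mollify_mono_ge[OF \<eta> integrable_envelope] mollify_mono_le[OF \<eta> integrable_envelope],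
    rule envelope_ge[OF \<rho>] envelope_nonpos[OF \<rho>])+

lemma mollified_envelope_sdb: "second_difference_bounded \<rho> g"
  by (rule mollify_second_difference[OF \<eta> integrable_envelope second_difference_bounded_envelope])

lemma mollified_envelope_laplacian: "\<bar>laplacian g x\<bar> \<le> 2 / \<rho>"
  by (intro laplacian_bound mollified_envelope_sdb \<rho> test_forms_smooth mollified_envelope_test_form)

lemma mollified_envelope_derivative: "(g has_derivative (\<lambda>h. grad g x \<bullet> h)) (at x)"
  by (intro has_derivative_grad smooth_differentiable test_forms_smooth mollified_envelope_test_form)

lemma mollified_envelope_close:
  assumes "\<And>x y. dist x y \<le> \<epsilon> \<Longrightarrow> \<bar>u x - u y\<bar> \<le> t"
  shows "\<bar>g x - u x\<bar> \<le> t"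
proof -
  have "u x - t \<le> g x" by (rule mollify_mono_ge[OF \<eta> integrable_envelope]) (use assms[of x] in \<open>force simp: abs_le_iff\<close>)
  moreover have "g x \<le> u x + t" by (rule mollify_mono_le[OF \<eta> integrable_envelope]) (use assms[of x] in \<open>force simp: abs_le_iff\<close>)
  ultimately show ?thesis by linarith
qed

end

private lemma U_lmeasurable: "U \<in> lmeasurable"
  using U by (simp add: lmeasurable_open)

private lemma layer_lmeasurable: "{x \<in> U. b < u x} \<in> lmeasurable"
proof -
  have "open {x \<in> U. b < u x}"
    using U(1) by (intro open_Collect_conj open_Collect_less continuous_on_envelope \<rho> continuous_intros) simp
  moreover have "bounded {x \<in> U. b < u x}" using U(2) by (rule bounded_subset) auto
  ultimately show ?thesis by (rule lmeasurable_open[rotated])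
qed

text \<open>Since \<open>u\<close> is strictly below - \<rho> / 2 on \<open>U\<close>, the layers
  shrink to the empty set as \<open>t\<close> tends to 0, and their measures follow. The factor 3
  leaves room for an offset \<open>t\<close>, a transition of width \<open>t\<close> and a
  mollification error \<open>t\<close>.\<close>

lemma thin_layer:
  assumes "0 < m" "0 < t\<^sub>0"
  shows "\<exists>t>0. t \<le> t\<^sub>0 \<and> measure lebesgue {x \<in> U. - \<rho> / 2 - 3 * t < u x} < m"
proof -
  define \<tau> where "\<tau> n = t\<^sub>0 / real (Suc n)" for n
  define Z where "Z n = {x \<in> U. - \<rho> / 2 - 3 * \<tau> n < u x}" for n
  have \<tau>: "0 < \<tau> n" "\<tau> n \<le> t\<^sub>0" for n using assms(2) unfolding \<tau>_def by (auto simp: field_simps)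
  have "decseq \<tau>" unfolding \<tau>_def decseq_def using assms(2) by (auto intro!: divide_left_mono)
  then have "decseq Z" unfolding decseq_def Z_def by force
  have "(\<Inter>n. Z n) = {}"
  proof (rule ccontr)
    assume "(\<Inter>n. Z n) \<noteq> {}"
    then obtain x where x: "\<And>n. x \<in> Z n" by blast
    then have "u x < - \<rho> / 2" using envelope_inside unfolding Z_def by blast
    moreover have "\<tau> \<longlonglongrightarrow> 0" unfolding \<tau>_def by (rule LIMSEQ_Suc[OF lim_const_over_n])
    then have "(\<lambda>n. - \<rho> / 2 - 3 * \<tau> n) \<longlonglongrightarrow> - \<rho> / 2 - 3 * 0" by (intro tendsto_intros)
    then have "- \<rho> / 2 - 3 * 0 \<le> u x"
      by (rule LIMSEQ_le_const2) (use x in \<open>force simp: Z_def less_imp_le\<close>)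
    ultimately show False by simp
  qed
  moreover have "(\<lambda>n. measure lebesgue (Z n)) \<longlonglongrightarrow> measure lebesgue (\<Inter>n. Z n)"
  proof (intro Lim_measure_decseq)
    have m: "Z n \<in> lmeasurable" for n unfolding Z_def by (rule layer_lmeasurable)
    show "range Z \<subseteq> sets lebesgue" using fmeasurableD[OF m] by blast
    show "emeasure lebesgue (Z n) \<noteq> \<infinity>" for n using fmeasurableD2[OF m] by simp
  qed fact
  ultimately have "(\<lambda>n. measure lebesgue (Z n)) \<longlonglongrightarrow> 0" by simp
  then have "\<forall>\<^sub>F n in sequentially. measure lebesgue (Z n) < m"
    by (rule order_tendstoD(2)) (rule assms(1))
  then obtain n where "measure lebesgue (Z n) < m"
    unfolding eventually_sequentially by blast
  then show ?thesis using \<tau>[of n] unfolding Z_def by blast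
qed

text \<open>Cut-off functions of the mollified envelope replace the indicator function of \<open>U\<close>;
  on their transition layer the gradient of the mollified envelope is almost a unit vector,
  hence almost optimal among all fields of norm at most one.\<close>

lemma perimeter_estimate:
  assumes \<psi>: "\<psi> \<in> test_forms" "\<And>x. norm (\<psi> x) \<le> 1" and "0 < e"
  shows "\<exists>\<epsilon>\<^sub>0>0. \<forall>\<epsilon> \<eta>. \<epsilon> \<le> \<epsilon>\<^sub>0 \<longrightarrow> mollifier \<epsilon> \<eta> \<longrightarrow>
    E2 U (ext_deriv \<psi>) \<le> E2 U (laplacian (mollify \<eta> u)) + e"
proof -
  define M where "M = measure lebesgue U"
  have M0: "0 \<le> M" unfolding M_def by simp
  have d\<psi>: "ext_deriv \<psi> \<in> test_forms" by (rule ext_deriv_test_forms[OF \<psi>(1)])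
  obtain C where C: "C > 0" "\<forall>x. norm (ext_deriv \<psi> x) \<le> C" using test_forms_bounded[OF d\<psi>] by blast
  \<comment> \<open>The slope on the layer will be at least 1 - \<tau>. The resulting relative loss
    2 \<tau> multiplies \<open>b\<close>, which is at most 4 M / \<rho>, and 8 \<tau> M / \<rho>
    should not exceed e / 2.\<close>
  define \<tau> where "\<tau> = min (1/2) (e * \<rho> / (16 * (M + 1)))"
  have \<tau>: "0 < \<tau>" "\<tau> \<le> 1/2"
    using \<open>0 < e\<close> \<rho> M0 unfolding \<tau>_def by (simp_all only: min.cobounded1) auto
  have \<tau>M: "8 * \<tau> * M / \<rho> \<le> e / 2"
  proof -
    have "\<tau> * (16 * (M + 1)) \<le> e * \<rho>"
      using M0 pos_le_divide_eq[of "16 * (M + 1)" \<tau> "e * \<rho>"] unfolding \<tau>_def by simp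
    then have "16 * \<tau> * M \<le> e * \<rho>" using \<tau>(1) by (simp add: algebra_simps)
    then show ?thesis using \<rho> by (simp add: field_simps)
  qed
  \<comment> \<open>Each of the three errors in \<open>gradient_lower\<close> should be at most
    \<tau> / 3: s / \<rho> by this choice, the other two through the bound \<tau> s / 9 on
    \<open>t\<close>.\<close>
  define s where "s = \<tau> * \<rho> / 3"
  have s: "0 < s" unfolding s_def using \<tau> \<rho> by simp
  have "0 < e / (2 * (C + 2 / \<rho>))" "0 < \<tau> * s / 9"
    using \<open>0 < e\<close> C(1) \<rho> \<tau>(1) s by (simp_all add: add_pos_pos)
  then obtain t where t: "0 < t" "t \<le> \<tau> * s / 9"
    "measure lebesgue {x \<in> U. - \<rho> / 2 - 3 * t < u x} < e / (2 * (C + 2 / \<rho>))"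
    using thin_layer by blast
  define Z where "Z = {x \<in> U. - \<rho> / 2 - 3 * t < u x}"
  have Z: "Z \<in> lmeasurable" unfolding Z_def by (rule layer_lmeasurable)
  have Zm: "(C + 2 / \<rho>) * measure lebesgue Z \<le> e / 2"
  proof -
    have pos: "0 < C + 2 / \<rho>" using C(1) \<rho> by (simp add: add_pos_pos)
    have "(C + 2 / \<rho>) * measure lebesgue Z \<le> (C + 2 / \<rho>) * (e / (2 * (C + 2 / \<rho>)))"
      using t(3) pos unfolding Z_def by (intro mult_left_mono) auto
    also have "\<dots> = e / 2" using pos by (simp add: field_simps)
    finally show ?thesis .
  qed
  obtain d where d: "d > 0" "\<forall>x y. dist x y < d \<longrightarrow> \<bar>u x - u y\<bar> \<le> t"
    using envelope_uniformly_continuous[OF \<rho> t(1)] by blast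
  obtain \<theta> \<theta>' :: "real \<Rightarrow> real" where \<theta>: "\<forall>s. (\<theta> has_field_derivative \<theta>' s) (at s)" "continuous_on UNIV \<theta>'"
     "\<forall>s. 0 \<le> \<theta> s \<and> \<theta> s \<le> 1" "\<forall>s\<le>0. \<theta> s = 0" "\<forall>s\<ge>1. \<theta> s = 1"
     "\<forall>s. 0 \<le> \<theta>' s" "\<forall>s. s \<le> 0 \<or> 1 \<le> s \<longrightarrow> \<theta>' s = 0"
    using cutoff_exists by blast
  have "E2 U (ext_deriv \<psi>) \<le> E2 U (laplacian (mollify \<eta> u)) + e"
    if \<epsilon>: "\<epsilon> \<le> d / 2" and \<eta>: "mollifier \<epsilon> \<eta>" for \<epsilon> \<eta>
  proof -
    define g where "g = mollify \<eta> u"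
    note gfacts = mollified_envelope_test_form[OF \<eta>] mollified_envelope_sdb[OF \<eta>]
      mollified_envelope_laplacian[OF \<eta>] mollified_envelope_derivative[OF \<eta>]
    have gt: "g \<in> test_forms" and gsd: "second_difference_bounded \<rho> g"
      and gl: "\<bar>laplacian g x\<bar> \<le> 2 / \<rho>" and gd: "(g has_derivative (\<lambda>h. grad g x \<bullet> h)) (at x)" for x
      unfolding g_def by (rule gfacts)+
    have close: "\<bar>g x - u x\<bar> \<le> t" for x
      unfolding g_def
      by (rule mollified_envelope_close[OF \<eta>]) (use d \<epsilon> in auto)
    \<comment> \<open>\<sigma> is 0 at the level - \<rho> / 2 - t of \<open>g\<close> and 1 at the
      level - \<rho> / 2 - 2 t. As \<open>g\<close> is within \<open>t\<close> of \<open>u\<close>,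
      the cut-off vanishes outside the closure of \<open>U\<close> and equals one on
      \<open>U - Z\<close>.\<close>
    define \<sigma> where "\<sigma> x = (- \<rho> / 2 - t - g x) / t" for x
    define \<zeta> where "\<zeta> x = \<theta> (\<sigma> x)" for x
    \<comment> \<open>The gradient of the cut-off is - \<kappa> grad g, so integrals weighted with
      \<kappa> on the layer play the part of boundary integrals.\<close>
    define \<kappa> where "\<kappa> x = \<theta>' (\<sigma> x) / t" for x
    have gcont: "continuous_on UNIV g" and pcont: "continuous_on UNIV (pderiv_at i g)" for i
      using gt pderiv_at_test_forms test_forms_smooth smooth_continuous_on by blast+
    have \<sigma>c: "continuous_on UNIV \<sigma>" unfolding \<sigma>_def using t(1) by (intro continuous_intros gcont) simp
    have \<kappa>c: "continuous_on UNIV \<kappa>" unfolding \<kappa>_def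
      using t(1) by (intro continuous_intros continuous_on_compose2[OF \<theta>(2) \<sigma>c]) auto
    have \<zeta>d: "(\<zeta> has_derivative (\<lambda>h. - \<kappa> x * (grad g x \<bullet> h))) (at x)" for x
    proof -
      have "(\<sigma> has_derivative (\<lambda>h. - (grad g x \<bullet> h) / t)) (at x)"
        unfolding \<sigma>_def divide_inverse by (auto intro!: derivative_eq_intros gd)
      from has_derivative_compose[OF this \<theta>(1)[rule_format, unfolded has_field_derivative_def]]
      show ?thesis unfolding \<zeta>_def \<kappa>_def by simp
    qed
    have \<zeta>p: "pderiv_at i \<zeta> x = - \<kappa> x * pderiv_at i g x" for i x
      using pderiv_atI[OF \<zeta>d] by (simp add: inner_grad_axis)
    have \<zeta>p': "pderiv_at i \<zeta> = (\<lambda>x. - \<kappa> x * pderiv_at i g x)" for i using \<zeta>p by blast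
    have \<zeta>diff: "\<zeta> differentiable (at x)" for x using \<zeta>d differentiable_def by blast
    have \<zeta>c: "continuous_on UNIV \<zeta>"
      by (simp add: continuous_at_imp_continuous_on \<zeta>diff differentiable_imp_continuous_within)
    have parts: "(LINT x|lborel. \<zeta> x * pderiv_at i b x) = (LINT x|lborel. \<kappa> x * pderiv_at i g x * b x)"
      if "b \<in> test_forms" for i b
    proof -
      have "continuous_on UNIV (pderiv_at i \<zeta>)"
        unfolding \<zeta>p' by (intro continuous_intros \<kappa>c pcont)
      from integration_by_parts[OF \<zeta>diff this that] show ?thesis by (simp add: \<zeta>p)
    qed
    have int: "integrable lborel (\<lambda>x. f x * b x)" if fb: "continuous_on UNIV f" "b \<in> test_forms" for f b :: "real^2 \<Rightarrow> real"
    proof -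
      obtain B where "\<forall>x. norm x > B \<longrightarrow> b x = 0" using test_forms_support[OF fb(2)] by blast
      then show ?thesis
        by (intro integrable_continuous_compact_support[of _ B] continuous_intros fb(1)
            smooth_continuous_on test_forms_smooth fb(2)) auto
    qed
    \<comment> \<open>\<open>a\<close> and \<open>b\<close> are the two sides of the estimate with
      the indicator of \<open>U\<close> replaced by \<zeta>. After integration by parts both become
      integrals against \<kappa>, where they can be compared pointwise.\<close>
    define a where "a = (LINT x|lborel. \<zeta> x * ext_deriv \<psi> x)"
    define b where "b = (LINT x|lborel. \<zeta> x * laplacian g x)"
    have \<psi>i: "(\<lambda>x. \<psi> x $ i) \<in> test_forms" for i by (rule test_forms_nth[OF \<psi>(1)])
    have gi: "pderiv_at i g \<in> test_forms" for i by (rule pderiv_at_test_forms[OF gt])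
    have a: "a = (LINT x|lborel. \<kappa> x * pderiv_at 1 g x * \<psi> x $ 2 - \<kappa> x * pderiv_at 2 g x * \<psi> x $ 1)"
    proof -
      have "a = (LINT x|lborel. \<zeta> x * pderiv_at 1 (\<lambda>y. \<psi> y $ 2) x) - (LINT x|lborel. \<zeta> x * pderiv_at 2 (\<lambda>y. \<psi> y $ 1) x)"
        unfolding a_def ext_deriv_def
        using int[OF \<zeta>c pderiv_at_test_forms[OF \<psi>i]] by (simp add: right_diff_distrib)
      also have "\<dots> = (LINT x|lborel. \<kappa> x * pderiv_at 1 g x * \<psi> x $ 2) - (LINT x|lborel. \<kappa> x * pderiv_at 2 g x * \<psi> x $ 1)"
        by (simp only: parts[OF \<psi>i])
      also have "\<dots> = (LINT x|lborel. \<kappa> x * pderiv_at 1 g x * \<psi> x $ 2 - \<kappa> x * pderiv_at 2 g x * \<psi> x $ 1)"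
        by (intro Bochner_Integration.integral_diff[symmetric] int \<psi>i continuous_intros \<kappa>c pcont)
      finally show ?thesis .
    qed
    have norm_grad: "(norm (grad g x))\<^sup>2 = pderiv_at 1 g x * pderiv_at 1 g x + pderiv_at 2 g x * pderiv_at 2 g x" for x
      by (simp add: power2_norm_eq_inner inner_vec_def sum_2 grad_def)
    have kint: "integrable lborel (\<lambda>x. \<kappa> x * pderiv_at i g x * pderiv_at i g x)" for i
      by (intro int gi continuous_intros \<kappa>c pcont)
    have b: "b = (LINT x|lborel. \<kappa> x * (norm (grad g x))\<^sup>2)"
    proof -
      have "b = (LINT x|lborel. \<zeta> x * pderiv_at 1 (pderiv_at 1 g) x) + (LINT x|lborel. \<zeta> x * pderiv_at 2 (pderiv_at 2 g) x)"
        unfolding b_def laplacian_def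
        using int[OF \<zeta>c pderiv_at_test_forms[OF gi]] by (simp add: distrib_left)
      also have "\<dots> = (LINT x|lborel. \<kappa> x * pderiv_at 1 g x * pderiv_at 1 g x) + (LINT x|lborel. \<kappa> x * pderiv_at 2 g x * pderiv_at 2 g x)"
        by (simp only: parts[OF gi])
      also have "\<dots> = (LINT x|lborel. \<kappa> x * (norm (grad g x))\<^sup>2)"
        unfolding norm_grad using kint by (simp add: algebra_simps)
      finally show ?thesis .
    qed
    have \<kappa>0: "0 \<le> \<kappa> x" for x unfolding \<kappa>_def using \<theta>(6) t(1) by simp
    \<comment> \<open>In \<open>gradient_lower\<close> the depth of the level contributes 2 t and
      the difference between \<open>g\<close> and \<open>u\<close> another t.\<close>
    have slope: "1 - \<tau> \<le> norm (grad g x)" if "\<kappa> x \<noteq> 0" for x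
    proof -
      have "0 < \<sigma> x" "\<sigma> x < 1" using \<theta>(7) that unfolding \<kappa>_def by (force simp: not_le[symmetric])+
      then have gx: "- \<rho> / 2 - 2 * t < g x" "g x < - \<rho> / 2 - t"
        unfolding \<sigma>_def using t(1) by (simp_all add: field_simps)
      then have "u x < - \<rho> / 2" using close[of x] by linarith
      then have "x \<in> closure U" using envelope_outside[of x] by force
      then obtain c where c: "c \<in> inner_centres \<rho> U" "dist x c \<le> \<rho>"
        using inner_centre_near_closure by blast
      have "g z \<le> - \<rho> + (dist z c)\<^sup>2 / (2 * \<rho>) + t" for z
        using close[of z] envelope_le_paraboloid[OF \<rho> c(1), of z] by linarith
      from gradient_lower[OF gsd \<rho> gd this c(2) _ s, of "2 * t"] gx(1)
      have 1: "1 - 2 * (2 * t + t) / \<rho> - s / \<rho> - (2 * t + t) / s \<le> norm (grad g x)" by simp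
      have "2 * (2 * t + t) / \<rho> \<le> \<tau> / 3"
      proof -
        have "\<tau> * s / 9 \<le> 1 * s / 9" using \<tau> s by (intro divide_right_mono mult_right_mono) auto
        then have "t \<le> \<tau> * \<rho> / 27" using t(2) unfolding s_def by simp
        moreover have "0 < \<tau> * \<rho>" using \<tau>(1) \<rho> by simp
        ultimately have "18 * t \<le> \<tau> * \<rho>" by linarith
        then show ?thesis using \<rho> by (simp add: field_simps)
      qed
      moreover have "s / \<rho> = \<tau> / 3" unfolding s_def using \<rho> by simp
      moreover have "(2 * t + t) / s \<le> \<tau> / 3" using t(2) s by (simp add: field_simps)
      ultimately show ?thesis using 1 by linarith
    qed
    \<comment> \<open>Turning \<psi> by a right angle makes the integrand of \<open>a\<close> an
      inner product with \<open>grad g\<close>. One factor 1 - \<tau> is traded for a factor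
      \<open>norm (grad g x)\<close>, giving the square on the right.\<close>
    have pointwise: "(1 - \<tau>) * (\<kappa> x * pderiv_at 1 g x * \<psi> x $ 2 - \<kappa> x * pderiv_at 2 g x * \<psi> x $ 1)
        \<le> \<kappa> x * (norm (grad g x))\<^sup>2" for x
    proof (cases "\<kappa> x = 0")
      case False
      have "pderiv_at 1 g x * \<psi> x $ 2 - pderiv_at 2 g x * \<psi> x $ 1 = grad g x \<bullet> vector [\<psi> x $ 2, - \<psi> x $ 1]"
        by (simp add: inner_vec_def sum_2 grad_def)
      also have "\<dots> \<le> norm (grad g x) * norm (vector [\<psi> x $ 2, - \<psi> x $ 1] :: real^2)"
        by (rule norm_cauchy_schwarz)
      also have "norm (vector [\<psi> x $ 2, - \<psi> x $ 1] :: real^2) = norm (\<psi> x)"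
        by (simp add: norm_vec_def L2_set_def sum_2 add.commute)
      also have "norm (grad g x) * norm (\<psi> x) \<le> norm (grad g x)"
        using \<psi>(2)[of x] by (simp add: mult_left_le)
      finally have "(1 - \<tau>) * (\<kappa> x * (pderiv_at 1 g x * \<psi> x $ 2 - pderiv_at 2 g x * \<psi> x $ 1))
        \<le> (1 - \<tau>) * (\<kappa> x * norm (grad g x))"
        using \<tau> \<kappa>0[of x] by (intro mult_left_mono) auto
      also have "\<dots> \<le> norm (grad g x) * (\<kappa> x * norm (grad g x))"
        using slope[OF False] \<kappa>0[of x] by (intro mult_right_mono) auto
      finally show ?thesis by (simp add: power2_eq_square algebra_simps)
    qed simp
    have "(1 - \<tau>) * a \<le> b"
      unfolding a b Bochner_Integration.integral_mult_right_zero[symmetric]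
    proof (rule integral_mono[OF _ _ pointwise])
      show "integrable lborel (\<lambda>x. (1 - \<tau>) * (\<kappa> x * pderiv_at 1 g x * \<psi> x $ 2 - \<kappa> x * pderiv_at 2 g x * \<psi> x $ 1))"
        by (intro integrable_mult_right Bochner_Integration.integrable_diff int \<psi>i continuous_intros \<kappa>c pcont)
      show "integrable lborel (\<lambda>x. \<kappa> x * (norm (grad g x))\<^sup>2)"
        unfolding norm_grad using kint[of 1] kint[of 2] by (simp add: distrib_left mult.assoc)
    qed
    moreover have b0: "0 \<le> b" unfolding b using \<kappa>0 by (intro Bochner_Integration.integral_nonneg) simp
    \<comment> \<open>For \<tau> at most 1 / 2 the factor 1 / (1 - \<tau>) is at most 1 + 2
      \<tau>.\<close>
    moreover have "b \<le> (1 - \<tau>) * (b + 2 * \<tau> * b)"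
    proof -
      have "0 \<le> \<tau> * (1 - 2 * \<tau>) * b" using \<tau> b0 by simp
      then show ?thesis by (simp add: algebra_simps)
    qed
    ultimately have "(1 - \<tau>) * a \<le> (1 - \<tau>) * (b + 2 * \<tau> * b)" by linarith
    then have ab: "a \<le> b + 2 * \<tau> * b" using \<tau> by simp
    \<comment> \<open>The cut-off and the indicator of \<open>U\<close> differ only on
      \<open>Z\<close> and possibly on the frontier, which is a null set.\<close>
    have approx: "\<bar>E2 U h - (LINT x|lborel. \<zeta> x * h x)\<bar> \<le> D * measure lebesgue Z"
      if h: "h \<in> test_forms" "\<And>x. \<bar>h x\<bar> \<le> D" for h D
    proof -
      have zi: "integrable lebesgue (\<lambda>x. \<zeta> x * h x)"
        using int[OF \<zeta>c h(1)] integrable_completion[of "\<lambda>x. \<zeta> x * h x" lborel]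
        by (simp add: borel_measurable_integrable)
      have ui: "integrable lebesgue (\<lambda>x. indicator U x * h x)"
        by (rule integrable_E2[OF h(1)]) (use U_lmeasurable in auto)
      have "(LINT x|lborel. \<zeta> x * h x) = (LINT x|lebesgue. \<zeta> x * h x)"
        using int[OF \<zeta>c h(1)] by (intro integral_completion[symmetric] borel_measurable_integrable)
      then have "E2 U h - (LINT x|lborel. \<zeta> x * h x) = (LINT x|lebesgue. indicator U x * h x - \<zeta> x * h x)"
        unfolding E2_eq using zi ui by simp
      also have "\<bar>\<dots>\<bar> \<le> (LINT x|lebesgue. \<bar>indicator U x * h x - \<zeta> x * h x\<bar>)"
        by (rule integral_abs_bound)
      also have "\<dots> \<le> (LINT x|lebesgue. D * indicator Z x)"
      proof (rule integral_mono_AE)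
        show "integrable lebesgue (\<lambda>x. \<bar>indicator U x * h x - \<zeta> x * h x\<bar>)"
          using zi ui by simp
        show "integrable lebesgue (\<lambda>x. D * indicator Z x)"
          using Z by (intro integrable_mult_right integrable_real_indicator) (auto simp: fmeasurable_def)
        have "frontier U \<in> null_sets lebesgue"
          using negligible_frontier negligible_iff_null_sets by blast
        then have "AE x in lebesgue. x \<notin> frontier U" by (rule AE_not_in)
        then show "AE x in lebesgue. \<bar>indicator U x * h x - \<zeta> x * h x\<bar> \<le> D * indicator Z x"
        proof eventually_elim
          case (elim x)
          have D0: "0 \<le> D" using h(2)[of x] by linarith
          show ?case
          proof (cases "x \<in> U")
            case True
            show ?thesis
            proof (cases "x \<in> Z")
              case True
              have "\<bar>1 - \<zeta> x\<bar> \<le> 1" using \<theta>(3) unfolding \<zeta>_def by (simp add: abs_le_iff)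
              then have "\<bar>1 - \<zeta> x\<bar> * \<bar>h x\<bar> \<le> 1 * D" using h(2) D0 by (intro mult_mono) auto
              then show ?thesis using True \<open>x \<in> U\<close> by (simp add: abs_mult[symmetric] left_diff_distrib)
            next
              case False
              then have "u x \<le> - \<rho> / 2 - 3 * t" using \<open>x \<in> U\<close> unfolding Z_def by auto
              then have "1 \<le> \<sigma> x" unfolding \<sigma>_def using close[of x] t(1) by (simp add: field_simps)
              then show ?thesis using \<theta>(5) \<open>x \<in> U\<close> D0 unfolding \<zeta>_def by simp
            qed
          next
            case False
            then have "x \<notin> closure U" using elim U(1) by (simp add: frontier_def interior_open)
            then have "- \<rho> / 2 < u x" by (rule envelope_outside)
            then have "\<sigma> x \<le> 0" unfolding \<sigma>_def using close[of x] t(1) by (simp add: divide_le_0_iff)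
            then show ?thesis using \<theta>(4) False D0 unfolding \<zeta>_def by simp
          qed
        qed
      qed
      also have "\<dots> = D * measure lebesgue Z" by simp
      finally show ?thesis .
    qed
    have lt: "laplacian g \<in> test_forms" by (rule laplacian_test_forms[OF gt])
    have 1: "E2 U (ext_deriv \<psi>) \<le> a + C * measure lebesgue Z"
      using approx[OF d\<psi>, of C] C(2) unfolding a_def by (simp add: abs_le_iff)
    have 2: "b \<le> E2 U (laplacian g) + 2 / \<rho> * measure lebesgue Z"
      using approx[OF lt gl] unfolding b_def by linarith
    have "E2 U (laplacian g) \<le> 2 / \<rho> * M"
      using E2_bound[OF lt U_lmeasurable gl] unfolding M_def by linarith
    moreover have "measure lebesgue Z \<le> M"
      unfolding M_def using Z U_lmeasurable by (intro measure_mono_fmeasurable) (auto simp: Z_def)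
    then have "2 / \<rho> * measure lebesgue Z \<le> 2 / \<rho> * M" using \<rho> by (intro mult_left_mono) auto
    ultimately have "b \<le> 4 * M / \<rho>" using 2 by simp
    then have "2 * \<tau> * b \<le> 2 * \<tau> * (4 * M / \<rho>)" using \<tau> by (intro mult_left_mono) auto
    also have "\<dots> = 8 * \<tau> * M / \<rho>" by simp
    finally have "2 * \<tau> * b \<le> e / 2" using \<tau>M by linarith
    then have "E2 U (ext_deriv \<psi>) \<le> E2 U (laplacian g) + (C + 2 / \<rho>) * measure lebesgue Z + e / 2"
      using 1 2 ab by (simp add: distrib_right)
    then show ?thesis using Zm unfolding g_def by linarith
  qed
  then show ?thesis using half_gt_zero[OF d(1)] by blast
qed

end

section \<open>The calibration\<close>

text \<open>The field \<open>grad g\<close> is corrected inside \<open>U\<close> by a field whose divergence is supported near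
  \<open>A\<close>, so that the total divergence equals \<open>-lam\<close> on most of \<open>A\<close>.\<close>

lemma calibration:
  fixes U W :: "(real^2) set" and \<rho> lam :: real
  assumes U: "open U" "bounded U" and \<rho>: "0 < \<rho>" and reach: "ereal \<rho> < reach (frontier U)"
    and W: "open W" "W \<subset>\<subset> U" and lam: "2 / \<rho> < lam"
  shows "\<exists>\<delta>>0. \<forall>A \<psi> e. A \<in> sets lebesgue \<longrightarrow> A \<subseteq> W \<longrightarrow> emeasure lebesgue A < ennreal \<delta> \<longrightarrow>
    \<psi> \<in> test_forms \<longrightarrow> (\<forall>x. norm (\<psi> x) \<le> 1) \<longrightarrow> 0 < e \<longrightarrow>
    (\<exists>\<phi>\<in>test_forms. (\<forall>x. norm (\<phi> x) \<le> 1) \<and> (\<forall>x. \<bar>ext_deriv \<phi> x\<bar> \<le> lam) \<and>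
       E2 U (ext_deriv \<psi>) + lam * measure lebesgue A - e \<le> E2 (U - A) (ext_deriv \<phi>))"
proof -
  let ?u = "envelope \<rho> (inner_centres \<rho> U)"
  have lam0: "0 < lam" using lam \<rho> by (smt (verit) divide_nonneg_nonneg)
  have K: "compact (closure W)" "closure W \<subseteq> U" using W(2) unfolding compactly_inside_def by auto
  have WU: "W \<subseteq> U" using K(2) closure_subset by blast
  obtain \<xi> L where \<xi>: "\<xi> \<in> test_forms" "\<And>x. 0 \<le> \<xi> x" "\<And>x. \<xi> x \<le> (1::real)"
    "\<And>x. x \<in> closure W \<Longrightarrow> \<xi> x = 1" and L: "compact L" "L \<subseteq> U" "\<And>x. x \<notin> L \<Longrightarrow> \<xi> x = 0"
    by (rule smooth_urysohn[OF K(1) U(1) K(2)]) blast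
  \<comment> \<open>Compactness of \<open>L\<close> gives a uniform gap below the boundary level. Of
    the 2 \<kappa>, one \<kappa> is spent on passing from \<open>u\<close> to its
    mollification.\<close>
  have "\<exists>\<kappa>>0. \<forall>x\<in>L. ?u x \<le> - \<rho> / 2 - 2 * \<kappa>"
  proof (cases "L = {}")
    case False
    then obtain z where z: "z \<in> L" "\<forall>x\<in>L. ?u x \<le> ?u z"
      using continuous_attains_sup[OF L(1) False continuous_on_envelope[OF \<rho>]] by blast
    have "?u z < - \<rho> / 2" using z(1) L(2) envelope_inside[OF U \<rho> reach] by blast
    then show ?thesis using z(2) by (intro exI[of _ "(- \<rho> / 2 - ?u z) / 2"]) (auto simp: field_simps)
  qed (auto intro: exI[of _ 1])
  then obtain \<kappa> where \<kappa>: "0 < \<kappa>" "\<forall>x\<in>L. ?u x \<le> - \<rho> / 2 - 2 * \<kappa>" by blast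
  obtain C1 where C1: "C1 > 0" "\<forall>x. norm (pderiv_at 1 \<xi> x) \<le> C1"
    using test_forms_bounded[OF pderiv_at_test_forms[OF \<xi>(1)]] by blast
  obtain C2 where C2: "C2 > 0" "\<forall>x. norm (pderiv_at 2 \<xi> x) \<le> C2"
    using test_forms_bounded[OF pderiv_at_test_forms[OF \<xi>(1)]] by blast
  obtain R where R: "R > 0" "U \<subseteq> ball 0 R" using bounded_subset_ballD[OF U(2), of 0] by auto
  \<comment> \<open>Two components of size 3 lam \<beta> must fit into the gap \<kappa> / \<rho> of
    the gradient on \<open>L\<close>; multiplied with the derivatives of the cut-off \<xi> they must
    fit into the slack lam - 2 / \<rho>.\<close>
  define \<beta> where "\<beta> = min (\<kappa> / \<rho> / (6 * lam)) ((lam - 2 / \<rho>) / (3 * lam * (C1 + C2)))"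
  have \<beta>: "0 < \<beta>" unfolding \<beta>_def using \<kappa>(1) \<rho> lam lam0 C1(1) C2(1) by simp
  have \<beta>1: "6 * lam * \<beta> \<le> \<kappa> / \<rho>"
  proof -
    have "\<beta> \<le> \<kappa> / \<rho> / (6 * lam)" unfolding \<beta>_def by simp
    moreover have "0 < 6 * lam" using lam0 by simp
    ultimately have "\<beta> * (6 * lam) \<le> \<kappa> / \<rho>" by (simp only: pos_le_divide_eq)
    then show ?thesis by (simp add: mult_ac)
  qed
  have \<beta>2: "3 * lam * \<beta> * (C1 + C2) \<le> lam - 2 / \<rho>"
  proof -
    have "\<beta> \<le> (lam - 2 / \<rho>) / (3 * lam * (C1 + C2))" unfolding \<beta>_def by simp
    moreover have "0 < 3 * lam * (C1 + C2)" using lam0 C1(1) C2(1) by simp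
    ultimately have "\<beta> * (3 * lam * (C1 + C2)) \<le> lam - 2 / \<rho>" by (simp only: pos_le_divide_eq)
    then show ?thesis by (simp add: mult_ac)
  qed
  \<comment> \<open>One half of \<open>\<beta>\<^sup>2\<close> is for \<open>A\<close>, the other
    for the excess of an open neighbourhood. With splitting length \<beta>,
    \<open>divergence_solver\<close> then yields the bound 2 lam (\<beta> + \<beta> / 2) = 3 lam
    \<beta>.\<close>
  define \<delta> where "\<delta> = \<beta>\<^sup>2 / 2"
  have \<delta>: "0 < \<delta>" unfolding \<delta>_def using \<beta> by simp
  have main: "\<exists>\<phi>\<in>test_forms. (\<forall>x. norm (\<phi> x) \<le> 1) \<and> (\<forall>x. \<bar>ext_deriv \<phi> x\<bar> \<le> lam) \<and>
       E2 U (ext_deriv \<psi>) + lam * measure lebesgue A - e \<le> E2 (U - A) (ext_deriv \<phi>)"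
    if A: "A \<in> sets lebesgue" "A \<subseteq> W" "emeasure lebesgue A < ennreal \<delta>"
      and \<psi>: "\<psi> \<in> test_forms" "\<forall>x. norm (\<psi> x) \<le> 1" and e: "0 < e" for A \<psi> e
  proof -
    obtain \<epsilon>\<^sub>0 where \<epsilon>\<^sub>0: "\<epsilon>\<^sub>0 > 0" "\<forall>\<epsilon> \<eta>. \<epsilon> \<le> \<epsilon>\<^sub>0 \<longrightarrow> mollifier \<epsilon> \<eta> \<longrightarrow>
      E2 U (ext_deriv \<psi>) \<le> E2 U (laplacian (mollify \<eta> ?u)) + e / 2"
      using perimeter_estimate[OF U \<rho> reach \<psi>(1), of "e / 2"] \<psi>(2) e by auto
    obtain d where d: "d > 0" "\<forall>x y. dist x y < d \<longrightarrow> \<bar>?u x - ?u y\<bar> \<le> \<kappa>"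
      using envelope_uniformly_continuous[OF \<rho> \<kappa>(1)] by blast
    define \<epsilon> where "\<epsilon> = min \<epsilon>\<^sub>0 (d / 2)"
    have "0 < \<epsilon>" unfolding \<epsilon>_def using \<epsilon>\<^sub>0(1) d(1) by simp
    then obtain \<eta> where \<eta>: "mollifier \<epsilon> \<eta>" using mollifier_exists by blast
    define g where "g = mollify \<eta> ?u"
    have per: "E2 U (ext_deriv \<psi>) \<le> E2 U (laplacian g) + e / 2"
    proof -
      have "\<epsilon> \<le> \<epsilon>\<^sub>0" unfolding \<epsilon>_def by simp
      then show ?thesis unfolding g_def using \<epsilon>\<^sub>0(2) \<eta> by blast
    qed
    have gt: "g \<in> test_forms" unfolding g_def by (rule mollified_envelope_test_form[OF U \<rho> reach \<eta>])
    have gl: "\<bar>laplacian g x\<bar> \<le> 2 / \<rho>" for x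
      unfolding g_def by (rule mollified_envelope_laplacian[OF U \<rho> reach \<eta>])
    have lt: "laplacian g \<in> test_forms" by (rule laplacian_test_forms[OF gt])
    have close: "\<bar>g x - ?u x\<bar> \<le> \<kappa>" for x
      unfolding g_def by (rule mollified_envelope_close[OF U \<rho> reach \<eta>]) (use d in \<open>auto simp: \<epsilon>_def\<close>)
    have G: "(norm (grad g x))\<^sup>2 \<le> 2 * (g x + \<rho>) / \<rho>" "norm (grad g x) \<le> 1" for x
      unfolding g_def
      by (rule gradient_upper[OF mollified_envelope_sdb[OF U \<rho> reach \<eta>] \<rho>
            mollified_envelope_derivative[OF U \<rho> reach \<eta>]
            mollified_envelope_range(1)[OF U \<rho> reach \<eta>] mollified_envelope_range(2)[OF U \<rho> reach \<eta>]])+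
    have GL: "norm (grad g x) \<le> 1 - \<kappa> / \<rho>" if "x \<in> L" for x
    proof -
      have gx: "g x \<le> - \<rho> / 2 - \<kappa>" using \<kappa>(2) that close[of x] by force
      moreover have "- \<rho> \<le> g x" unfolding g_def by (rule mollified_envelope_range(1)[OF U \<rho> reach \<eta>])
      ultimately have "\<kappa> \<le> \<rho>" using \<rho> by linarith
      then have 1: "0 \<le> 1 - \<kappa> / \<rho>" using \<rho> by simp
      have "2 * (g x + \<rho>) / \<rho> \<le> (\<rho> - 2 * \<kappa>) / \<rho>"
        using gx \<rho> by (intro divide_right_mono) auto
      also have "\<dots> = 1 - 2 * (\<kappa> / \<rho>)" using \<rho> by (simp add: diff_divide_distrib)
      also have "\<dots> \<le> (1 - \<kappa> / \<rho>)\<^sup>2" by (simp add: power2_diff)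
      finally have "(norm (grad g x))\<^sup>2 \<le> (1 - \<kappa> / \<rho>)\<^sup>2" using G(1)[of x] by linarith
      then show ?thesis using 1 by (rule power2_le_imp_le)
    qed
    \<comment> \<open>The prescribed divergence must be smooth, so measurable \<open>A\<close> is
      squeezed between a compact set \<open>T\<close>, where the divergence is exactly -lam, and an
      open set \<open>V\<close> of small area.\<close>
    obtain V' where V': "open V'" "A \<subseteq> V'" "V' - A \<in> lmeasurable" "emeasure lebesgue (V' - A) < ennreal \<delta>"
      by (rule sets_lebesgue_outer_open[OF A(1) \<delta>])
    define V where "V = V' \<inter> W"
    have V: "open V" "A \<subseteq> V" "V \<subseteq> W" unfolding V_def using V' W(1) A(2) by auto
    have Vm: "emeasure lborel V \<le> ennreal (\<beta>\<^sup>2)"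
    proof -
      have "emeasure lborel V = emeasure lebesgue V" using V(1) by simp
      also have "\<dots> \<le> emeasure lebesgue (A \<union> (V' - A))"
        by (rule emeasure_mono) (use V_def A(1) V'(1) in auto)
      also have "\<dots> \<le> emeasure lebesgue A + emeasure lebesgue (V' - A)"
        by (rule emeasure_subadditive) (use A(1) V'(3) in auto)
      also have "\<dots> \<le> ennreal \<delta> + ennreal \<delta>"
        by (intro add_mono) (use A(3) V'(4) in auto)
      also have "\<dots> = ennreal (\<beta>\<^sup>2)" unfolding \<delta>_def by (simp flip: ennreal_plus)
      finally show ?thesis .
    qed
    \<comment> \<open>On \<open>A - T\<close> the divergence may exceed -lam by as much as 2 lam;
      this area bound keeps the loss below e / 2.\<close>
    have "0 < e / (4 * lam)" using e lam0 by simp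
    then obtain T where T: "closed T" "T \<subseteq> A" "A - T \<in> lmeasurable" "emeasure lebesgue (A - T) < ennreal (e / (4 * lam))"
      by (rule sets_lebesgue_inner_closed[OF A(1)])
    have "bounded T" using T(2) A(2) WU U(2) bounded_subset by blast
    then have "compact T" using T(1) by (simp add: compact_eq_bounded_closed)
    moreover have "T \<subseteq> V" using T(2) V(2) by blast
    ultimately obtain a L' where a: "a \<in> test_forms" "\<And>x. 0 \<le> a x" "\<And>x. a x \<le> (1::real)"
      "\<And>x. x \<in> T \<Longrightarrow> a x = 1" "L' \<subseteq> V" "\<And>x. x \<notin> L' \<Longrightarrow> a x = 0"
      using smooth_urysohn[OF _ V(1)] by metis
    have aV: "a x = 0" if "x \<notin> V" for x using a(5,6) that by blast
    \<comment> \<open>Added to \<open>laplacian g\<close>, this interpolates between the Laplacian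
      where \<open>a\<close> is 0 and -lam where \<open>a\<close> is 1.\<close>
    define f where "f x = a x * (- lam - laplacian g x)" for x
    have ft: "f \<in> test_forms" unfolding f_def
      by (intro test_forms_mult a smooth_minus smooth_const test_forms_smooth lt)
    have fV: "f x = 0" if "x \<notin> V" for x using aV[OF that] unfolding f_def by simp
    have fsupp: "f x = 0" if "norm x > R" for x
      by (rule fV) (use that V(3) WU R(2) in force)
    have fb: "\<bar>f x\<bar> \<le> (2 * lam) * indicator V x" for x
    proof (cases "x \<in> V")
      case True
      have "\<bar>f x\<bar> \<le> 1 * (2 * lam)"
        unfolding f_def abs_mult using a(2,3)[of x] gl[of x] lam lam0 by (intro mult_mono) auto
      then show ?thesis using True by simp
    qed (simp add: fV)
    have "\<exists>p q. smooth p \<and> smooth q \<and> (\<forall>x. norm x \<le> R \<longrightarrow> pderiv_at 1 p x + pderiv_at 2 q x = f x) \<and>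
      (\<forall>x. \<bar>p x\<bar> \<le> 2 * lam * (\<beta> + \<beta>\<^sup>2 / (2 * \<beta>)) \<and> \<bar>q x\<bar> \<le> 2 * lam * (\<beta> + \<beta>\<^sup>2 / (2 * \<beta>)))"
      by (rule divergence_solver[OF ft fsupp R(1) _ Vm _ \<beta> fb]) (use V(1) lam0 in auto)
    moreover have "2 * lam * (\<beta> + \<beta>\<^sup>2 / (2 * \<beta>)) = 3 * lam * \<beta>"
      using \<beta> by (simp add: power2_eq_square)
    ultimately obtain p q where pq: "smooth p" "smooth q"
      and div: "\<And>x. norm x \<le> R \<Longrightarrow> pderiv_at 1 p x + pderiv_at 2 q x = f x"
      and pb: "\<And>x. \<bar>p x\<bar> \<le> 3 * lam * \<beta>" and qb: "\<And>x. \<bar>q x\<bar> \<le> 3 * lam * \<beta>"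
      by auto
    \<comment> \<open>The solutions \<open>p\<close> and \<open>q\<close> need not vanish near the
      frontier, hence the factor \<xi>. Its derivatives vanish on \<open>W\<close>, so the
      product-rule error stays away from the set \<open>V\<close> where \<open>f\<close>
      lives.\<close>
    define P where "P x = \<xi> x * p x" for x
    define Q where "Q x = \<xi> x * q x" for x
    have Pt: "P \<in> test_forms" and Qt: "Q \<in> test_forms"
      unfolding P_def Q_def by (intro test_forms_mult \<xi>(1) pq)+
    have PL: "P x = 0" "Q x = 0" if "x \<notin> L" for x using L(3)[OF that] unfolding P_def Q_def by auto
    have \<xi>d: "\<xi> differentiable (at x)" for x using \<xi>(1) test_forms_smooth smooth_differentiable by blast
    have dP: "pderiv_at i P x = pderiv_at i \<xi> x * p x + \<xi> x * pderiv_at i p x" for i x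
      unfolding P_def by (rule pderiv_at_mult[OF \<xi>d smooth_differentiable[OF pq(1)]])
    have dQ: "pderiv_at i Q x = pderiv_at i \<xi> x * q x + \<xi> x * pderiv_at i q x" for i x
      unfolding Q_def by (rule pderiv_at_mult[OF \<xi>d smooth_differentiable[OF pq(2)]])
    have gi: "pderiv_at i g \<in> test_forms" for i by (rule pderiv_at_test_forms[OF gt])
    \<comment> \<open>The coefficients are those of the field (pderiv_at 1 g + P, pderiv_at 2 g + Q)
      turned by a right angle, which makes \<open>ext_deriv\<close> its divergence.\<close>
    define \<phi> where "\<phi> x = (vector [(-1) *\<^sub>R (pderiv_at 2 g x + Q x), pderiv_at 1 g x + P x] :: real^2)" for x
    have \<phi>t: "\<phi> \<in> test_forms" unfolding \<phi>_def
      by (intro test_forms_vec2 test_forms_scaleR test_forms_add gi Pt Qt)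
    define D where "D x = pderiv_at 1 P x + pderiv_at 2 Q x" for x
    have Dt: "D \<in> test_forms" unfolding D_def by (intro test_forms_add pderiv_at_test_forms Pt Qt)
    have d\<phi>: "ext_deriv \<phi> x = laplacian g x + D x" for x
    proof -
      have diff: "h differentiable (at x)" if "h \<in> test_forms" for h :: "real^2 \<Rightarrow> real"
        using that test_forms_smooth smooth_differentiable by blast
      have "pderiv_at 2 (\<lambda>y. (-1) *\<^sub>R (pderiv_at 2 g y + Q y)) x
          = (-1) *\<^sub>R pderiv_at 2 (\<lambda>y. pderiv_at 2 g y + Q y) x"
        by (intro pderiv_at_bounded_linear(2)[OF bounded_linear_scaleR_right] diff test_forms_add gi Qt)
      then show ?thesis
        unfolding ext_deriv_def \<phi>_def D_def laplacian_def
        by (simp add: pderiv_at_add[OF diff[OF gi] diff[OF Pt]] pderiv_at_add[OF diff[OF gi] diff[OF Qt]])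
    qed
    have D: "D x = pderiv_at 1 \<xi> x * p x + pderiv_at 2 \<xi> x * q x + f x" for x
    proof -
      have "\<xi> x * (pderiv_at 1 p x + pderiv_at 2 q x) = f x"
      proof (cases "x \<in> L")
        case True
        then have "norm x \<le> R" using L(2) R(2) by force
        then have "pderiv_at 1 p x + pderiv_at 2 q x = f x" by (rule div)
        moreover have "\<xi> x * f x = f x"
          using fV[of x] \<xi>(4)[of x] V(3) closure_subset[of W] by (cases "x \<in> V") auto
        ultimately show ?thesis by simp
      next
        case False
        then have "x \<notin> closure W" using \<xi>(4)[of x] L(3)[of x] by auto
        then have "x \<notin> V" using V(3) closure_subset[of W] by blast
        then show ?thesis using fV L(3)[OF False] by simp
      qed
      then show ?thesis unfolding D_def dP dQ by (simp add: algebra_simps)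
    qed
    have \<xi>W: "pderiv_at i \<xi> x = 0" if "x \<in> W" for i x
      by (rule pderiv_at_locally_const[OF W(1) that, of _ 1]) (use \<xi>(4) closure_subset in blast)
    \<comment> \<open>On \<open>V\<close> there is no cut-off error, so the total divergence is a
      convex combination of \<open>laplacian g\<close> and -lam and cannot leave
      [-lam, lam].\<close>
    have DV: "laplacian g x + D x = (1 - a x) * (laplacian g x + lam) - lam" if "x \<in> V" for x
      using that V(3) \<xi>W[of x] unfolding D f_def by (simp add: subset_iff algebra_simps)
    have bound1: "norm (\<phi> x) \<le> 1" for x
    proof -
      have "norm (\<phi> x) = norm (grad g x + vector [P x, Q x])"
        by (simp add: norm_vec_def L2_set_def sum_2 \<phi>_def grad_def add.commute power2_commute[of _ "- _"])
          (simp add: power2_eq_square algebra_simps)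
      also have "\<dots> \<le> norm (grad g x) + norm (vector [P x, Q x] :: real^2)" by (rule norm_triangle_ineq)
      also have "norm (vector [P x, Q x] :: real^2) \<le> \<bar>P x\<bar> + \<bar>Q x\<bar>"
        using norm_le_l1_cart[of "vector [P x, Q x] :: real^2"] by (simp add: sum_2)
      finally have 1: "norm (\<phi> x) \<le> norm (grad g x) + (\<bar>P x\<bar> + \<bar>Q x\<bar>)" by simp
      show ?thesis
      proof (cases "x \<in> L")
        case True
        have "\<bar>P x\<bar> \<le> 1 * (3 * lam * \<beta>)" "\<bar>Q x\<bar> \<le> 1 * (3 * lam * \<beta>)"
          unfolding P_def Q_def abs_mult using \<xi>(2,3)[of x] pb[of x] qb[of x] by (intro mult_mono; simp)+
        then show ?thesis using 1 GL[OF True] \<beta>1 by linarith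
      next
        case False
        then show ?thesis using 1 G(2)[of x] PL by simp
      qed
    qed
    have bound2: "\<bar>ext_deriv \<phi> x\<bar> \<le> lam" for x
    proof (cases "x \<in> V")
      case True
      have "0 \<le> (1 - a x) * (laplacian g x + lam)" using a(3)[of x] gl[of x] lam by (intro mult_nonneg_nonneg) linarith+
      moreover have "(1 - a x) * (laplacian g x + lam) \<le> 1 * (2 * lam)"
        using a(2,3)[of x] gl[of x] lam lam0 by (intro mult_mono) auto
      ultimately show ?thesis unfolding d\<phi> DV[OF True] by (simp add: abs_le_iff)
    next
      case False
      have "\<bar>pderiv_at 1 \<xi> x * p x\<bar> \<le> C1 * (3 * lam * \<beta>)" "\<bar>pderiv_at 2 \<xi> x * q x\<bar> \<le> C2 * (3 * lam * \<beta>)"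
        unfolding abs_mult using C1 C2 pb[of x] qb[of x] by (intro mult_mono; simp)+
      moreover have "C1 * (3 * lam * \<beta>) + C2 * (3 * lam * \<beta>) = 3 * lam * \<beta> * (C1 + C2)" by (simp add: algebra_simps)
      ultimately show ?thesis
        unfolding d\<phi> D fV[OF False] using gl[of x] \<beta>2 by linarith
    qed
    have Um: "U \<in> sets lebesgue" using U(1) by simp
    have AU: "A \<subseteq> U" using A(2) WU by blast
    \<comment> \<open>The correction is supported in a compact subset of \<open>U\<close>, so its
      divergence integrates to zero and the perimeter estimate for \<open>g\<close> carries over to
      \<phi>.\<close>
    have "E2 U D = 0"
    proof -
      have DU: "D x = 0" if "x \<notin> U" for x
      proof -
        have "x \<in> - L" "open (- L)" using that L compact_imp_closed by auto
        then have "pderiv_at 1 P x = 0" "pderiv_at 2 Q x = 0"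
          using pderiv_at_locally_const[of "- L" x P 0] pderiv_at_locally_const[of "- L" x Q 0] PL by auto
        then show ?thesis unfolding D_def by simp
      qed
      have zero: "integral\<^sup>L lborel (pderiv_at i h) = 0" if h: "h \<in> test_forms" for i and h :: "real^2 \<Rightarrow> real"
      proof -
        obtain B where "\<forall>x. norm x > B \<longrightarrow> h x = 0" using test_forms_support[OF h] by blast
        then show ?thesis
          using h by (intro integral_pderiv_zero[of h i B])
            (auto intro: smooth_differentiable smooth_continuous_on smooth_pderiv_at test_forms_smooth)
      qed
      have "E2 U D = integral\<^sup>L lebesgue D"
        unfolding E2_eq using DU by (intro Bochner_Integration.integral_cong) (auto simp: indicator_def)
      also have "\<dots> = integral\<^sup>L lborel D"
        using integrable_test_form[OF Dt] by (intro integral_completion borel_measurable_integrable)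
      also have "\<dots> = 0"
        unfolding D_def using integrable_test_form[OF pderiv_at_test_forms[OF Pt]]
          integrable_test_form[OF pderiv_at_test_forms[OF Qt]] zero[OF Pt] zero[OF Qt] by simp
      finally show ?thesis .
    qed
    then have U\<phi>: "E2 U (ext_deriv \<phi>) = E2 U (laplacian g)"
      using E2_add[OF lt Dt Um] d\<phi>[abs_def] by simp
    have Af: "A \<in> lmeasurable" using A(1,3) by (intro fmeasurableI) (auto intro: less_le_trans)
    have "E2 A (ext_deriv \<phi>) \<le> - lam * measure lebesgue A + 2 * lam * measure lebesgue (A - T)"
    proof -
      have i1: "integrable lebesgue (\<lambda>x. (2 * lam) * indicator (A - T) x)" and i2: "integrable lebesgue (\<lambda>x. lam * indicator A x)"
        using T(3) Af by (intro integrable_mult_right integrable_real_indicator; simp add: fmeasurable_def)+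
      have "E2 A (ext_deriv \<phi>) \<le> (LINT x|lebesgue. (2 * lam) * indicator (A - T) x - lam * indicator A x)"
        unfolding E2_eq
      proof (rule integral_mono)
        show "integrable lebesgue (\<lambda>x. indicator A x * ext_deriv \<phi> x)"
          by (rule integrable_E2[OF ext_deriv_test_forms[OF \<phi>t] A(1)])
        show "integrable lebesgue (\<lambda>x. (2 * lam) * indicator (A - T) x - lam * indicator A x)"
          using i1 i2 by simp
        fix x
        show "indicator A x * ext_deriv \<phi> x \<le> (2 * lam) * indicator (A - T) x - lam * indicator A x"
        proof (cases "x \<in> A")
          case True
          then have xV: "x \<in> V" using V(2) by blast
          show ?thesis
          proof (cases "x \<in> T")
            case True
            then show ?thesis using \<open>x \<in> A\<close> a(4) unfolding d\<phi> DV[OF xV] by simp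
          next
            case False
            have "(1 - a x) * (laplacian g x + lam) \<le> 1 * (2 * lam)"
              using a(2,3)[of x] gl[of x] lam lam0 by (intro mult_mono) auto
            then show ?thesis using False \<open>x \<in> A\<close> unfolding d\<phi> DV[OF xV] by simp
          qed
        qed (use T(2) in auto)
      qed
      also have "\<dots> = - lam * measure lebesgue A + 2 * lam * measure lebesgue (A - T)"
        using i1 i2 by simp
      finally show ?thesis .
    qed
    moreover have "measure lebesgue (A - T) < e / (4 * lam)"
      using T(3,4) e lam0 by (simp add: emeasure_eq_measure2 ennreal_less_iff)
    then have "2 * lam * measure lebesgue (A - T) \<le> 2 * lam * (e / (4 * lam))"
      using lam0 by (intro mult_left_mono) auto
    then have "2 * lam * measure lebesgue (A - T) \<le> e / 2" using lam0 by simp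
    ultimately have "E2 U (ext_deriv \<psi>) + lam * measure lebesgue A - e \<le> E2 (U - A) (ext_deriv \<phi>)"
      unfolding E2_Diff[OF ext_deriv_test_forms[OF \<phi>t] A(1) Um AU] U\<phi> using per by linarith
    then show ?thesis using \<phi>t bound1 bound2 by blast
  qed
  show ?thesis
    using \<delta> main by (intro exI[of _ \<delta>]) blast
qed

section \<open>Flat costs and the minimality of the filling\<close>

lemma E2_is_current:
  assumes "B \<in> lmeasurable"
  shows "is_current (E2 B)"
  unfolding is_current_def
proof (intro conjI ballI allI impI)
  have B: "B \<in> sets lebesgue" using assms by (rule fmeasurableD)
  show "E2 B (\<lambda>x. \<phi> x + \<psi> x) = E2 B \<phi> + E2 B \<psi>" if "\<phi> \<in> test_forms" "\<psi> \<in> test_forms" for \<phi> \<psi>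
    using E2_add[OF that B] .
  show "E2 B (\<lambda>x. c *\<^sub>R \<phi> x) = c * E2 B \<phi>" for c \<phi>
    using E2_scale by simp
  fix K :: "(real^2) set"
  show "\<exists>C N. \<forall>\<phi>\<in>test_forms. supp \<phi> \<subseteq> K \<longrightarrow>
      \<bar>E2 B \<phi>\<bar> \<le> C * (\<Sum>js | length js \<le> N. SUP x. norm (iterated_pderiv js \<phi> x))"
  \<comment> \<open>Order 0 suffices: the sum then has the empty list as its only index and reduces
    to the sup norm.\<close>
  proof (intro exI[of _ "measure lebesgue B"] exI[of _ 0] ballI impI)
    fix \<phi> :: "real^2 \<Rightarrow> real" assume \<phi>: "\<phi> \<in> test_forms"
    obtain C where C: "\<forall>x. norm (\<phi> x) \<le> C" using test_forms_bounded[OF \<phi>] by blast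
    have "\<bar>\<phi> x\<bar> \<le> (SUP x. norm (\<phi> x))" for x
      using cSUP_upper[of x UNIV "\<lambda>x. norm (\<phi> x)"] C by (force intro: bdd_aboveI)
    then have "\<bar>E2 B \<phi>\<bar> \<le> (SUP x. norm (\<phi> x)) * measure lebesgue B"
      by (rule E2_bound[OF \<phi> assms])
    then show "\<bar>E2 B \<phi>\<bar> \<le> measure lebesgue B * (\<Sum>js::2 list | length js \<le> 0. SUP x. norm (iterated_pderiv js \<phi> x))"
      by (simp add: mult.commute)
  qed
qed

lemma mass_upper: "\<phi> \<in> test_forms \<Longrightarrow> (\<And>x. norm (\<phi> x) \<le> 1) \<Longrightarrow> ereal (T \<phi>) \<le> mass T"
  unfolding mass_def by (rule SUP_upper) simp

text \<open>Testing the two masses with \<open>\<phi>\<close> and \<open>ext_deriv \<phi> / lam\<close> makes the competitor \<open>S\<close> cancel.\<close>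

lemma flat_cost_ge:
  assumes S: "is_current S" and "0 < lam" and \<phi>: "\<phi> \<in> test_forms" "\<And>x. norm (\<phi> x) \<le> 1"
    and d\<phi>: "\<And>x. \<bar>ext_deriv \<phi> x\<bar> \<le> lam"
  shows "ereal (T \<phi>) \<le> flat_cost lam T S"
proof -
  let ?h = "\<lambda>x. (1 / lam) *\<^sub>R ext_deriv \<phi> x"
  have dt: "ext_deriv \<phi> \<in> test_forms" by (rule ext_deriv_test_forms[OF \<phi>(1)])
  have h: "?h \<in> test_forms" by (rule test_forms_scaleR[OF dt])
  have "S ?h = (1 / lam) * S (ext_deriv \<phi>)"
    using S dt unfolding is_current_def by blast
  then have "ereal (S (ext_deriv \<phi>)) = ereal lam * ereal (S ?h)" using \<open>0 < lam\<close> by simp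
  also have "\<dots> \<le> ereal lam * mass S"
    using \<open>0 < lam\<close> d\<phi> by (intro ereal_mult_left_mono mass_upper h) (auto simp: abs_le_iff field_simps)
  finally have 1: "ereal (S (ext_deriv \<phi>)) \<le> ereal lam * mass S" .
  have "ereal (T \<phi> - S (ext_deriv \<phi>)) \<le> mass (current_diff T (boundary S))"
    using mass_upper[OF \<phi>, of "current_diff T (boundary S)"] unfolding current_diff_def boundary_def .
  from add_mono[OF this 1] show ?thesis unfolding flat_cost_def by simp
qed

theorem theorem4p20:
  fixes U W :: "(real^2) set" and \<rho> lam :: real
  assumes "open U" and "bounded U"
    and "0 < \<rho>" and "ereal \<rho> < reach (frontier U)"
    and "open W" and "W \<subset>\<subset> U"
    and "0 < 2 / lam" and "2 / lam < \<rho>"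
  shows "\<exists>\<delta>>0. \<forall>A. A \<in> sets lebesgue \<and> A \<subset>\<subset> W \<and> emeasure lebesgue A < ennreal \<delta> \<longrightarrow>
           flat_norm_minimizer lam (boundary (E2 (U - A))) (boundary (E2 U))"
proof -
  have lam0: "0 < lam" using assms(7) by (simp add: zero_less_divide_iff)
  then have "2 < lam * \<rho>" using assms(8) by (simp add: pos_divide_less_eq mult.commute)
  then have lam: "0 < lam" "2 / \<rho> < lam" using lam0 assms(3) by (simp_all add: pos_divide_less_eq)
  obtain \<delta> where \<delta>: "\<delta> > 0" and cal: "\<And>A \<psi> e. A \<in> sets lebesgue \<Longrightarrow> A \<subseteq> W \<Longrightarrow> emeasure lebesgue A < ennreal \<delta> \<Longrightarrow>
    \<psi> \<in> test_forms \<Longrightarrow> (\<forall>x. norm (\<psi> x) \<le> 1) \<Longrightarrow> 0 < e \<Longrightarrow>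
    (\<exists>\<phi>\<in>test_forms. (\<forall>x. norm (\<phi> x) \<le> 1) \<and> (\<forall>x. \<bar>ext_deriv \<phi> x\<bar> \<le> lam) \<and>
       E2 U (ext_deriv \<psi>) + lam * measure lebesgue A - e \<le> E2 (U - A) (ext_deriv \<phi>))"
    using calibration[OF assms(1-6) lam(2)] by blast
  have "flat_norm_minimizer lam (boundary (E2 (U - A))) (boundary (E2 U))"
    if A: "A \<in> sets lebesgue" "A \<subset>\<subset> W" "emeasure lebesgue A < ennreal \<delta>" for A
  proof -
    \<comment> \<open>On test forms this filling is minus the current of \<open>A\<close>;
      subtracting its boundary restores the boundary of \<open>U\<close> at mass at most the area of
      \<open>A\<close>.\<close>
    define S where "S = current_diff (E2 (U - A)) (E2 U)"
    have AW: "A \<subseteq> W" using A(2) closure_subset unfolding compactly_inside_def by blast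
    then have AU: "A \<subseteq> U" using assms(6) closure_subset unfolding compactly_inside_def by blast
    have Um: "U \<in> lmeasurable" using assms(1,2) by (simp add: lmeasurable_open)
    have Am: "A \<in> lmeasurable" using A(1,3) by (intro fmeasurableI) (auto intro: less_le_trans)
    have Sh: "S h = - E2 A h" if "h \<in> test_forms" for h
      unfolding S_def current_diff_def using E2_Diff[OF that A(1) fmeasurableD[OF Um] AU] by simp
    have Scur: "is_current S"
    proof -
      have "is_current (E2 A)" by (rule E2_is_current[OF Am])
      then have "is_current (\<lambda>h. - E2 A h)" unfolding is_current_def by simp
      moreover have "(\<lambda>x. c * h x) \<in> test_forms" if "h \<in> test_forms" for c and h :: "real^2 \<Rightarrow> real"
        using test_forms_scaleR[OF that, of c] by simp
      \<comment> \<open>Off test forms the integrals may take default values and the two functionals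
        may differ, but \<open>is_current\<close> reads values on test forms only.\<close>
      then have "is_current S \<longleftrightarrow> is_current (\<lambda>h. - E2 A h)"
        unfolding is_current_def by (simp add: Sh test_forms_add)
      ultimately show ?thesis by simp
    qed
    have eq: "current_diff (boundary (E2 (U - A))) (boundary S) = boundary (E2 U)"
      unfolding S_def by (rule ext) (simp add: current_diff_def boundary_def)
    have "mass S \<le> ereal (measure lebesgue A)"
      unfolding mass_def
    proof (rule SUP_least)
      fix h :: "real^2 \<Rightarrow> real" assume h: "h \<in> {\<phi> \<in> test_forms. \<forall>x. norm (\<phi> x) \<le> 1}"
      then have "\<bar>E2 A h\<bar> \<le> 1 * measure lebesgue A" by (intro E2_bound Am) auto
      then show "ereal (S h) \<le> ereal (measure lebesgue A)" using Sh h by auto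
    qed
    then have "ereal lam * mass S \<le> ereal (lam * measure lebesgue A)"
      using ereal_mult_left_mono[of "mass S" "ereal (measure lebesgue A)" "ereal lam"] lam(1) by simp
    then have upper: "flat_cost lam (boundary (E2 (U - A))) S \<le> mass (boundary (E2 U)) + ereal (lam * measure lebesgue A)"
      unfolding flat_cost_def eq by (rule add_left_mono)
    \<comment> \<open>No single form calibrates exactly. The bound holds for each \<psi> up to
      \<open>e\<close>; letting \<open>e\<close> tend to 0 and then taking the supremum over \<psi>
      recovers the mass of the boundary.\<close>
    have lower: "mass (boundary (E2 U)) + ereal (lam * measure lebesgue A) \<le> flat_cost lam (boundary (E2 (U - A))) S'"
      if S': "is_current S'" for S'
    proof -
      let ?F = "flat_cost lam (boundary (E2 (U - A))) S'"
      have "ereal (E2 U (ext_deriv \<psi>)) \<le> ?F - ereal (lam * measure lebesgue A)"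
        if \<psi>: "\<psi> \<in> test_forms" "\<forall>x. norm (\<psi> x) \<le> 1" for \<psi>
      proof -
        have "ereal (E2 U (ext_deriv \<psi>) + lam * measure lebesgue A) \<le> ?F"
        proof (rule ereal_le_epsilon2)
          fix e :: real assume "0 < e"
          then obtain \<phi> where \<phi>: "\<phi> \<in> test_forms" "\<forall>x. norm (\<phi> x) \<le> 1" "\<forall>x. \<bar>ext_deriv \<phi> x\<bar> \<le> lam"
            "E2 U (ext_deriv \<psi>) + lam * measure lebesgue A - e \<le> E2 (U - A) (ext_deriv \<phi>)"
            using cal[OF A(1) AW A(3) \<psi>] by blast
          have "ereal (E2 U (ext_deriv \<psi>) + lam * measure lebesgue A - e) \<le> ?F"
            using flat_cost_ge[OF S' lam(1) \<phi>(1), of "boundary (E2 (U - A))"] \<phi>(2-4)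
            unfolding boundary_def by (meson ereal_less_eq(3) order_trans)
          then have "ereal (E2 U (ext_deriv \<psi>) + lam * measure lebesgue A - e) + ereal e \<le> ?F + ereal e"
            by (rule add_right_mono)
          then show "ereal (E2 U (ext_deriv \<psi>) + lam * measure lebesgue A) \<le> ?F + ereal e" by simp
        qed
        \<comment> \<open>The cost is an extended real: an infinite value makes the claim trivial,
          and minus infinity is excluded by the finite lower bound.\<close>
        then show ?thesis by (cases ?F) auto
      qed
      then have "mass (boundary (E2 U)) \<le> ?F - ereal (lam * measure lebesgue A)"
        unfolding mass_def boundary_def by (intro SUP_least) auto
      then show ?thesis by (simp add: ereal_le_minus)
    qed
    have "flat_cost lam (boundary (E2 (U - A))) S = flat_norm lam (boundary (E2 (U - A)))"
      unfolding flat_norm_def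
    proof (rule antisym)
      show "flat_cost lam (boundary (E2 (U - A))) S \<le> (INF S\<in>{S. is_current S}. flat_cost lam (boundary (E2 (U - A))) S)"
        using order_trans[OF upper lower] by (intro INF_greatest) auto
      show "(INF S\<in>{S. is_current S}. flat_cost lam (boundary (E2 (U - A))) S) \<le> flat_cost lam (boundary (E2 (U - A))) S"
        using Scur by (intro INF_lower) simp
    qed
    then show ?thesis
      unfolding flat_norm_minimizer_def current_eq_def using Scur eq by metis
  qed
  then show ?thesis using \<delta> by blast
qed

end
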